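(* Let $M\ge 2$ and $a$ be integers with $2\le a\le M$, and let $\zeta_n:=e^{2\pi i/n}$. For generic $z',z''\in\mathbb{C}$ (i.e. such that none of the Appell–Lerch series and theta quotients below has a pole) the following identities hold. (i) If $a$ and $M$ are both even, then \[ \overline{D}(a,M)+\overline{D}(a-1,M)=\chi(a=M)+2(-1)^{\frac a2}q^{-\frac{a^2}{4}}\,m\!\left((-1)^{\frac M2+1}q^{\frac{M^2}{4}-\frac{aM}{2}},\,q^{\frac{M^2}{2}},\,z'\right)-2q^{-1}\Psi^{\frac M2}_{\frac a2-1}(q^{-1},-1,z';q^2)-\frac{2}{M}\sum_{j=1}^{M-1}\zeta_{\frac M2}^{-\frac{aj}{2}}(1-\zeta_M^j)\,\Delta(\zeta_M^{-2j}q,\zeta_M^j,-1;q^2). \] (ii) If $a$ is even and $M$ is odd, then \[ \begin{aligned} \overline{D}(a,M)+\overline{D}(a-1,M)={}&-2q^{-(\frac{2M-a}{2})^2}(-1)^{\frac{2M-a}{2}}m(q^{M(a-M)},q^{2M^2},z')+2q^{-(\frac{M+1-a}{2})^2}(-1)^{\frac{M+1-a}{2}}m(q^{M(a-1)},q^{2M^2},z'')\\ &-2\Psi^{M}_{\frac{2M-a}{2}}(q,-1,z';q^2)+2\Psi^{M}_{\frac{M+1-a}{2}}(q,-1,z'';q^2)-\frac{2}{M}\sum_{j=1}^{M-1}\zeta_M^{-aj}(1-\zeta_M^j)\,\Delta(\zeta_M^{-2j}q,\zeta_M^j,-1;q^2). \end{aligned} \] (iii) If $a$ and $M$ are both odd,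 then \[ \begin{aligned} \overline{D}(a,M)+\overline{D}(a-1,M)={}&\chi(a=M)-2q^{-(\frac{M-a}{2})^2}(-1)^{\frac{M-a}{2}}m(q^{Ma},q^{2M^2},z')+2q^{-(\frac{2M-a+1}{2})^2}(-1)^{\frac{2M-a+1}{2}}m(q^{M(a-M-1)},q^{2M^2},z'')\\ &-2\Psi^{M}_{\frac{M-a}{2}}(q,-1,z';q^2)+2\Psi^{M}_{\frac{2M-a+1}{2}}(q,-1,z'';q^2)-\frac{2}{M}\sum_{j=1}^{M-1}\zeta_M^{-aj}(1-\zeta_M^j)\,\Delta(\zeta_M^{-2j}q,\zeta_M^j,-1;q^2). \end{aligned} \]
   Context: Throughout $q$ is a complex number with $0<|q|<1$ (identities may equivalently be read as identities of $q$-series). $(x;q)_\infty:=\prod_{k\ge0}(1-xq^k)$, $j(z;q):=(z;q)_\infty(q/z;q)_\infty(q;q)_\infty$, and $j(z_1,z_2;q):=j(z_1;q)j(z_2;q)$. $\chi(X)=1$ if $X$ is true and $0$ otherwise. Appell–Lerch series: for nonzero $x,z$ with $z$, $xz$ not integral powers of $q$, $m(x,q,z):=\frac{1}{j(z;q)}\sum_{r\in\mathbb{Z}}\frac{(-1)^rq^{\binom r2}z^r}{1-q^{r-1}xz}$. $\Delta(x,z_1,z_0;q):=\frac{z_0\,(q;q)_\infty^3\, j(z_1/z_0;q)\,j(xz_0z_1;q)}{j(z_0;q)\,j(z_1;q)\,j(xz_0;q)\,j(xz_1;q)}$ (so e.g. in $\Delta(\cdot,\cdot,\cdot;q^2)$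 the factor is $(q^2;q^2)_\infty^3$). For integers $n\ge1$, $k$: $\Psi^n_k(x,z,z';q):=-\frac{x^kz^{k+1}(q^{n^2};q^{n^2})_\infty^3}{j(z;q)\,j(z';q^{n^2})}\sum_{t=0}^{n-1}\frac{q^{\binom{t+1}{2}+kt}(-z)^t\, j\!\left(-q^{\binom{n+1}{2}+nk+nt}(-z)^n/z';q^{n^2}\right) j\!\left(q^{nt}(xz)^nz';q^{n^2}\right)}{j\!\left(-q^{\binom n2-nk}(-x)^nz';q^{n^2}\right) j\!\left(q^{nt}(xz)^n;q^{n^2}\right)}$, where when $q$ is replaced by $q^2$ every occurrence of $q$ (including in $(q^{n^2};q^{n^2})_\infty$) is replaced. An overpartition of $n$ is a partition of $n$ (non-increasing sequence of positive integers summing to $n$) in which the first occurrence of each distinct part may be overlined; $\overline{p}(n)$ is the number of overpartitions of $n$ ($\overline p(0)=1$). The rank of an overpartition is its largest part minus its number of parts (the empty overpartition has rank $0$). For integers $a$ and $M\ge2$, $\overline{N}(a,M,n)$ is the number of overpartitions of $n$ with rank congruent to $a$ modulo $M$, and $\overline{D}(a,M):=\sum_{n\ge0}\left(\overline N(a,M,n)-\frac{\overline p(n)}{M}\right)q^n$. *)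

theory Defs
  imports "HOL-Analysis.Analysis" "HOL-Number_Theory.Cong"
begin

section \<open>Theta functions and Appell--Lerch series\<close>

definition qpoch_inf :: "complex \<Rightarrow> complex \<Rightarrow> complex" where
  "qpoch_inf x q = prodinf (\<lambda>k::nat. 1 - x * q ^ k)"

definition jtheta :: "complex \<Rightarrow> complex \<Rightarrow> complex" where
  "jtheta z q = qpoch_inf z q * qpoch_inf (q / z) q * qpoch_inf q q"

text \<open>The binomial coefficient $r$ over 2 for an arbitrary integer $r$; the division is exact.\<close>

definition choose2 :: "int \<Rightarrow> int" where
  "choose2 r = r * (r - 1) div 2"

definition appell_m :: "complex \<Rightarrow> complex \<Rightarrow> complex \<Rightarrow> complex" where
  "appell_m x q z =
     1 / jtheta z q *
     (\<Sum>\<^sub>\<infinity>r\<in>(UNIV::int set).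
        (-1) powi r * q powi (choose2 r) * z powi r / (1 - q powi (r - 1) * x * z))"

definition appell_m_defined :: "complex \<Rightarrow> complex \<Rightarrow> complex \<Rightarrow> bool" where
  "appell_m_defined x q z \<longleftrightarrow>
     x \<noteq> 0 \<and> z \<noteq> 0 \<and> (\<forall>k::int. z \<noteq> q powi k) \<and> (\<forall>k::int. x * z \<noteq> q powi k)"

definition Delta :: "complex \<Rightarrow> complex \<Rightarrow> complex \<Rightarrow> complex \<Rightarrow> complex" where
  "Delta x z1 z0 q =
     z0 * qpoch_inf q q ^ 3 * jtheta (z1 / z0) q * jtheta (x * z0 * z1) q /
     (jtheta z0 q * jtheta z1 q * jtheta (x * z0) q * jtheta (x * z1) q)"

definition Psi :: "int \<Rightarrow> int \<Rightarrow> complex \<Rightarrow> complex \<Rightarrow> complex \<Rightarrow> complex \<Rightarrow> complex" where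
  "Psi n k x z z' q =
     (let Q = q powi (n^2) in
      - (x powi k * z powi (k + 1) * qpoch_inf Q Q ^ 3 / (jtheta z q * jtheta z' Q)) *
      (\<Sum>t = 0..n - 1.
         q powi (choose2 (t + 1) + k * t) * (- z) powi t *
         jtheta (- (q powi (choose2 (n + 1) + n * k + n * t)) * (- z) powi n / z') Q *
         jtheta (q powi (n * t) * (x * z) powi n * z') Q /
         (jtheta (- (q powi (choose2 n - n * k)) * (- x) powi n * z') Q *
          jtheta (q powi (n * t) * (x * z) powi n) Q)))"

text \<open>Genericity of \<open>z'\<close> for \<^const>\<open>Psi\<close>: the denominators involving \<open>z'\<close> do not vanish.
  The other denominators do not depend on \<open>z'\<close>; they are not constrained here.\<close>

definition Psi_generic :: "int \<Rightarrow> int \<Rightarrow> complex \<Rightarrow> complex \<Rightarrow> complex \<Rightarrow> bool" where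
  "Psi_generic n k x z' q \<longleftrightarrow>
     (let Q = q powi (n^2) in
      z' \<noteq> 0 \<and> jtheta z' Q \<noteq> 0 \<and>
      jtheta (- (q powi (choose2 n - n * k)) * (- x) powi n * z') Q \<noteq> 0)"

definition zeta :: "int \<Rightarrow> complex" where
  "zeta n = exp (2 * of_real pi * \<i> / of_int n)"


section \<open>Overpartitions and their ranks\<close>

text \<open>An overpartition is the non-increasing list of its parts, each paired with a flag telling
  whether it is overlined; only the first occurrence of a part may be overlined.\<close>

definition overpartitions :: "nat \<Rightarrow> (nat \<times> bool) list set" where
  "overpartitions n =
     {xs. sorted_wrt (\<ge>) (map fst xs) \<and> (\<forall>p\<in>set xs. fst p > 0) \<and> sum_list (map fst xs) = n \<and>
          (\<forall>i<length xs. snd (xs ! i) \<longrightarrow> (\<forall>j<i. fst (xs ! j) \<noteq> fst (xs ! i)))}"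

definition pbar :: "nat \<Rightarrow> nat" where
  "pbar n = card (overpartitions n)"

definition overpartition_rank :: "(nat \<times> bool) list \<Rightarrow> int" where
  "overpartition_rank xs =
     (if xs = [] then 0 else int (Max (fst ` set xs)) - int (length xs))"

definition Nbar :: "int \<Rightarrow> int \<Rightarrow> nat \<Rightarrow> nat" where
  "Nbar a M n = card {xs \<in> overpartitions n. [overpartition_rank xs = a] (mod M)}"

definition Dbar :: "int \<Rightarrow> int \<Rightarrow> complex \<Rightarrow> complex" where
  "Dbar a M q = (\<Sum>n. (of_nat (Nbar a M n) - of_nat (pbar n) / of_int M) * q ^ n)"

end

theory Submission
  imports Defs "HOL-Complex_Analysis.Complex_Analysis"
begin

text \<open>
  Splitting overpartitions by their largest part gives a series for the rank generating function
  $R(w)$, which satisfies a first-order $q$-difference equation under $w \mapsto qw$. The function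
  $(1-w)(1 - 2m(q/w^2, q^2, -1) - 2\Delta(q/w^2, w, -1; q^2))/(1+w)$ satisfies the same equation,
  so the difference times a product of theta functions is a $q$-periodic function on a punctured
  disc whose singularities are removable; it is constant by the maximum modulus principle, and it
  vanishes at $w = -1$. The same periodicity argument, in the variable $x$, proves
  $m(x,q,z_1) - m(x,q,z_0) = \Delta(x,z_1,z_0;q)$.

  Averaging $R$ over the $M$-th roots of unity turns $\overline{D}(a,M) + \overline{D}(a-1,M)$
  into sums of $\zeta^{-kt} m(\zeta^t x, q^2, -1)$. Expanding $m$ as a bilateral Lambert series and
  splitting the summation index modulo the order of $\zeta$ produces Appell--Lerch series to the base
  $q^{2n^2}$; moving all of them to the common parameter $z'$ creates the theta quotients in $\Psi$.
\<close>

section \<open>Sums over infinite index sets\<close>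

text \<open>There are two families of possible poles in the comparison for \<open>R(w)\<close>. At
  the powers of \<open>q\<close> they are at most simple, and a theta factor with a zero there
  removes them. At the points with \<open>w^2 = -q^(odd)\<close> both \<open>m\<close> and
  \<open>Delta\<close> are singular and must cancel each other: by the formula for changing
  \<open>z\<close>, their sum is a single Appell-Lerch series with parameter \<open>w\<close>, which
  is regular there. That formula therefore has to be available before \<open>R\<close> is treated.

  The residues \<open>a\<close> and \<open>a - 1\<close> are added because their Fourier
  coefficients combine to the factor \<open>1 + w\<close>, which is the denominator in the formula
  for \<open>R\<close>. The distinction by the parity of \<open>M\<close> comes from the argument
  \<open>q/w^2\<close>. For odd \<open>M\<close> squaring permutes the \<open>M\<close>-th roots of
  unity. For even \<open>M\<close> it covers the roots of order \<open>M/2\<close> twice, and over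
  the two preimages \<open>w\<close> and \<open>-w\<close> the factor \<open>1 - w\<close> adds up
  to 2.\<close>

lemma uniform_limit_infsum:
  fixes f :: "'i \<Rightarrow> 'a \<Rightarrow> complex"
  assumes bound: "\<And>i x. i \<in> I \<Longrightarrow> x \<in> X \<Longrightarrow> norm (f i x) \<le> M i"
    and M: "M summable_on I"
  shows "uniform_limit X (\<lambda>A x. \<Sum>i\<in>A. f i x) (\<lambda>x. \<Sum>\<^sub>\<infinity>i\<in>I. f i x) (finite_subsets_at_top I)"
proof (rule uniform_limitI)
  fix e :: real assume e: "e > 0"
  have "((\<lambda>A. sum M A) \<longlongrightarrow> infsum M I) (finite_subsets_at_top I)"
    using M by (rule infsum_tendsto)
  then have "eventually (\<lambda>A. dist (sum M A) (infsum M I) < e) (finite_subsets_at_top I)"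
    using e by (rule tendstoD)
  moreover have "eventually (\<lambda>A. finite A \<and> A \<subseteq> I) (finite_subsets_at_top I)"
    by (rule eventually_finite_subsets_at_top_weakI) auto
  ultimately show "\<forall>\<^sub>F A in finite_subsets_at_top I.
      \<forall>x\<in>X. dist (\<Sum>i\<in>A. f i x) (\<Sum>\<^sub>\<infinity>i\<in>I. f i x) < e"
  proof eventually_elim
    case (elim A)
    show ?case
    proof
      fix x assume x: "x \<in> X"
      have fin: "finite A" "A \<subseteq> I" using elim by auto
      have sumf: "(\<lambda>i. f i x) summable_on I"
        by (rule abs_summable_summable, rule summable_on_comparison_test[OF M]) (use bound x in auto)
      have "(\<Sum>\<^sub>\<infinity>i\<in>I. f i x) = (\<Sum>\<^sub>\<infinity>i\<in>A \<union> (I - A). f i x)"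
        using fin by (simp add: Un_absorb1)
      also have "\<dots> = (\<Sum>i\<in>A. f i x) + (\<Sum>\<^sub>\<infinity>i\<in>I - A. f i x)"
        using fin sumf summable_on_subset[OF sumf, of "I - A"] by (subst infsum_Un_disjoint) auto
      finally have 1: "norm ((\<Sum>i\<in>A. f i x) - (\<Sum>\<^sub>\<infinity>i\<in>I. f i x)) = norm (\<Sum>\<^sub>\<infinity>i\<in>I - A. f i x)"
        by (simp add: norm_minus_commute)
      have MA: "M summable_on (I - A)" using M by (rule summable_on_subset) auto
      have fA: "(\<lambda>i. f i x) summable_on (I - A)" using sumf by (rule summable_on_subset) auto
      have "infsum M I = infsum M (A \<union> (I - A))"
        using fin by (simp add: Un_absorb1)
      also have "\<dots> = sum M A + infsum M (I - A)"
        using fin MA by (subst infsum_Un_disjoint) auto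
      finally have 2: "infsum M (I - A) = infsum M I - sum M A" by simp
      have "norm (\<Sum>\<^sub>\<infinity>i\<in>I - A. f i x) \<le> infsum M (I - A)"
        by (rule norm_infsum_le[OF has_sum_infsum[OF fA] has_sum_infsum[OF MA]]) (use bound x in auto)
      also have "\<dots> < e" using elim unfolding 2 by (auto simp: dist_real_def)
      finally show "dist (\<Sum>i\<in>A. f i x) (\<Sum>\<^sub>\<infinity>i\<in>I. f i x) < e"
        unfolding dist_norm 1 .
    qed
  qed
qed

text \<open>Tannery's theorem for unordered sums: the majorant makes the finite partial sums
  converge uniformly in \<open>x\<close>, so the two limits may be exchanged. It carries the finite
  triple product to the infinite one.\<close>

lemma tendsto_infsum_dominated:
  fixes f :: "'i \<Rightarrow> 'a \<Rightarrow> complex"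
  assumes bound: "\<And>i x. i \<in> I \<Longrightarrow> norm (f i x) \<le> M i"
    and M: "M summable_on I"
    and lim: "\<And>i. i \<in> I \<Longrightarrow> (f i \<longlongrightarrow> g i) F"
    and F: "F \<noteq> bot"
  shows "((\<lambda>x. \<Sum>\<^sub>\<infinity>i\<in>I. f i x) \<longlongrightarrow> (\<Sum>\<^sub>\<infinity>i\<in>I. g i)) F"
proof (rule swap_uniform_limit'[OF _ _ uniform_limit_infsum[of I UNIV f M]])
  show "\<forall>\<^sub>F A in finite_subsets_at_top I. ((\<lambda>x. \<Sum>i\<in>A. f i x) \<longlongrightarrow> sum g A) F"
    by (rule eventually_finite_subsets_at_top_weakI) (use lim in \<open>auto intro!: tendsto_sum\<close>)
  have "norm (g i) \<le> M i" if "i \<in> I" for i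
    using tendsto_upperbound[OF tendsto_norm[OF lim[OF that]] _ F] bound[OF that] by simp
  then have "g summable_on I"
    by (rule abs_summable_summable[OF summable_on_comparison_test[OF M]]) auto
  then show "(sum g \<longlongrightarrow> (\<Sum>\<^sub>\<infinity>i\<in>I. g i)) (finite_subsets_at_top I)"
    by (rule infsum_tendsto)
qed (simp_all add: M bound)

lemma bounded_on_cball:
  fixes f :: "complex \<Rightarrow> complex"
  assumes "continuous_on (cball w d) f"
  obtains B where "\<And>v. v \<in> cball w d \<Longrightarrow> norm (f v) \<le> B"
proof -
  have "bounded (f ` cball w d)"
    by (rule compact_imp_bounded[OF compact_continuous_image[OF assms compact_cball]])
  with that show thesis unfolding bounded_iff by blast
qed

text \<open>Near a given point finitely many terms of a Lerch sum may have small denominators and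
  escape the common majorant. The set \<open>E\<close> collects them; each is continuous on the
  closed disc and hence bounded there.\<close>

lemma holomorphic_on_infsum:
  fixes f :: "'i \<Rightarrow> complex \<Rightarrow> complex"
  assumes S: "open S"
    and hol: "\<And>i. i \<in> I \<Longrightarrow> f i holomorphic_on S"
    and bound: "\<And>z. z \<in> S \<Longrightarrow> \<exists>r>0. \<exists>M E. cball z r \<subseteq> S \<and> finite E \<and> M summable_on I \<and>
                  (\<forall>i\<in>I - E. \<forall>w\<in>cball z r. norm (f i w) \<le> M i)"
  shows "(\<lambda>z. \<Sum>\<^sub>\<infinity>i\<in>I. f i z) holomorphic_on S"
proof -
  have "(\<lambda>z. \<Sum>\<^sub>\<infinity>i\<in>I. f i z) field_differentiable (at z)" if z: "z \<in> S" for z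
  proof -
    obtain r M E where r: "r > 0" "cball z r \<subseteq> S" "finite E" "M summable_on I"
      and le: "\<And>i w. i \<in> I - E \<Longrightarrow> w \<in> cball z r \<Longrightarrow> norm (f i w) \<le> M i"
      using bound[OF z] by blast
    have cont: "continuous_on (cball z r) (f i)" if "i \<in> I" for i
      using hol[OF that] r(2) holomorphic_on_imp_continuous_on holomorphic_on_subset by blast
    have "\<exists>B. \<forall>w\<in>cball z r. norm (f i w) \<le> B" if "i \<in> I" for i
      using bounded_on_cball[OF cont[OF that]] by metis
    then obtain B where B: "\<And>i w. i \<in> I \<Longrightarrow> w \<in> cball z r \<Longrightarrow> norm (f i w) \<le> B i"
      by metis
    define N where "N = (\<lambda>i. if i \<in> E then B i else M i)"
    have "N summable_on I"
    proof -
      have "N summable_on (I \<inter> E) \<union> (I - E)"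
      proof (rule summable_on_union)
        show "N summable_on I - E"
          using summable_on_subset[OF r(4), of "I - E"]
          by (subst summable_on_cong[where g=M]) (auto simp: N_def)
      qed (use r in auto)
      then show ?thesis by (simp add: Int_Diff_Un)
    qed
    then have ul: "uniform_limit (cball z r) (\<lambda>A x. \<Sum>i\<in>A. f i x) (\<lambda>x. \<Sum>\<^sub>\<infinity>i\<in>I. f i x) (finite_subsets_at_top I)"
      by (intro uniform_limit_infsum[where M=N]) (use le B in \<open>auto simp: N_def\<close>)
    have ev: "\<forall>\<^sub>F A in finite_subsets_at_top I. continuous_on (cball z r) (\<lambda>x. \<Sum>i\<in>A. f i x) \<and>
        (\<lambda>x. \<Sum>i\<in>A. f i x) holomorphic_on ball z r"
      by (rule eventually_finite_subsets_at_top_weakI)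
        (use cont hol r(2) in \<open>auto intro!: continuous_on_sum holomorphic_on_sum
           intro: holomorphic_on_subset[OF _ order_trans[OF ball_subset_cball]]\<close>)
    have "(\<lambda>x. \<Sum>\<^sub>\<infinity>i\<in>I. f i x) holomorphic_on ball z r"
      by (rule holomorphic_uniform_limit[OF ev ul finite_subsets_at_top_neq_bot])
    then show ?thesis
      using r(1) holomorphic_on_imp_differentiable_at[of _ "ball z r" z] by auto
  qed
  then show ?thesis
    by (simp add: field_differentiable_at_within holomorphic_on_def)
qed

lemma has_sum_int_shift:
  fixes f :: "int \<Rightarrow> complex"
  assumes "(f has_sum S) UNIV"
  shows "((\<lambda>r. f (r + d)) has_sum S) UNIV"
  by (rule has_sum_reindex_bij_witness[THEN iffD1, OF _ _ _ _ _ _ assms, of "\<lambda>r. r + d" "\<lambda>r. r - d"]) auto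

section \<open>The theta function\<close>

text \<open>The base is a locale parameter because the same theory is applied to several bases:
  \<open>q\<close>, \<open>q ^ 2\<close>, the base \<open>Q\<close> of the multisection, and the
  real number \<open>norm q\<close> in the convergence estimates.\<close>

locale nome =
  fixes q :: complex
  assumes q_nz [simp]: "q \<noteq> 0" and q_lt1: "norm q < 1"
begin

lemma power_q_neq_1:
  assumes "n > 0"
  shows "q ^ n \<noteq> 1"
proof
  assume "q ^ n = 1"
  then have "norm q ^ n = 1" by (simp flip: norm_power)
  then show False using q_lt1 power_less_one_iff[of "norm q" n] assms by simp
qed

lemma nome_square: "nome (q ^ 2)"
  by standard (use q_lt1 in \<open>auto simp: norm_power power_less_one_iff\<close>)

lemma powi_q_eq_iff: "q powi m = q powi n \<longleftrightarrow> m = n"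
proof -
  have *: "norm q powi n < norm q powi m" if "m < n" for m n :: int
    using that q_lt1 by (intro power_int_strict_decreasing) auto
  have "m = n" if "q powi m = q powi n"
    using that *[of m n] *[of n m] norm_power_int[of q m] norm_power_int[of q n]
    by (cases m n rule: linorder_cases) auto
  then show ?thesis by blast
qed

lemma convergent_qpoch: "convergent_prod (\<lambda>k. 1 - x * q ^ k)"
proof (rule abs_convergent_prod_imp_convergent_prod, rule summable_imp_abs_convergent_prod)
  show "summable (\<lambda>k. norm (1 - x * q ^ k - 1))"
    using q_lt1 by (auto simp: norm_mult norm_power intro!: summable_mult)
qed

lemma qpoch_LIMSEQ: "(\<lambda>n. \<Prod>k<n. 1 - x * q ^ k) \<longlonglongrightarrow> qpoch_inf x q"
  using convergent_prod_LIMSEQ[OF convergent_qpoch]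
  unfolding qpoch_inf_def using LIMSEQ_lessThan_iff_atMost by blast

lemma qpoch_eq_0_iff: "qpoch_inf x q = 0 \<longleftrightarrow> (\<exists>n::nat. x * q ^ n = 1)"
  using has_prod_eq_0_iff[OF convergent_prod_has_prod[OF convergent_qpoch, of x]]
  unfolding qpoch_inf_def by (auto simp: image_iff)

lemma qpoch_step: "qpoch_inf x q = (1 - x) * qpoch_inf (x * q) q"
proof -
  have "(\<lambda>n. (1 - x) * (\<Prod>k<n. 1 - (x * q) * q ^ k)) \<longlonglongrightarrow> (1 - x) * qpoch_inf (x * q) q"
    by (intro tendsto_intros qpoch_LIMSEQ)
  moreover have "(1 - x) * (\<Prod>k<n. 1 - (x * q) * q ^ k) = (\<Prod>k<Suc n. 1 - x * q ^ k)" for n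
    by (simp only: prod.lessThan_Suc_shift) (simp add: mult_ac)
  ultimately show ?thesis
    using LIMSEQ_unique[OF LIMSEQ_Suc[OF qpoch_LIMSEQ[of x]]] by simp
qed

lemma holomorphic_qpoch: "(\<lambda>x. qpoch_inf x q) holomorphic_on UNIV"
proof (rule holomorphic_uniform_sequence[where f = "\<lambda>n x. \<Prod>k<n. 1 - x * q ^ k"])
  fix x :: complex
  define C where "C = cball x 1"
  obtain B where B: "\<And>y. y \<in> C \<Longrightarrow> norm y \<le> B"
    using compact_imp_bounded[OF compact_cball[of x 1]] unfolding C_def unfolding bounded_iff by blast
  have "uniformly_convergent_on C (\<lambda>N x. \<Prod>n<N. 1 - x * q ^ n)"
  proof (rule uniformly_convergent_on_prod')
    have "uniform_limit C (\<lambda>N x. \<Sum>n<N. norm (1 - x * q ^ n - 1)) (\<lambda>x. \<Sum>n. norm (1 - x * q ^ n - 1)) sequentially"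
      by (rule Weierstrass_m_test[where M="\<lambda>n. B * norm q ^ n"])
        (use q_lt1 B in \<open>auto simp: norm_mult norm_power intro!: mult_right_mono\<close>)
    then show "uniformly_convergent_on C (\<lambda>N x. \<Sum>n<N. norm (1 - x * q ^ n - 1))"
      by (rule uniformly_convergentI)
  qed (auto intro!: continuous_intros simp: C_def)
  then obtain l where l: "uniform_limit C (\<lambda>N x. \<Prod>n<N. 1 - x * q ^ n) l sequentially"
    by (auto simp: uniformly_convergent_on_def)
  have "l y = qpoch_inf y q" if "y \<in> C" for y
    using tendsto_uniform_limitI[OF l that] qpoch_LIMSEQ LIMSEQ_unique by blast
  then have "uniform_limit C (\<lambda>N x. \<Prod>n<N. 1 - x * q ^ n) (\<lambda>x. qpoch_inf x q) sequentially"
    using l by (simp cong: uniform_limit_cong')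
  then show "\<exists>d>0. cball x d \<subseteq> UNIV \<and>
        uniform_limit (cball x d) (\<lambda>n x. \<Prod>k<n. 1 - x * q ^ k) (\<lambda>x. qpoch_inf x q) sequentially"
    by (intro exI[of _ 1]) (auto simp: C_def)
qed (auto intro!: holomorphic_intros)

lemma qpoch_q_nz [simp]: "qpoch_inf q q \<noteq> 0"
proof -
  have "q * q ^ n \<noteq> 1" for n using power_q_neq_1[of "Suc n"] by simp
  then show ?thesis by (simp add: qpoch_eq_0_iff)
qed

text \<open>From \<open>z\<close> to \<open>q * z\<close> the first product loses the factor
  \<open>1 - z\<close> and the second gains \<open>1 - 1 / z\<close>; the quotient of the two is
  \<open>-1 / z\<close>.\<close>

lemma jtheta_q_shift:
  assumes z: "z \<noteq> 0"
  shows "jtheta (q * z) q = - jtheta z q / z"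
proof -
  have 1: "qpoch_inf (1 / z) q = (1 - 1 / z) * qpoch_inf (q / z) q"
    using qpoch_step[of "1 / z"] by simp
  have 2: "qpoch_inf z q = (1 - z) * qpoch_inf (q * z) q"
    using qpoch_step[of z] by (simp add: mult.commute)
  show ?thesis using z unfolding jtheta_def by (simp add: 1 2 field_simps)
qed

lemma jtheta_flip: "z \<noteq> 0 \<Longrightarrow> jtheta (q / z) q = jtheta z q"
  unfolding jtheta_def by (simp add: mult.commute)

lemma jtheta_inverse: "z \<noteq> 0 \<Longrightarrow> jtheta (1 / z) q = - jtheta z q / z"
  using jtheta_flip[of "q * z"] by (simp add: jtheta_q_shift)

lemma jtheta_eq_0_iff:
  assumes "z \<noteq> 0"
  shows "jtheta z q = 0 \<longleftrightarrow> (\<exists>k::int. z = q powi k)"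
proof
  assume "jtheta z q = 0"
  then consider n :: nat where "z * q ^ n = 1" | n :: nat where "q / z * q ^ n = 1"
    unfolding jtheta_def using qpoch_eq_0_iff[of z] qpoch_eq_0_iff[of "q / z"] qpoch_q_nz by fastforce
  then show "\<exists>k::int. z = q powi k"
  proof cases
    case 1
    then show ?thesis using assms
      by (intro exI[of _ "- int n"]) (simp add: power_int_minus field_simps)
  next
    case 2
    then show ?thesis using assms
      by (intro exI[of _ "int (Suc n)"]) (simp add: field_simps power_int_add del: of_nat_Suc flip: power_Suc)
  qed
next
  assume "\<exists>k::int. z = q powi k"
  then obtain k :: int where k: "z = q powi k" by blast
  show "jtheta z q = 0"
  proof (cases "k \<ge> 1")
    case True
    then have "q / z * q ^ nat (k - 1) = 1"
      unfolding k using power_int_add[of q 1 "k - 1"] by (simp add: power_int_def)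
    then show ?thesis unfolding jtheta_def using qpoch_eq_0_iff by auto
  next
    case False
    then have "z * q ^ nat (- k) = 1"
      unfolding k by (simp add: power_int_def flip: power_mult_distrib)
    then show ?thesis unfolding jtheta_def using qpoch_eq_0_iff by auto
  qed
qed

lemma holomorphic_jtheta: "(\<lambda>z. jtheta z q) holomorphic_on - {0}"
proof -
  have "(\<lambda>z. qpoch_inf (q / z) q) holomorphic_on - {0}"
    by (rule holomorphic_on_compose_gen[OF _ holomorphic_qpoch, of "\<lambda>z. q / z", unfolded o_def])
      (auto intro!: holomorphic_intros)
  then show ?thesis
    unfolding jtheta_def using holomorphic_on_subset[OF holomorphic_qpoch]
    by (auto intro!: holomorphic_intros)
qed

lemma jtheta_holomorphic_intros [holomorphic_intros]:
  assumes "f holomorphic_on A" and "\<And>z. z \<in> A \<Longrightarrow> f z \<noteq> 0"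
  shows "(\<lambda>z. jtheta (f z) q) holomorphic_on A"
  by (rule holomorphic_on_compose_gen[OF assms(1) holomorphic_jtheta, unfolded o_def])
    (use assms(2) in auto)

lemma jtheta_1 [simp]: "jtheta 1 q = 0"
  using jtheta_eq_0_iff[of 1] power_int_0_right by (metis one_neq_zero)

text \<open>Without its factor \<open>1 - z\<close> the first product is continuous at 1, where all
  three products equal \<open>qpoch_inf q q\<close>. The behaviour of theta quotients at their
  simple poles rests on this limit.\<close>

lemma jtheta_tendsto_1: "((\<lambda>z. jtheta z q / (1 - z)) \<longlongrightarrow> qpoch_inf q q ^ 3) (at 1)"
proof -
  define g where "g = (\<lambda>z. qpoch_inf (z * q) q * qpoch_inf (q / z) q * qpoch_inf q q)"
  have cont: "isCont (\<lambda>x. qpoch_inf x q) y" for y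
    using holomorphic_on_imp_continuous_on[OF holomorphic_qpoch]
    by (simp add: continuous_on_eq_continuous_at)
  have "isCont g 1"
    unfolding g_def by (intro continuous_intros isCont_o2[OF _ cont]) auto
  then have "(g \<longlongrightarrow> qpoch_inf q q ^ 3) (at 1)"
    by (simp add: isCont_def g_def power3_eq_cube)
  moreover have "\<forall>\<^sub>F z in at 1. g z = jtheta z q / (1 - z)"
    unfolding g_def jtheta_def
    by (subst (3) qpoch_step) (auto simp: eventually_at intro!: exI[of _ 1])
  ultimately show ?thesis
    by (rule Lim_transform_eventually)
qed

end

section \<open>Triangular numbers and Gaussian majorants\<close>

lemma choose2_double: "2 * choose2 r = r * (r - 1)"
  unfolding choose2_def by simp

lemma choose2_plus_1: "choose2 (r + 1) = choose2 r + r"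
  using choose2_double[of r] choose2_double[of "r + 1"] by (simp add: algebra_simps)

lemma choose2_minus_1: "choose2 (r - 1) = choose2 r - r + 1"
  using choose2_plus_1[of "r - 1"] by simp

lemma choose2_flip: "choose2 (1 - r) = choose2 r"
  using choose2_double[of r] choose2_double[of "1 - r"] by (simp add: algebra_simps)

lemma norm_powi_le:
  fixes z :: complex
  assumes "z \<noteq> 0" "norm z \<le> Z" "1 / norm z \<le> Z"
  shows "norm (z powi r) \<le> Z ^ nat \<bar>r\<bar>"
proof (cases "r \<ge> 0")
  case True
  then show ?thesis using assms by (auto simp: norm_power power_int_def intro!: power_mono)
next
  case False
  then have "norm (z powi r) = (1 / norm z) ^ nat \<bar>r\<bar>"
    by (simp add: norm_power norm_inverse norm_divide power_int_def field_simps)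
  also have "\<dots> \<le> Z ^ nat \<bar>r\<bar>" using assms by (intro power_mono) auto
  finally show ?thesis .
qed

context nome
begin

lemma eventually_small: "eventually (\<lambda>n. norm q ^ n * B \<le> 1 / 2) sequentially" for B :: real
proof -
  have "(\<lambda>n. norm q ^ n * B) \<longlonglongrightarrow> 0 * B"
    using q_lt1 by (intro tendsto_intros LIMSEQ_power_zero) auto
  then have "eventually (\<lambda>n. norm q ^ n * B < 1 / 2) sequentially"
    by (rule order_tendstoD) auto
  then show ?thesis by eventually_elim simp
qed

text \<open>\<open>Z\<close> stands for a common bound of \<open>|z|\<close> and
  \<open>1/|z|\<close>; one majorant then serves both ends of the bilateral sum and all
  \<open>z\<close> in a compact set avoiding 0.\<close>

abbreviation gauss_term :: "real \<Rightarrow> int \<Rightarrow> real" where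
  "gauss_term Z r \<equiv> norm q powi choose2 r * Z ^ nat \<bar>r\<bar>"

text \<open>In both directions the ratio of consecutive terms is \<open>Z\<close> times a power of
  \<open>norm q\<close> whose exponent grows without bound, so it drops below 1/2.\<close>

lemma summable_gauss:
  assumes Z: "Z > 0"
  shows "(\<lambda>r. gauss_term Z r) summable_on UNIV"
proof -
  define f where "f = (\<lambda>r. gauss_term Z r)"
  obtain N where N: "\<And>n. n \<ge> N \<Longrightarrow> norm q ^ n * Z \<le> 1 / 2"
    using eventually_small[of Z] unfolding eventually_sequentially by auto
  have nonneg: "f r \<ge> 0" for r using Z by (simp add: f_def)
  have step1: "f (int (Suc n)) = (norm q ^ n * Z) * f (int n)" for n
    using choose2_plus_1[of "int n"] by (simp add: f_def power_int_add ac_simps nat_add_distrib)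
  have step2: "f (- int (Suc n)) = (norm q ^ Suc n * Z) * f (- int n)" for n
  proof -
    have "choose2 (- int (Suc n)) = choose2 (- int n) + int (Suc n)"
    proof -
      have "- int (Suc n) = - int n - 1" by simp
      then show ?thesis using choose2_minus_1[of "- int n"] by (metis (no_types, lifting) add.assoc diff_minus_eq_add of_nat_Suc add.commute)
    qed
    moreover have "nat \<bar>- int (Suc n)\<bar> = Suc n" "nat \<bar>- int n\<bar> = n" by auto
    ultimately show ?thesis unfolding f_def by (simp only: power_int_add q_nz norm_eq_zero simp_thms power_int_of_nat power_Suc) (simp add: ac_simps)
  qed
  have "summable (\<lambda>n. f (int n))"
  proof (rule summable_ratio_test[of "1/2" N])
    fix n assume "n \<ge> N"
    then have "norm q ^ n * Z * f (int n) \<le> 1 / 2 * f (int n)"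
      by (intro mult_right_mono N nonneg)
    then show "norm (f (int (Suc n))) \<le> 1 / 2 * norm (f (int n))"
      unfolding step1 using nonneg[of "int n"] Z by simp
  qed auto
  then have "(\<lambda>n. f (int n)) summable_on UNIV"
    using nonneg by (intro summable_nonneg_imp_summable_on) auto
  then have 1: "f summable_on range int"
    by (subst summable_on_reindex) (auto simp: o_def)
  have "summable (\<lambda>n. f (- int n))"
  proof (rule summable_ratio_test[of "1/2" N])
    fix n assume "n \<ge> N"
    then have "norm q ^ Suc n * Z * f (- int n) \<le> 1 / 2 * f (- int n)"
      by (intro mult_right_mono N nonneg) simp
    then show "norm (f (- int (Suc n))) \<le> 1 / 2 * norm (f (- int n))"
      unfolding step2 using nonneg[of "- int n"] Z by simp
  qed auto
  then have "(\<lambda>n. f (- int n)) summable_on UNIV"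
    using nonneg by (intro summable_nonneg_imp_summable_on) auto
  then have 2: "f summable_on range (\<lambda>n. - int n)"
    by (subst summable_on_reindex) (auto simp: o_def inj_def)
  have "f summable_on range int \<union> range (\<lambda>n. - int n)"
    using 1 2 by (rule summable_on_union)
  also have "range int \<union> range (\<lambda>n. - int n) = UNIV"
  proof -
    have "r \<in> range int \<union> range (\<lambda>n. - int n)" for r
      by (cases r rule: int_cases2) auto
    then show ?thesis by auto
  qed
  finally show ?thesis unfolding f_def .
qed

subsection \<open>The Jacobi triple product\<close>

definition theta_term :: "complex \<Rightarrow> int \<Rightarrow> complex" where
  "theta_term z r = (-1) powi r * q powi choose2 r * z powi r"

lemma theta_term_plus_1: "z \<noteq> 0 \<Longrightarrow> theta_term z (r + 1) = - z * q powi r * theta_term z r"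
  unfolding theta_term_def choose2_plus_1 by (simp add: power_int_add)

lemma theta_term_minus_1: "z \<noteq> 0 \<Longrightarrow> z * theta_term z (r - 1) = - (q powi (1 - r)) * theta_term z r"
  using theta_term_plus_1[of z "r - 1"] by (simp add: power_int_diff field_simps)

lemma norm_theta_term_le:
  assumes "z \<noteq> 0" "norm z \<le> Z" "1 / norm z \<le> Z"
  shows "norm (theta_term z r) \<le> gauss_term Z r"
  using norm_powi_le[OF assms, of r]
  by (simp add: theta_term_def norm_mult norm_power_int mult_left_mono)

definition qfact :: "nat \<Rightarrow> complex" where
  "qfact n = (\<Prod>k<n. 1 - q ^ Suc k)"

text \<open>The value $0$ at negative arguments makes \<open>rqfact_step\<close> hold for all integers.\<close>

definition rqfact :: "int \<Rightarrow> complex" where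
  "rqfact m = (if m < 0 then 0 else inverse (qfact (nat m)))"

lemma qfact_nz [simp]: "qfact n \<noteq> 0"
  using power_q_neq_1[of "Suc _"] by (auto simp: qfact_def simp del: power_Suc)

lemma qfact_LIMSEQ: "qfact \<longlonglongrightarrow> qpoch_inf q q"
  using qpoch_LIMSEQ[of q] unfolding qfact_def[abs_def] by simp

lemma rqfact_step: "rqfact (m - 1) = (1 - q powi m) * rqfact m"
proof -
  consider "m < 0" | "m = 0" | n where "m = int (Suc n)"
    by (metis int_cases less_linear negative_zless not0_implies_Suc of_nat_0 of_nat_less_0_iff)
  then show ?thesis
  proof cases
    case (3 n)
    have "1 - q ^ Suc n \<noteq> 0" using power_q_neq_1[of "Suc n"] by simp
    moreover have "nat m = Suc n" "nat (m - 1) = n" "\<not> m < 0" "\<not> m - 1 < 0" "q powi m = q ^ Suc n"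
      unfolding 3 by (auto simp del: of_nat_Suc)
    ultimately show ?thesis unfolding rqfact_def qfact_def by (simp del: power_Suc)
  qed (auto simp: rqfact_def)
qed

lemma rqfact_bounded: "\<exists>B. \<forall>m. norm (rqfact m) \<le> B"
proof -
  have "(\<lambda>n. inverse (qfact n)) \<longlonglongrightarrow> inverse (qpoch_inf q q)"
    by (intro tendsto_inverse qfact_LIMSEQ) simp
  then have "Bseq (\<lambda>n. inverse (qfact n))" by (rule convergent_imp_Bseq[OF convergentI])
  then obtain B where B: "B > 0" "\<And>n. norm (inverse (qfact n)) \<le> B" unfolding Bseq_def by blast
  then have "norm (rqfact m) \<le> B" for m unfolding rqfact_def using B(2)[of "nat m"] by auto
  then show ?thesis by blast
qed

text \<open>Cauchy's finite form of the triple product, with the q-binomial coefficients divided by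
  \<open>qfact (2 * N)\<close>. As \<open>rqfact\<close> vanishes at negative arguments only
  finitely many terms are nonzero, yet the index can be shifted freely over all integers.\<close>

lemma finite_triple_product:
  assumes z: "z \<noteq> 0"
  shows "((\<lambda>j. theta_term z j * (rqfact (int N - j) * rqfact (int N + j))) has_sum
           (\<Prod>k<N. (1 - z * q ^ k) * (1 - q ^ Suc k / z)) / qfact (2 * N)) UNIV"
proof (induction N)
  case 0
  have "((\<lambda>j. theta_term z j * (rqfact (int 0 - j) * rqfact (int 0 + j))) has_sum 1) {0}"
    by (rule has_sum_finiteI) (auto simp: theta_term_def rqfact_def qfact_def choose2_def)
  then show ?case
    by (subst has_sum_cong_neutral[where T="{0}"]) (auto simp: rqfact_def qfact_def)
next
  case (Suc N)
  define P where "P = (\<Prod>k<N. (1 - z * q ^ k) * (1 - q ^ Suc k / z))"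
  define b where "b = (\<lambda>j. rqfact (int N - j) * rqfact (int N + j))"
  define c where "c = (\<lambda>j. rqfact (int (Suc N) - j) * rqfact (int (Suc N) + j))"
  let ?V = "(1 + q ^ (2 * N + 1)) * (P / qfact (2 * N)) + (- (z * q ^ N)) * (P / qfact (2 * N))
              + (- (q ^ Suc N / z)) * (P / qfact (2 * N))"
  have IH: "((\<lambda>j. theta_term z j * b j) has_sum P / qfact (2 * N)) UNIV"
    using Suc.IH unfolding P_def b_def .
  have sh: "((\<lambda>j. theta_term z (j + d) * b (j + d)) has_sum P / qfact (2 * N)) UNIV" for d
    by (rule has_sum_int_shift[OF IH])
  \<comment> \<open>The two new factors multiply out to
    \<open>1 + q^(2N+1) - z q^N - q^(N+1)/z\<close>. The last two monomials are paired with index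
    shifts by -1 and +1, so that all three parts become multiples of
    \<open>theta_term z j\<close>.\<close>
  let ?L = "\<lambda>j. (1 + q ^ (2 * N + 1)) * (theta_term z j * b j)
                + (- (z * q ^ N)) * (theta_term z (j + (-1)) * b (j + (-1)))
                + (- (q ^ Suc N / z)) * (theta_term z (j + 1) * b (j + 1))"
  have sum: "(?L has_sum
          ?V) UNIV"
    by (intro has_sum_add has_sum_cmult_right IH sh)
  have pt: "?L j =
        (1 - q ^ (2 * N + 1)) * (1 - q ^ (2 * N + 2)) * (theta_term z j * c j)" for j
  proof -
    define A where "A = rqfact (int (Suc N) - j)"
    define B where "B = rqfact (int (Suc N) + j)"
    define u where "u = q powi (int (Suc N) - j)"
    define v where "v = q powi (int (Suc N) + j)"
    have uq: "q powi (int N - j) = u / q" "q powi (int N + j) = v / q"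
      unfolding u_def v_def by (simp_all add: power_int_diff power_int_add)
    have shift: "int (Suc N) - j - 1 = int N - j" "int (Suc N) + j - 1 = int N + j"
      "int N - (j + 1) = int N - j - 1" "int N + (j + (-1)) = int N + j - 1"
      "int N - (j + (-1)) = int (Suc N) - j" "int N + (j + 1) = int (Suc N) + j" by auto
    have r1: "rqfact (int N - j) = (1 - u) * A"
      using rqfact_step[of "int (Suc N) - j"] unfolding A_def u_def shift .
    have r2: "rqfact (int N + j) = (1 - v) * B"
      using rqfact_step[of "int (Suc N) + j"] unfolding B_def v_def shift .
    have b0: "b j = (1 - u) * A * ((1 - v) * B)"
      unfolding b_def r1 r2 ..
    have b1: "b (j + (-1)) = A * ((1 - v / q) * (1 - v) * B)"
      using rqfact_step[of "int N + j"] unfolding b_def shift uq r2 A_def by simp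
    have b2: "b (j + 1) = (1 - u / q) * (1 - u) * A * B"
      using rqfact_step[of "int N - j"] unfolding b_def shift uq r1 B_def by simp
    have s1: "- (z * q ^ N) * theta_term z (j + (-1)) = u * theta_term z j"
    proof -
      have "- (z * q ^ N) * theta_term z (j + (-1)) = - (q ^ N) * (z * theta_term z (j - 1))"
        by simp
      also have "\<dots> = u * theta_term z j"
        unfolding theta_term_minus_1[OF z, of j] u_def
        by (simp add: power_int_diff power_int_add)
      finally show ?thesis .
    qed
    have s2: "- (q ^ Suc N / z) * theta_term z (j + 1) = v * theta_term z j"
      using theta_term_plus_1[OF z, of j] z unfolding v_def
      by (simp add: power_int_diff power_int_add field_simps)
    have uv: "q ^ (2 * N + 2) = u * v" "q ^ (2 * N + 1) = u * v / q"
    proof -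
      have "u * v = q powi (int (2 * N + 2))"
        unfolding u_def v_def by (simp flip: power_int_add)
      then show "q ^ (2 * N + 2) = u * v" by (simp only: power_int_of_nat)
      then show "q ^ (2 * N + 1) = u * v / q" by (simp add: field_simps)
    qed
    \<comment> \<open>What remains is the polynomial identity \<open>(1 + uv/q)(1-u)(1-v) +
      u(1-v/q)(1-v) + v(1-u/q)(1-u) = (1-uv/q)(1-uv)\<close>.\<close>
    have "(1 + u * v / q) * (theta_term z j * b j) + (- (z * q ^ N) * theta_term z (j + (-1))) * b (j + (-1))
       + (- (q ^ Suc N / z) * theta_term z (j + 1)) * b (j + 1) =
       (1 - u * v / q) * (1 - u * v) * (theta_term z j * (A * B))"
      unfolding s1 s2 b0 b1 b2 by (simp add: field_simps)
    then show ?thesis unfolding uv c_def A_def[symmetric] B_def[symmetric] by (simp only: mult.assoc)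
  qed
  have nz: "1 - q ^ (2 * N + 1) \<noteq> 0" "1 - q ^ (2 * N + 2) \<noteq> 0"
    using power_q_neq_1[of "2 * N + 1"] power_q_neq_1[of "2 * N + 2"] by auto
  have qf: "qfact (2 * Suc N) = qfact (2 * N) * ((1 - q ^ (2 * N + 1)) * (1 - q ^ (2 * N + 2)))"
    by (simp add: qfact_def mult_ac)
  define D where "D = (1 - q ^ (2 * N + 1)) * (1 - q ^ (2 * N + 2))"
  have D: "D \<noteq> 0" using nz by (simp add: D_def)
  have "((\<lambda>j. inverse D * (D * (theta_term z j * c j))) has_sum
         inverse D * ?V) UNIV"
    unfolding D_def by (rule has_sum_cmult_right) (use sum in \<open>simp only: pt\<close>)
  moreover have "inverse D * ?V =
       (P * ((1 - z * q ^ N) * (1 - q ^ Suc N / z))) / qfact (2 * Suc N)"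
  proof -
    have "(1 - z * q ^ N) * (1 - q ^ Suc N / z) = 1 + q ^ (2 * N + 1) - z * q ^ N - q ^ Suc N / z"
      using z by (simp add: field_simps power_add power_mult power2_eq_square mult_2 mult_2_right)
    note E = this
    have gen: "inverse D * ((1 + x) * (P / F) + (- y) * (P / F) + (- w) * (P / F)) =
       P * (1 + x - y - w) / (F * D)" for x y w F :: complex
      by (simp add: divide_inverse algebra_simps)
    show ?thesis unfolding gen E qf D_def[symmetric] ..
  qed
  moreover have "(\<lambda>j. inverse D * (D * (theta_term z j * c j))) = (\<lambda>j. theta_term z j * c j)"
    using D by (simp add: fun_eq_iff)
  ultimately show ?case
    unfolding c_def P_def prod.lessThan_Suc by simp
qed

text \<open>The limit of \<open>finite_triple_product\<close> for large \<open>N\<close>: the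
  reciprocal q-factorials are bounded, so a multiple of the Gaussian majorant dominates all the
  finite sums at once.\<close>

theorem jacobi_triple_product:
  assumes z: "z \<noteq> 0"
  shows "(theta_term z has_sum jtheta z q) UNIV"
proof -
  obtain B where B: "\<And>m. norm (rqfact m) \<le> B" using rqfact_bounded by blast
  define Z where "Z = max (norm z) (1 / norm z)"
  have Zp: "Z > 0" using z by (auto simp: Z_def less_max_iff_disj)
  define M where "M = (\<lambda>j. gauss_term Z j * (B * B))"
  define f where "f = (\<lambda>j N. theta_term z j * (rqfact (int N - j) * rqfact (int N + j)))"
  define C where "C = inverse (qpoch_inf q q)"
  have tle: "norm (theta_term z j) \<le> gauss_term Z j" for j
    by (rule norm_theta_term_le) (use z in \<open>auto simp: Z_def\<close>)
  have sum: "theta_term z summable_on UNIV"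
    by (rule abs_summable_summable[OF summable_on_comparison_test[OF summable_gauss[OF Zp]]])
      (use tle in auto)
  have rl: "(\<lambda>N. rqfact (int N + d)) \<longlonglongrightarrow> C" for d
  proof -
    have lim: "(\<lambda>n. inverse (qfact n)) \<longlonglongrightarrow> C"
      unfolding C_def by (intro tendsto_inverse qfact_LIMSEQ) simp
    have "filterlim (\<lambda>N. nat (int N + d)) sequentially sequentially"
      unfolding filterlim_at_top eventually_sequentially
    proof (intro allI exI impI)
      fix Z n :: nat assume "Z + nat \<bar>d\<bar> \<le> n"
      then show "Z \<le> nat (int n + d)" by linarith
    qed
    with lim have "(\<lambda>N. inverse (qfact (nat (int N + d)))) \<longlonglongrightarrow> C"
      by (rule filterlim_compose)
    moreover have "eventually (\<lambda>N. inverse (qfact (nat (int N + d))) = rqfact (int N + d)) sequentially"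
      using eventually_ge_at_top[of "nat \<bar>d\<bar>"] by eventually_elim (auto simp: rqfact_def)
    ultimately show ?thesis by (rule Lim_transform_eventually)
  qed
  \<comment> \<open>Each of the two reciprocals in a term tends to \<open>C\<close>, while the
    finite product side brings a single \<open>C\<close>. The missing factor \<open>1/C\<close> is
    the third product in \<open>jtheta\<close>.\<close>
  have 1: "(\<lambda>N. \<Sum>\<^sub>\<infinity>j. f j N) \<longlonglongrightarrow> (\<Sum>\<^sub>\<infinity>j. theta_term z j * (C * C))"
  proof (rule tendsto_infsum_dominated)
    show "norm (f j N) \<le> M j" for j N
      unfolding f_def M_def norm_mult
      by (intro mult_mono tle B mult_nonneg_nonneg) (use Zp B order_trans[OF norm_ge_zero B] in auto)
    show "M summable_on UNIV"
      unfolding M_def by (intro summable_on_cmult_left summable_gauss Zp)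
    show "f j \<longlonglongrightarrow> theta_term z j * (C * C)" for j
      unfolding f_def using rl[of "-j"] rl[of j] by (intro tendsto_intros) auto
  qed auto
  have 2: "(\<Sum>\<^sub>\<infinity>j. f j N) = (\<Prod>k<N. 1 - z * q ^ k) * (\<Prod>k<N. 1 - q / z * q ^ k) * inverse (qfact (2 * N))" for N
    using infsumI[OF finite_triple_product[OF z, of N]]
    by (simp add: f_def prod.distrib divide_inverse mult_ac)
  have "(\<lambda>N. \<Sum>\<^sub>\<infinity>j. f j N) \<longlonglongrightarrow> qpoch_inf z q * qpoch_inf (q / z) q * C"
    unfolding 2 C_def
    by (intro tendsto_mult tendsto_inverse qpoch_LIMSEQ LIMSEQ_subseq_LIMSEQ[OF qfact_LIMSEQ, unfolded o_def])
       (auto simp: strict_mono_def)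
  with 1 have "(\<Sum>\<^sub>\<infinity>j. theta_term z j * (C * C)) = qpoch_inf z q * qpoch_inf (q / z) q * C"
    by (rule LIMSEQ_unique)
  then have "infsum (theta_term z) UNIV * (C * C) = qpoch_inf z q * qpoch_inf (q / z) q * C"
    by (simp add: infsum_cmult_left')
  then have "infsum (theta_term z) UNIV = jtheta z q"
    unfolding C_def jtheta_def by (simp add: field_simps)
  then show ?thesis using sum by (simp add: has_sum_iff)
qed

section \<open>Periodic functions on a punctured disc\<close>

text \<open>The exponent is the floor of the logarithm of \<open>|w|\<close> to base
  \<open>|q|\<close>. Its sign separates two cases with natural powers, because periodicity is only
  given for multiplication by \<open>q\<close> inside the disc.\<close>

lemma fundamental_annulus:
  assumes w: "w \<noteq> 0"
  obtains (inner) n where "norm q < norm (w / q ^ n)" "norm (w / q ^ n) \<le> 1"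
    | (outer) n where "norm q < norm (q ^ n * w)" "norm (q ^ n * w) \<le> 1"
proof -
  define n where "n = \<lfloor>log (norm q) (norm w)\<rfloor>"
  have q01: "0 < norm q" "norm q < 1" using q_lt1 by auto
  have wn: "norm w > 0" using w by simp
  have lw: "norm q powr log (norm q) (norm w) = norm w"
    using q01 wn by simp
  have "norm w \<le> norm q powr real_of_int n"
    unfolding n_def by (subst lw[symmetric], rule powr_mono') (use q01 in auto)
  then have u: "norm w \<le> norm q powi n"
    using q01 by (simp add: powr_real_of_int')
  have "norm q powr real_of_int (n + 1) < norm w"
    unfolding n_def by (subst (2) lw[symmetric], rule powr_less_mono') (use q01 in \<open>auto simp: floor_less_iff\<close>)
  then have l: "norm q powi (n + 1) < norm w"
    using q01 powr_real_of_int'[of "norm q" "n + 1"] by linarith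
  show thesis
  proof (cases "n \<ge> 0")
    case True
    show thesis
    proof (rule inner[of "nat n"])
      show "norm q < norm (w / q ^ nat n)" "norm (w / q ^ nat n) \<le> 1"
        using u l True q01 power_int_add[of "norm q" n 1]
        by (auto simp: norm_divide norm_power power_int_def field_simps)
    qed
  next
    case False
    show thesis
    proof (rule outer[of "nat (-n)"])
      have "norm q powi (n + 1) = norm q powi n * norm q" using q01 by (simp add: power_int_add)
      moreover have "norm q powi n = 1 / norm q ^ nat (- n)"
        using False by (simp add: power_int_def field_simps)
      ultimately have "norm w \<le> 1 / norm q ^ nat (- n)" "1 / norm q ^ nat (- n) * norm q < norm w"
        using u l by auto
      then show "norm q < norm (q ^ nat (-n) * w)" "norm (q ^ nat (-n) * w) \<le> 1"
        using q01 by (auto simp: norm_mult norm_power field_simps)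
    qed
  qed
qed

text \<open>Every orbit meets the closed annulus \<open>K\<close>, so the maximum of
  \<open>|G|\<close> over \<open>K\<close> bounds \<open>|G|\<close> everywhere. The condition
  \<open>\<rho> > 1\<close> places the outer circle of \<open>K\<close> inside the open domain, so
  that this maximum is attained at an interior point.\<close>

lemma q_periodic_imp_constant:
  assumes \<rho>: "\<rho> > 1"
    and hol: "G holomorphic_on {w. 0 < norm w \<and> norm w < \<rho>}" (is "_ holomorphic_on ?D")
    and per: "\<And>w. 0 < norm w \<Longrightarrow> norm w < \<rho> \<Longrightarrow> G (q * w) = G w"
  shows "G constant_on ?D"
proof -
  have D: "?D = ball 0 \<rho> - {0}" by auto
  have opn: "open ?D" unfolding D by auto
  have conn: "connected ?D"
    unfolding D using connected_punctured_ball[of "0::complex" \<rho>] by simp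
  define K where "K = {w :: complex. norm q \<le> norm w \<and> norm w \<le> 1}"
  have "K = cball 0 1 - ball 0 (norm q)" by (auto simp: K_def)
  then have K: "compact K" using compact_diff[OF compact_cball open_ball] by simp
  have KD: "K \<subseteq> ?D" using \<rho> by (auto simp: K_def)
  have "1 \<in> K" using q_lt1 by (simp add: K_def)
  moreover have "continuous_on K (\<lambda>w. norm (G w))"
    using holomorphic_on_imp_continuous_on[OF holomorphic_on_subset[OF hol KD]] by (intro continuous_intros)
  ultimately obtain \<xi> where \<xi>: "\<xi> \<in> K" "\<And>w. w \<in> K \<Longrightarrow> norm (G w) \<le> norm (G \<xi>)"
    using continuous_attains_sup[OF K] by blast
  have per_n: "G (q ^ n * w) = G w" if "0 < norm w" "norm w < \<rho>" for n w
  proof (induction n)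
    case (Suc n)
    have "norm (q ^ n * w) \<le> norm w"
      using q_lt1 by (simp add: norm_mult norm_power mult_left_le_one_le power_le_one)
    then have "norm (q ^ n * w) < \<rho>" using that by simp
    then show ?case using per[of "q ^ n * w"] Suc that by (simp add: mult.assoc)
  qed simp
  have le: "norm (G w) \<le> norm (G \<xi>)" if w: "w \<in> ?D" for w
  proof -
    have "w \<noteq> 0" using w by auto
    then show ?thesis
    proof (cases rule: fundamental_annulus)
      case (inner n)
      then have "w / q ^ n \<in> K" by (simp add: K_def)
      moreover have "G (q ^ n * (w / q ^ n)) = G (w / q ^ n)"
        using inner \<rho> \<open>w \<noteq> 0\<close> by (intro per_n) (auto simp del: norm_divide)
      ultimately show ?thesis using \<xi>(2) by simp
    next
      case (outer n)
      then have "q ^ n * w \<in> K" by (simp add: K_def)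
      then show ?thesis using \<xi>(2) per_n[of w n] w by fastforce
    qed
  qed
  show ?thesis
    by (rule maximum_modulus_principle[OF hol opn conn opn order_refl _ le]) (use \<xi> KD in auto)
qed

text \<open>By periodicity a singularity may be moved along its $q$-orbit, so one point of each orbit
  suffices to show that it is removable.\<close>

lemma q_periodic_eq_0:
  assumes \<rho>: "\<rho> > 1"
    and D_def: "D = {w. 0 < norm w \<and> norm w < \<rho>}"
    and h: "h holomorphic_on D"
    and h_per: "\<And>w. w \<in> D \<Longrightarrow> h (q * w) = 0 \<longleftrightarrow> h w = 0"
    and F: "F holomorphic_on {w\<in>D. h w \<noteq> 0}"
    and per: "\<And>w. w \<in> D \<Longrightarrow> h w \<noteq> 0 \<Longrightarrow> F (q * w) = F w"
    and lim: "\<And>p. p \<in> D \<Longrightarrow> h p = 0 \<Longrightarrow>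
                \<exists>p0\<in>D. \<exists>m n. q ^ m * p = q ^ n * p0 \<and> ((\<lambda>w. (w - p0) * F w) \<longlongrightarrow> 0) (at p0)"
    and w0: "w0 \<in> D" "h w0 \<noteq> 0" "F w0 = 0"
    and w: "w \<in> D" "h w \<noteq> 0"
  shows "F w = 0"
proof -
  have D: "D = ball 0 \<rho> - {0}" by (auto simp: D_def)
  have opn: "open D" unfolding D by auto
  have conn: "connected D"
    unfolding D using connected_punctured_ball[of "0::complex" \<rho>] by simp
  have qD: "q ^ n * w \<in> D" if "w \<in> D" for w n
  proof -
    have "norm (q ^ n * w) \<le> norm w"
      using q_lt1 by (simp add: norm_mult norm_power mult_left_le_one_le power_le_one)
    then show ?thesis using that by (auto simp: D_def)
  qed
  have h_n: "h (q ^ n * w) = 0 \<longleftrightarrow> h w = 0" if "w \<in> D" for w n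
    using h_per[OF qD[OF that]] by (induction n) (simp_all add: mult.assoc)
  have per_n: "F (q ^ n * w) = F w" if "w \<in> D" "h w \<noteq> 0" for w n
    using per[OF qD[OF that(1)]] h_n[OF that(1)] that(2) by (induction n) (simp_all add: mult.assoc)
  \<comment> \<open>The point \<open>w0\<close> shows that \<open>h\<close> is not identically zero
    on the connected set \<open>D\<close>, so its zeros are isolated.\<close>
  have iso: "\<exists>r>0. ball p r \<subseteq> D \<and> (\<forall>w\<in>ball p r - {p}. h w \<noteq> 0)" if p: "p \<in> D" for p
  proof (cases "h p = 0")
    case True
    obtain r where "0 < r" "ball p r \<subseteq> D" "\<And>z. z \<in> ball p r - {p} \<Longrightarrow> h z \<noteq> 0"
      using isolated_zeros[OF h opn conn p True w0(1,2)] by blast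
    then show ?thesis by blast
  next
    case False
    have "continuous_on D h" using h by (rule holomorphic_on_imp_continuous_on)
    then have "open (h -` (- {0}) \<inter> D)"
      by (rule continuous_open_preimage[of D h "- {0}", unfolded Int_commute[of D]]) (use opn in auto)
    then obtain r where "r > 0" "ball p r \<subseteq> h -` (- {0}) \<inter> D"
      using False p openE[of "h -` (- {0}) \<inter> D" p] by blast
    then show ?thesis by (intro exI[of _ r]) auto
  qed
  have ev: "\<forall>\<^sub>F w in at p. w \<in> D \<and> h w \<noteq> 0" if p: "p \<in> D" for p
  proof -
    obtain r where r: "r > 0" "ball p r \<subseteq> D" "\<forall>w\<in>ball p r - {p}. h w \<noteq> 0" using iso[OF p] by blast
    then show ?thesis unfolding eventually_at by (intro exI[of _ r]) (auto simp: subset_iff dist_commute)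
  qed
  \<comment> \<open>A limit of \<open>F\<close> at one point of an orbit gives the same limit at the
    others, in either direction; this covers a \<open>p0\<close> nearer to 0 than \<open>p\<close>
    as well as one farther away.\<close>
  have lim_iff: "(F \<longlongrightarrow> L) (at (q ^ n * p)) \<longleftrightarrow> (F \<longlongrightarrow> L) (at p)" if p: "p \<in> D" for p n L
  proof
    assume L: "(F \<longlongrightarrow> L) (at (q ^ n * p))"
    have "filterlim (\<lambda>w. q ^ n * w) (at (q ^ n * p)) (at p)"
      by (auto simp: filterlim_at eventually_at intro!: tendsto_intros exI[of _ 1])
    then have "((\<lambda>w. F (q ^ n * w)) \<longlongrightarrow> L) (at p)" by (rule filterlim_compose[OF L])
    moreover have "\<forall>\<^sub>F w in at p. F (q ^ n * w) = F w"
      using ev[OF p] by eventually_elim (use per_n in auto)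
    ultimately show "(F \<longlongrightarrow> L) (at p)" by (rule Lim_transform_eventually)
  next
    assume L: "(F \<longlongrightarrow> L) (at p)"
    have fl: "filterlim (\<lambda>w. w / q ^ n) (at p) (at (q ^ n * p))"
      by (auto simp: filterlim_at eventually_at intro!: tendsto_eq_intros exI[of _ 1])
    then have "((\<lambda>w. F (w / q ^ n)) \<longlongrightarrow> L) (at (q ^ n * p))" by (rule filterlim_compose[OF L])
    moreover have "\<forall>\<^sub>F w in at (q ^ n * p). F (w / q ^ n) = F w"
      using eventually_compose_filterlim[OF ev[OF p] fl]
    proof eventually_elim
      case (elim w)
      then show ?case using per_n[of "w / q ^ n" n] by simp
    qed
    ultimately show "(F \<longlongrightarrow> L) (at (q ^ n * p))" by (rule Lim_transform_eventually)
  qed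
  have lim': "\<exists>L. (F \<longlongrightarrow> L) (at p)" if p: "p \<in> D" "h p = 0" for p
  proof -
    obtain p0 m n where p0: "p0 \<in> D" "q ^ m * p = q ^ n * p0"
      "((\<lambda>w. (w - p0) * F w) \<longlongrightarrow> 0) (at p0)" using lim[OF p] by blast
    obtain r where r: "r > 0" "ball p0 r \<subseteq> D" "\<forall>w\<in>ball p0 r - {p0}. h w \<noteq> 0" using iso[OF p0(1)] by blast
    have "F holomorphic_on (ball p0 r - {p0})"
      by (rule holomorphic_on_subset[OF F]) (use r in auto)
    \<comment> \<open>Riemann's criterion: \<open>(w - p0) * F w\<close> tends to 0, so
      \<open>F\<close> extends holomorphically across \<open>p0\<close>.\<close>
    then obtain g where g: "g holomorphic_on ball p0 r" "\<And>z. z \<in> ball p0 r - {p0} \<Longrightarrow> g z = F z"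
      using holomorphic_on_extend_lim[of F "ball p0 r" p0] p0(3) r(1) by auto
    have "isCont g p0"
      using holomorphic_on_imp_continuous_on[OF g(1)] r(1) by (simp add: continuous_on_eq_continuous_at)
    then have "(g \<longlongrightarrow> g p0) (at p0)" by (simp add: isCont_def)
    moreover have "\<forall>\<^sub>F w in at p0. g w = F w"
      using g(2) r(1) by (auto simp: eventually_at dist_commute intro!: exI[of _ r])
    ultimately have "(F \<longlongrightarrow> g p0) (at p0)" by (rule Lim_transform_eventually)
    then have "(F \<longlongrightarrow> g p0) (at (q ^ m * p))"
      unfolding p0(2) lim_iff[OF p0(1)] .
    then show ?thesis using lim_iff[OF p(1)] by blast
  qed
  define G where "G = (\<lambda>w. if h w \<noteq> 0 then F w else Lim (at w) F)"
  have G_lim: "(F \<longlongrightarrow> G p) (at p)" if p: "p \<in> D" "h p = 0" for p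
    using lim'[OF p] p by (auto simp: G_def tendsto_Lim)
  have G_per: "G (q * w) = G w" if w: "w \<in> D" for w
  proof (cases "h w = 0")
    case True
    have "(F \<longlongrightarrow> G (q * w)) (at (q ^ 1 * w))"
      using G_lim[OF qD[OF w, of 1]] h_n[OF w, of 1] True by simp
    then have "(F \<longlongrightarrow> G (q * w)) (at w)" unfolding lim_iff[OF w] .
    with G_lim[OF w True] show ?thesis using tendsto_unique trivial_limit_at by blast
  next
    case False
    then show ?thesis using per[OF w] h_per[OF w] by (simp add: G_def)
  qed
  have "G field_differentiable (at p)" if p: "p \<in> D" for p
  proof -
    obtain r where r: "r > 0" "ball p r \<subseteq> D" "\<forall>w\<in>ball p r - {p}. h w \<noteq> 0" using iso[OF p] by blast
    have F1: "F holomorphic_on (ball p r - {p})"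
      by (rule holomorphic_on_subset[OF F]) (use r in auto)
    have G1: "G holomorphic_on (ball p r - {p})"
      by (rule holomorphic_transform[OF F1]) (use r in \<open>auto simp: G_def\<close>)
    have Gp: "(G \<longlongrightarrow> G p) (at p)"
    proof -
      have FL: "(F \<longlongrightarrow> G p) (at p)"
      proof (cases "h p = 0")
        case False
        then have "ball p r \<subseteq> {w \<in> D. h w \<noteq> 0}" using r by auto
        then have "continuous_on (ball p r) F"
          using F holomorphic_on_imp_continuous_on holomorphic_on_subset by blast
        then show ?thesis using False r(1)
          by (auto simp: G_def continuous_on_eq_continuous_at isCont_def)
      qed (use G_lim p in auto)
      moreover have "\<forall>\<^sub>F w in at p. F w = G w"
        using ev[OF p] by eventually_elim (simp add: G_def)
      ultimately show ?thesis by (rule Lim_transform_eventually)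
    qed
    have "G holomorphic_on ball p r"
      by (rule no_isolated_singularity'[where K = "{p}"])
        (use Gp G1 in \<open>auto intro: tendsto_within_subset\<close>)
    then show ?thesis using r(1) holomorphic_on_imp_differentiable_at[of G "ball p r" p] by auto
  qed
  then have "G holomorphic_on D"
    by (simp add: field_differentiable_at_within holomorphic_on_def)
  then have "G constant_on D"
    unfolding D_def by (rule q_periodic_imp_constant[OF \<rho>]) (use G_per in \<open>auto simp: D_def\<close>)
  then have "G w = G w0" using w(1) w0(1) by (auto simp: constant_on_def)
  then show ?thesis using w w0 by (simp add: G_def)
qed

section \<open>Appell--Lerch series\<close>

abbreviation lerch_term :: "complex \<Rightarrow> complex \<Rightarrow> int \<Rightarrow> complex" where
  "lerch_term y z r \<equiv> theta_term z r / (1 - q powi (r - 1) * y)"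

text \<open>The product \<open>y = x z\<close> is a separate argument: the denominators depend on
  \<open>y\<close> only and the theta terms on \<open>z\<close> only. The index set \<open>I\<close>
  allows the one term that is singular at \<open>y = 1\<close> to be taken out.\<close>

definition lerch_on :: "int set \<Rightarrow> complex \<Rightarrow> complex \<Rightarrow> complex" where
  "lerch_on I y z = (\<Sum>\<^sub>\<infinity>r\<in>I. lerch_term y z r)"

abbreviation lerch :: "complex \<Rightarrow> complex \<Rightarrow> complex" where
  "lerch \<equiv> lerch_on UNIV"

lemma appell_m_eq: "appell_m x q z = lerch (x * z) z / jtheta z q"
  unfolding appell_m_def lerch_on_def theta_term_def by (simp add: mult.assoc)

text \<open>Outside a finite window that depends only on \<open>Y\<close>, the number
  \<open>q powi (r - 1) * y\<close> has modulus at most 1/2 or at least 2, so the denominator has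
  modulus at least 1/2.\<close>

lemma lerch_term_bound:
  assumes Y: "Y > 0" and Z: "Z > 0"
  obtains N :: nat where
    "\<And>r y z. r \<notin> {- int N..int N + 1} \<Longrightarrow> y \<noteq> 0 \<Longrightarrow> norm y \<le> Y \<Longrightarrow> 1 / norm y \<le> Y \<Longrightarrow>
       z \<noteq> 0 \<Longrightarrow> norm z \<le> Z \<Longrightarrow> 1 / norm z \<le> Z \<Longrightarrow>
       norm (lerch_term y z r) \<le> gauss_term Z r * 2"
proof -
  obtain N where N: "\<And>n. n \<ge> N \<Longrightarrow> norm q ^ n * Y \<le> 1 / 2"
    using eventually_small[of Y] unfolding eventually_sequentially by auto
  show thesis
  proof (rule that[of N])
    fix r :: int and y z :: complex
    assume r: "r \<notin> {- int N..int N + 1}" and y: "y \<noteq> 0" "norm y \<le> Y" "1 / norm y \<le> Y"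
      and z: "z \<noteq> 0" "norm z \<le> Z" "1 / norm z \<le> Z"
    define u where "u = q powi (r - 1) * y"
    have "norm (1 - u) \<ge> 1 / 2"
    proof (cases "r > int N + 1")
      case True
      then have "norm u = norm q ^ nat (r - 1) * norm y"
        by (simp add: u_def norm_mult norm_power power_int_def)
      also have "\<dots> \<le> norm q ^ nat (r - 1) * Y" using y by (intro mult_left_mono) auto
      also have "\<dots> \<le> 1 / 2" using True by (intro N) auto
      finally show ?thesis using norm_triangle_ineq2[of 1 u] by simp
    next
      case False
      then have r': "r < - int N" using r by auto
      have "norm u = norm y / norm q ^ nat (1 - r)"
        using r' by (simp add: u_def norm_mult norm_power norm_inverse norm_divide power_int_def field_simps)
      moreover have "norm q ^ nat (1 - r) / norm y \<le> 1 / 2"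
      proof -
        have "norm q ^ nat (1 - r) / norm y = norm q ^ nat (1 - r) * (1 / norm y)" by simp
        also have "\<dots> \<le> norm q ^ nat (1 - r) * Y" using y by (intro mult_left_mono) auto
        also have "\<dots> \<le> 1 / 2" using r' by (intro N) auto
        finally show ?thesis .
      qed
      ultimately have "norm u \<ge> 2" using y(1) q_nz by (simp add: divide_le_eq le_divide_eq mult.commute)
      then show ?thesis using norm_triangle_ineq2[of u 1] by (simp add: norm_minus_commute)
    qed
    then have "norm (1 - u) > 0" "1 \<le> 2 * norm (1 - u)" by auto
    then have "1 / norm (1 - u) \<le> 2" by (simp only: divide_le_eq) simp
    then have "norm (theta_term z r) * (1 / norm (1 - u)) \<le> gauss_term Z r * 2"
      using norm_theta_term_le[OF z, of r] Z by (intro mult_mono) auto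
    then show "norm (lerch_term y z r) \<le> gauss_term Z r * 2"
      by (simp add: u_def norm_divide)
  qed
qed

lemma lerch_summable:
  assumes "y \<noteq> 0" "z \<noteq> 0"
  shows "(\<lambda>r. lerch_term y z r) summable_on I"
proof -
  define Y where "Y = max (norm y) (1 / norm y)"
  define Z where "Z = max (norm z) (1 / norm z)"
  have pos: "Y > 0" "Z > 0" using assms by (auto simp: Y_def Z_def less_max_iff_disj)
  obtain N where N: "\<And>r. r \<notin> {- int N..int N + 1} \<Longrightarrow>
     norm (lerch_term y z r) \<le> gauss_term Z r * 2"
    using lerch_term_bound[OF pos] assms unfolding Y_def Z_def by (metis max.cobounded1 max.cobounded2)
  have "(\<lambda>r. lerch_term y z r) summable_on (UNIV - {- int N..int N + 1})"
  proof (rule abs_summable_summable[OF summable_on_comparison_test])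
    show "(\<lambda>r. gauss_term Z r * 2) summable_on (UNIV - {- int N..int N + 1})"
      by (rule summable_on_subset[OF summable_on_cmult_left[OF summable_gauss[OF pos(2)]]]) auto
  qed (use N in auto)
  then have "(\<lambda>r. lerch_term y z r) summable_on
      ((UNIV - {- int N..int N + 1}) \<union> {- int N..int N + 1})"
    by (rule summable_on_union) auto
  then show ?thesis
    by (rule summable_on_subset) auto
qed

lemma lerch_has_sum:
  assumes "y \<noteq> 0" "z \<noteq> 0"
  shows "((\<lambda>r. lerch_term y z r) has_sum lerch y z) UNIV"
  unfolding lerch_on_def by (rule has_sum_infsum[OF lerch_summable[OF assms]])

text \<open>On a small closed disc \<open>f\<close>, \<open>g\<close> and their inverses are
  bounded, so the window of \<open>lerch_term_bound\<close> is the same for all its points; it is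
  the exceptional set in \<open>holomorphic_on_infsum\<close>.\<close>

lemma holomorphic_lerch_on [holomorphic_intros]:
  assumes S: "open S" and f: "f holomorphic_on S" and g: "g holomorphic_on S"
    and nz: "\<And>w. w \<in> S \<Longrightarrow> f w \<noteq> 0" "\<And>w. w \<in> S \<Longrightarrow> g w \<noteq> 0"
    and pole: "\<And>w r. w \<in> S \<Longrightarrow> r \<in> I \<Longrightarrow> q powi (r - 1) * f w \<noteq> 1"
  shows "(\<lambda>w. lerch_on I (f w) (g w)) holomorphic_on S"
  unfolding lerch_on_def
proof (rule holomorphic_on_infsum[OF S])
  show "(\<lambda>w. lerch_term (f w) (g w) r) holomorphic_on S" if "r \<in> I" for r
    unfolding theta_term_def using pole[OF _ that] nz f g by (intro holomorphic_intros) auto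
next
  fix w assume w: "w \<in> S"
  obtain d where d: "d > 0" "cball w d \<subseteq> S" using S w open_contains_cball by blast
  have bd: "\<exists>B>0. \<forall>v\<in>cball w d. norm (k v) \<le> B \<and> 1 / norm (k v) \<le> B"
    if k: "k holomorphic_on S" "\<And>v. v \<in> S \<Longrightarrow> k v \<noteq> 0" for k :: "complex \<Rightarrow> complex"
  proof -
    have c: "continuous_on (cball w d) k"
      using k(1) d(2) holomorphic_on_imp_continuous_on holomorphic_on_subset by blast
    then have c2: "continuous_on (cball w d) (\<lambda>v. inverse (k v))"
      using k(2) d(2) by (intro continuous_intros) auto
    obtain B1 where B1: "\<And>v. v \<in> cball w d \<Longrightarrow> norm (k v) \<le> B1"
      using bounded_on_cball[OF c] by blast
    obtain B2 where B2: "\<And>v. v \<in> cball w d \<Longrightarrow> norm (inverse (k v)) \<le> B2"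
      using bounded_on_cball[OF c2] by blast
    show ?thesis
      by (rule exI[of _ "max 1 (max B1 B2)"]) (use B1 B2 in \<open>fastforce simp: norm_inverse divide_inverse le_max_iff_disj less_max_iff_disj\<close>)
  qed
  obtain Y where Y: "Y > 0" "\<And>v. v \<in> cball w d \<Longrightarrow> norm (f v) \<le> Y" "\<And>v. v \<in> cball w d \<Longrightarrow> 1 / norm (f v) \<le> Y"
    using bd[OF f nz(1)] by blast
  obtain Z where Z: "Z > 0" "\<And>v. v \<in> cball w d \<Longrightarrow> norm (g v) \<le> Z" "\<And>v. v \<in> cball w d \<Longrightarrow> 1 / norm (g v) \<le> Z"
    using bd[OF g nz(2)] by blast
  obtain N where N: "\<And>r y z. r \<notin> {- int N..int N + 1} \<Longrightarrow> y \<noteq> 0 \<Longrightarrow> norm y \<le> Y \<Longrightarrow> 1 / norm y \<le> Y \<Longrightarrow>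
       z \<noteq> 0 \<Longrightarrow> norm z \<le> Z \<Longrightarrow> 1 / norm z \<le> Z \<Longrightarrow>
       norm (lerch_term y z r) \<le> gauss_term Z r * 2"
    using lerch_term_bound[OF Y(1) Z(1)] by blast
  have "(\<lambda>r. gauss_term Z r * 2) summable_on I"
    by (rule summable_on_subset[OF summable_on_cmult_left[OF summable_gauss[OF Z(1)]]]) auto
  moreover have "norm (lerch_term (f v) (g v) r) \<le> gauss_term Z r * 2"
    if "r \<in> I - {- int N..int N + 1}" "v \<in> cball w d" for r v
    using that d(2) by (intro N Y Z nz) auto
  ultimately show "\<exists>d>0. \<exists>M E. cball w d \<subseteq> S \<and> finite E \<and> M summable_on I \<and>
      (\<forall>r\<in>I - E. \<forall>v\<in>cball w d. norm (lerch_term (f v) (g v) r) \<le> M r)"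
    using d by (intro exI[of _ d] exI[of _ "\<lambda>r. gauss_term Z r * 2"]
      exI[of _ "{- int N..int N + 1}"] conjI) simp_all
qed

text \<open>The term \<open>r = 1\<close> is the one with denominator \<open>1 - y\<close>, hence
  the one responsible for the pole at \<open>y = 1\<close>; its numerator is
  \<open>theta_term z 1 = - z\<close>.\<close>

lemma lerch_split:
  assumes "y \<noteq> 0" "z \<noteq> 0"
  shows "lerch y z = - z / (1 - y) + lerch_on (- {1}) y z"
proof -
  have "lerch y z = lerch_on ({1} \<union> - {1}) y z" by simp
  also have "\<dots> = lerch_on {1} y z + lerch_on (- {1}) y z"
    unfolding lerch_on_def by (rule infsum_Un_disjoint) (use assms lerch_summable in auto)
  also have "lerch_on {1} y z = - z / (1 - y)"
    by (simp add: lerch_on_def theta_term_def choose2_def)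
  finally show ?thesis .
qed

section \<open>Functional equations of the Lerch sum\<close>

lemma powi_mult_neq_1:
  assumes "\<And>k::int. y \<noteq> q powi k"
  shows "q powi r * y \<noteq> 1"
proof
  assume "q powi r * y = 1"
  then have "y = q powi (- r)" by (simp add: power_int_minus field_simps)
  with assms show False by blast
qed

text \<open>After an index shift both sums have the denominator \<open>1 - q powi r * y\<close>, and
  the combined numerators contain exactly this factor. What is left is the theta series.\<close>

lemma lerch_q_shift:
  assumes y: "y \<noteq> 0" "\<And>k::int. y \<noteq> q powi k" and z: "z \<noteq> 0"
  shows "lerch (q * y) z = jtheta z q - y / z * lerch y z"
proof -
  have nz: "1 - q powi r * y \<noteq> 0" for r using powi_mult_neq_1[OF y(2)] by simp
  have 1: "((\<lambda>r. theta_term z r / (1 - q powi r * y)) has_sum lerch (q * y) z) UNIV"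
    using lerch_has_sum[of "q * y" z] y z by (simp add: power_int_diff)
  have 2: "((\<lambda>r. theta_term z (r + 1) / (1 - q powi r * y)) has_sum lerch y z) UNIV"
    using has_sum_int_shift[OF lerch_has_sum[OF y(1) z], of 1] by simp
  let ?t = "\<lambda>r. theta_term z r / (1 - q powi r * y) + y / z * (theta_term z (r + 1) / (1 - q powi r * y))"
  have "(?t
      has_sum lerch (q * y) z + y / z * lerch y z) UNIV"
    by (intro has_sum_add has_sum_cmult_right 1 2)
  also have "?t = theta_term z"
  proof
    fix r
    have "?t r =
       theta_term z r * (1 - q powi r * y) / (1 - q powi r * y)"
      unfolding theta_term_plus_1[OF z] using z by (simp add: divide_inverse algebra_simps)
    then show "?t r = theta_term z r"
      using nz[of r] by simp
  qed
  finally have "lerch (q * y) z + y / z * lerch y z = jtheta z q"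
    using jacobi_triple_product[OF z] has_sum_unique by blast
  then show ?thesis by (simp add: algebra_simps)
qed

text \<open>Both arguments are multiplied by \<open>q\<close>, so the quotient
  \<open>x = y / z\<close> stays fixed: this is the invariance of \<open>m(x, q, z)\<close> under
  \<open>z\<close> to \<open>q z\<close>.\<close>

lemma lerch_z_shift:
  assumes y: "y \<noteq> 0" and z: "z \<noteq> 0"
  shows "lerch (q * y) (q * z) = - lerch y z / z"
proof -
  have 1: "((\<lambda>r. theta_term (q * z) r / (1 - q powi r * y)) has_sum lerch (q * y) (q * z)) UNIV"
    using lerch_has_sum[of "q * y" "q * z"] y z by (simp add: power_int_diff)
  have 2: "((\<lambda>r. theta_term z (r + 1) / (1 - q powi r * y)) has_sum lerch y z) UNIV"
    using has_sum_int_shift[OF lerch_has_sum[OF y z], of 1] by simp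
  have "theta_term (q * z) r = - 1 / z * theta_term z (r + 1)" for r
    using z by (simp add: theta_term_plus_1) (simp add: theta_term_def power_int_mult_distrib)
  then have "((\<lambda>r. - 1 / z * (theta_term z (r + 1) / (1 - q powi r * y))) has_sum lerch (q * y) (q * z)) UNIV"
    using 1 by simp
  moreover have "((\<lambda>r. - 1 / z * (theta_term z (r + 1) / (1 - q powi r * y))) has_sum - 1 / z * lerch y z) UNIV"
    by (intro has_sum_cmult_right 2)
  ultimately show ?thesis using has_sum_unique by fastforce
qed

text \<open>Reversing the index gives the denominators \<open>1 - q powi (- r - 1) / y\<close>;
  clearing the negative power turns them into \<open>1 - q powi (r + 1) * y\<close>, which belong to
  the index \<open>r + 2\<close>.\<close>

lemma lerch_inverse:
  assumes y: "y \<noteq> 0" "\<And>k::int. y \<noteq> q powi k" and z: "z \<noteq> 0"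
  shows "lerch (1 / y) (1 / z) = - y / z ^ 2 * lerch y z"
proof -
  have nz: "1 - q powi r * y \<noteq> 0" for r using powi_mult_neq_1[OF y(2)] by simp
  have 1: "((\<lambda>r. theta_term (1 / z) (- r) / (1 - q powi (- r - 1) * (1 / y))) has_sum lerch (1 / y) (1 / z)) UNIV"
    by (rule has_sum_reindex_bij_witness[THEN iffD1, OF _ _ _ _ _ _ lerch_has_sum[of "1 / y" "1 / z"], of uminus uminus])
      (use y z in auto)
  let ?t = "\<lambda>r. - y / z ^ 2 * (theta_term z (r + 2) / (1 - q powi (r + 1) * y))"
  have "theta_term (1 / z) (- r) / (1 - q powi (- r - 1) * (1 / y)) =
        ?t r" for r
  proof -
    define X where "X = q powi (r + 1)"
    have X: "X \<noteq> 0" "1 - X * y \<noteq> 0" using nz[of "r + 1"] by (auto simp: X_def)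
    have "choose2 (- r) = choose2 (r + 1)" using choose2_flip[of "r + 1"] by simp
    then have tt: "theta_term (1 / z) (- r) = - theta_term z (r + 1) / z"
      using z unfolding theta_term_def by (simp add: power_int_minus power_int_add field_simps)
    have t2: "theta_term z (r + 2) = - z * X * theta_term z (r + 1)"
      using theta_term_plus_1[OF z, of "r + 1"] unfolding X_def by (simp add: add.assoc)
    have qX: "q powi (- r - 1) = 1 / X"
      using power_int_minus[of q "r + 1"] unfolding X_def by (simp add: divide_inverse)
    have "X * y - 1 \<noteq> 0" using X by auto
    then show ?thesis
      unfolding tt t2 qX X_def[symmetric] using X y(1) z
      by (simp add: divide_simps) (simp add: algebra_simps power2_eq_square)
  qed
  then have "(?t has_sum lerch (1 / y) (1 / z)) UNIV"
    using 1 by simp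
  moreover have "(?t has_sum
      - y / z ^ 2 * lerch y z) UNIV"
    using has_sum_int_shift[OF lerch_has_sum[OF y(1) z], of 2]
    by (intro has_sum_cmult_right) (simp add: algebra_simps)
  ultimately show ?thesis using has_sum_unique by blast
qed

lemma jtheta_nz: "z \<noteq> 0 \<Longrightarrow> (\<And>k::int. z \<noteq> q powi k) \<Longrightarrow> jtheta z q \<noteq> 0"
  using jtheta_eq_0_iff by blast

lemma appell_m_q_shift:
  assumes "appell_m_defined x q z"
  shows "appell_m (q * x) q z = 1 - x * appell_m x q z"
  using assms lerch_q_shift[of "x * z" z] jtheta_nz[of z]
  unfolding appell_m_defined_def appell_m_eq by (simp add: field_simps)

lemma appell_m_inverse:
  assumes "appell_m_defined x q z"
  shows "appell_m (1 / x) q (1 / z) = x * appell_m x q z"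
proof -
  have nz: "x \<noteq> 0" "z \<noteq> 0" using assms by (auto simp: appell_m_defined_def)
  have "lerch (1 / (x * z)) (1 / z) = - (x * z) / z ^ 2 * lerch (x * z) z"
    by (rule lerch_inverse) (use assms in \<open>auto simp: appell_m_defined_def\<close>)
  then have "lerch (1 / x * (1 / z)) (1 / z) = - x / z * lerch (x * z) z"
    using nz by (simp add: power2_eq_square)
  then show ?thesis
    unfolding appell_m_eq jtheta_inverse[OF nz(2)] using nz by simp
qed

lemma appell_m_z_shift:
  assumes "x \<noteq> 0" "z \<noteq> 0"
  shows "appell_m x q (q * z) = appell_m x q z"
  using assms lerch_z_shift[of "x * z" z] jtheta_q_shift[of z]
  unfolding appell_m_eq by (simp add: mult_ac)

lemma appell_m_z_shift_powi:
  assumes "x \<noteq> 0" "z \<noteq> 0"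
  shows "appell_m x q (q powi k * z) = appell_m x q z"
proof -
  have nat: "appell_m x q (q ^ n * w) = appell_m x q w" if "w \<noteq> 0" for n w
    using appell_m_z_shift[of x "q ^ _ * w"] assms(1) that by (induction n) (simp_all add: mult.assoc)
  show ?thesis
  proof (cases k rule: int_cases2)
    case (nonneg n)
    then show ?thesis using nat assms by simp
  next
    case (nonpos n)
    then have "q ^ n * (q powi k * z) = z" by (simp add: power_int_minus)
    then show ?thesis using nat[of "q powi k * z" n] assms by (metis mult_eq_0_iff power_int_eq_0_iff q_nz)
  qed
qed

section \<open>The theta quotient and the change of parameter\<close>

lemma Delta_swap:
  assumes "z0 \<noteq> 0" "z1 \<noteq> 0"
  shows "Delta x z0 z1 q = - Delta x z1 z0 q"
proof -
  have "jtheta (z0 / z1) q = - (z0 / z1) * jtheta (z1 / z0) q"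
    using jtheta_inverse[of "z1 / z0"] assms by simp
  then have "z1 * jtheta (z0 / z1) q = - (z0 * jtheta (z1 / z0) q)"
    using assms by (simp add: field_simps)
  moreover have "Delta x z0 z1 q = (z1 * jtheta (z0 / z1) q) * (qpoch_inf q q ^ 3 * jtheta (x * z0 * z1) q /
     (jtheta z0 q * jtheta z1 q * jtheta (x * z0) q * jtheta (x * z1) q))"
    unfolding Delta_def by (simp add: mult_ac)
  ultimately show ?thesis
    unfolding Delta_def by (simp add: mult_ac)
qed

lemma holomorphic_Delta:
  assumes "z0 \<noteq> 0" "z1 \<noteq> 0" "jtheta z0 q \<noteq> 0" "jtheta z1 q \<noteq> 0"
    and "\<And>x. x \<in> A \<Longrightarrow> x \<noteq> 0 \<and> jtheta (x * z0) q \<noteq> 0 \<and> jtheta (x * z1) q \<noteq> 0"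
  shows "(\<lambda>x. Delta x z1 z0 q) holomorphic_on A"
  unfolding Delta_def using assms by (intro holomorphic_intros) auto

lemma Delta_q_shift:
  assumes "x \<noteq> 0" "z0 \<noteq> 0" "z1 \<noteq> 0"
  shows "Delta (q * x) z1 z0 q = - x * Delta x z1 z0 q"
proof -
  have "jtheta (q * x * z0 * z1) q = - jtheta (x * z0 * z1) q / (x * z0 * z1)"
    using jtheta_q_shift[of "x * z0 * z1"] assms by (simp add: mult.assoc)
  moreover have "jtheta (q * x * z0) q = - jtheta (x * z0) q / (x * z0)"
    using jtheta_q_shift[of "x * z0"] assms by (simp add: mult.assoc)
  moreover have "jtheta (q * x * z1) q = - jtheta (x * z1) q / (x * z1)"
    using jtheta_q_shift[of "x * z1"] assms by (simp add: mult.assoc)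
  ultimately show ?thesis unfolding Delta_def using assms by simp
qed

lemma powi_mult_eq_1_iff: "q powi (r - 1) * y = 1 \<longleftrightarrow> y = q powi (1 - r)"
  by (auto simp: power_int_diff field_simps)

text \<open>Brings an orbit relation with an integer exponent into the form with natural powers on
  both sides that \<open>q_periodic_eq_0\<close> asks for.\<close>

lemma orbit_powers: "\<exists>m n :: nat. q ^ m * (q powi k * p) = q ^ n * p"
proof (cases k rule: int_cases2)
  case (nonneg n)
  then show ?thesis by (intro exI[of _ 0] exI[of _ n]) auto
next
  case (nonpos n)
  then show ?thesis by (intro exI[of _ n] exI[of _ 0]) (auto simp: power_int_minus)
qed

lemma powi_q_neq_minus_1: "q powi k \<noteq> - 1"
proof
  assume k: "q powi k = - 1"
  then have "q powi (k + k) = q powi 0" by (subst power_int_add) auto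
  then have "k = 0" using powi_q_eq_iff[of "k + k" 0] by simp
  with k show False by simp
qed

lemma jtheta_minus_1_nz: "jtheta (- 1) q \<noteq> 0"
  using jtheta_nz[of "- 1"] powi_q_neq_minus_1 by (metis neg_equal_0_iff_equal one_neq_zero)

text \<open>The excluded points are zeros of the function \<open>jtheta (x * c) q\<close> of
  \<open>x\<close>, holomorphic on the connected punctured plane. It does not vanish identically, as
  its value at \<open>x = - 1 / c\<close> is \<open>jtheta (- 1) q\<close>.\<close>

lemma q_orbit_isolated:
  assumes c: "c \<noteq> 0" and p: "p \<noteq> 0"
  shows "\<exists>V. open V \<and> p \<in> V \<and> 0 \<notin> V \<and> (\<forall>x k. x \<in> V \<longrightarrow> x \<noteq> p \<longrightarrow> x * c \<noteq> q powi k)"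
proof -
  have hol: "(\<lambda>x. jtheta (x * c) q) holomorphic_on - {0}" using c by (intro holomorphic_intros) auto
  have notin: "x * c \<noteq> q powi k" if "jtheta (x * c) q \<noteq> 0" "x \<noteq> 0" for x and k :: int
    using jtheta_eq_0_iff[of "x * c"] c that by auto
  show ?thesis
  proof (cases "jtheta (p * c) q = 0")
    case True
    have x0: "- 1 / c \<in> - {0}" "jtheta (- 1 / c * c) q \<noteq> 0" using c jtheta_minus_1_nz by auto
    have "connected (- {0 :: complex})" by (rule connected_punctured_universe) simp
    then obtain r where
      r: "r > 0" "ball p r \<subseteq> - {0}" "\<And>z. z \<in> ball p r - {p} \<Longrightarrow> jtheta (z * c) q \<noteq> 0"
      using isolated_zeros[OF hol _ _ _ True x0] p by auto
    have "x * c \<noteq> q powi k" if "x \<in> ball p r" "x \<noteq> p" for x and k :: int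
      by (rule notin) (use that r in auto)
    then show ?thesis using r by (intro exI[of _ "ball p r"]) auto
  next
    case False
    have "open (- {0} \<inter> (\<lambda>x. jtheta (x * c) q) -` (- {0}))"
      by (rule continuous_open_preimage[OF holomorphic_on_imp_continuous_on[OF hol]]) auto
    then show ?thesis using False p notin
      by (intro exI[of _ "- {0} \<inter> (\<lambda>x. jtheta (x * c) q) -` (- {0})"]) auto
  qed
qed

lemma isCont_jtheta: "z \<noteq> 0 \<Longrightarrow> isCont (\<lambda>z. jtheta z q) z"
  using holomorphic_on_imp_continuous_on[OF holomorphic_jtheta]
  by (simp add: continuous_on_eq_continuous_at open_Compl)

text \<open>At \<open>x = 1 / z1\<close> the series with parameter \<open>z1\<close> and
  \<open>Delta\<close> have the same residue \<open>1 / jtheta z1 q\<close>, while the series with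
  parameter \<open>z0\<close> is regular because \<open>z0 / z1\<close> is not a power of
  \<open>q\<close>.\<close>

lemma appell_m_change_z_residue:
  assumes nz: "z0 \<noteq> 0" "z1 \<noteq> 0" and j: "jtheta z0 q \<noteq> 0" "jtheta z1 q \<noteq> 0" "jtheta (z1 / z0) q \<noteq> 0"
  shows "((\<lambda>x. (x - 1 / z1) * (appell_m x q z1 - appell_m x q z0 - Delta x z1 z0 q)) \<longlongrightarrow> 0) (at (1 / z1))"
proof -
  define p where "p = 1 / z1"
  have p: "p \<noteq> 0" "p * z1 = 1" using nz by (auto simp: p_def)
  have jc: "jtheta (z0 / z1) q = - (z0 / z1) * jtheta (z1 / z0) q"
    using jtheta_inverse[of "z1 / z0"] nz by simp
  then have j01: "jtheta (z0 / z1) q \<noteq> 0" using j nz by simp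
  have cont_j: "isCont (\<lambda>x. jtheta (x * c) q) p" if "c \<noteq> 0" for c
    using that p(1) by (intro isCont_o2[OF _ isCont_jtheta] continuous_intros) auto
  have cont_l: "isCont (\<lambda>x. lerch_on I (x * c) c) p"
    if c: "c \<noteq> 0" and I: "\<And>r. r \<in> I \<Longrightarrow> q powi (r - 1) * (p * c) \<noteq> 1" for I c
  proof -
    obtain V where V: "open V" "p \<in> V" "0 \<notin> V" "\<And>x k. x \<in> V \<Longrightarrow> x \<noteq> p \<Longrightarrow> x * c \<noteq> q powi k"
      using q_orbit_isolated[OF c p(1)] by blast
    have "(\<lambda>x. lerch_on I (x * c) c) holomorphic_on V"
    proof (rule holomorphic_lerch_on)
      fix x r assume x: "x \<in> V" and r: "r \<in> I"
      show "q powi (r - 1) * (x * c) \<noteq> 1"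
      proof (cases "x = p")
        case False
        then have "x * c \<noteq> q powi (1 - r)" using V x by blast
        then show ?thesis by (auto simp: power_int_diff field_simps)
      qed (use I r in auto)
    qed (use V c in \<open>auto intro!: holomorphic_intros\<close>)
    then have "continuous_on V (\<lambda>x. lerch_on I (x * c) c)" by (rule holomorphic_on_imp_continuous_on)
    then show ?thesis using V by (simp add: continuous_on_eq_continuous_at)
  qed
  have q1: "q powi (r - 1) \<noteq> 1" if "r \<noteq> 1" for r
    using powi_q_eq_iff[of "r - 1" 0] that by simp
  have lim1: "((\<lambda>x. (x - p) * appell_m x q z1) \<longlongrightarrow> 1 / jtheta z1 q) (at p)"
  proof -
    let ?r = "\<lambda>x. lerch_on (- {1}) (x * z1) z1"
    have c: "isCont ?r p"
      by (rule cont_l) (use nz p q1 in auto)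
    have "((\<lambda>x. (1 + (x - p) * ?r x) / jtheta z1 q) \<longlongrightarrow>
       (1 + (p - p) * ?r p) / jtheta z1 q) (at p)"
      using j(2) by (intro tendsto_intros isContD[OF c]) auto
    moreover have "\<forall>\<^sub>F x in at p. (1 + (x - p) * ?r x) / jtheta z1 q = (x - p) * appell_m x q z1"
    proof -
      have "\<forall>\<^sub>F x in at p. x \<noteq> 0 \<and> x \<noteq> p"
        using eventually_neq_at_within[of p] eventually_neq_at_within[of 0 p UNIV] by eventually_elim auto
      then show ?thesis
      proof eventually_elim
        case (elim x)
        \<comment> \<open>Since \<open>p * z1 = 1\<close>, the polar term
          \<open>- z1 / (1 - x * z1)\<close> is exactly \<open>1 / (x - p)\<close>.\<close>
        have "1 - x * z1 = - z1 * (x - p)" using p by (simp add: algebra_simps)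
        moreover have "x - p \<noteq> 0" using elim by simp
        ultimately have "(x - p) * (- z1 / (1 - x * z1)) = 1" using nz by simp
        moreover have "lerch (x * z1) z1 = - z1 / (1 - x * z1) + ?r x"
          by (rule lerch_split) (use elim nz in auto)
        ultimately have "(x - p) * lerch (x * z1) z1 = 1 + (x - p) * ?r x"
          by (simp only: distrib_left)
        then show ?case unfolding appell_m_eq by simp
      qed
    qed
    ultimately show ?thesis by (simp add: Lim_transform_eventually)
  qed
  have lim0: "((\<lambda>x. (x - p) * appell_m x q z0) \<longlongrightarrow> 0) (at p)"
  proof -
    have "p * z0 \<noteq> q powi k" for k
      using j01 jtheta_eq_0_iff[of "p * z0"] nz p by (auto simp: p_def)
    then have "q powi (r - 1) * (p * z0) \<noteq> 1" for r
      by (simp add: powi_mult_eq_1_iff)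
    then have c: "isCont (\<lambda>x. lerch (x * z0) z0) p"
      using nz by (intro cont_l) auto
    have "((\<lambda>x. (x - p) * (lerch (x * z0) z0 / jtheta z0 q)) \<longlongrightarrow> (p - p) * (lerch (p * z0) z0 / jtheta z0 q)) (at p)"
      using j by (intro tendsto_intros isContD[OF c]) auto
    then show ?thesis unfolding appell_m_eq by simp
  qed
  have limD: "((\<lambda>x. (x - p) * Delta x z1 z0 q) \<longlongrightarrow> 1 / jtheta z1 q) (at p)"
  proof -
    define C where "C = z0 * qpoch_inf q q ^ 3 * jtheta (z1 / z0) q / (jtheta z0 q * jtheta z1 q)"
    let ?L = "\<lambda>x. (- 1 / z1) * (C * jtheta (x * z0 * z1) q / jtheta (x * z0) q) * inverse (jtheta (x * z1) q / (1 - x * z1))"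
    have fl: "filterlim (\<lambda>x. x * z1) (at 1) (at p)"
      using nz unfolding p_def
      by (auto simp: filterlim_at eventually_at field_simps intro!: tendsto_eq_intros exI[of _ 1])
    have "((\<lambda>x. jtheta (x * z1) q / (1 - x * z1)) \<longlongrightarrow> qpoch_inf q q ^ 3) (at p)"
      using filterlim_compose[OF jtheta_tendsto_1 fl] .
    then have "(?L
      \<longlongrightarrow> (- 1 / z1) * (C * jtheta (p * z0 * z1) q / jtheta (p * z0) q) * inverse (qpoch_inf q q ^ 3)) (at p)"
      using isContD[OF cont_j[of "z0"]] isContD[OF cont_j[of "z0 * z1"]] nz j01
      by (intro tendsto_intros) (auto simp: mult.assoc p_def)
    also have "(- 1 / z1) * (C * jtheta (p * z0 * z1) q / jtheta (p * z0) q) * inverse (qpoch_inf q q ^ 3) = 1 / jtheta z1 q"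
    proof -
      \<comment> \<open>At \<open>p\<close> one theta factor of the numerator becomes
        \<open>jtheta z0 q\<close>, and inversion relates \<open>jtheta (z0 / z1) q\<close> to
        \<open>jtheta (z1 / z0) q\<close>; then everything cancels except
        \<open>1 / jtheta z1 q\<close>.\<close>
      have pz: "p * z0 * z1 = z0" "p * z0 = z0 / z1" using nz by (auto simp: p_def)
      show ?thesis unfolding C_def pz jc using nz j by (simp add: field_simps)
    qed
    finally have "(?L
      \<longlongrightarrow> 1 / jtheta z1 q) (at p)" .
    moreover have "?L x
       = (x - p) * Delta x z1 z0 q" for x
    proof -
      have "(- 1 / z1) * (1 - x * z1) = x - p" using nz by (simp add: p_def field_simps)
      moreover have "?L x
        = ((- 1 / z1) * (1 - x * z1)) * Delta x z1 z0 q"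
        unfolding C_def Delta_def by (simp add: divide_inverse mult_ac)
      ultimately show ?thesis by simp
    qed
    ultimately show ?thesis by simp
  qed
  have "((\<lambda>x. (x - p) * appell_m x q z1 - (x - p) * appell_m x q z0 - (x - p) * Delta x z1 z0 q) \<longlongrightarrow>
    1 / jtheta z1 q - 0 - 1 / jtheta z1 q) (at p)"
    by (intro tendsto_diff lim1 lim0 limD)
  then show ?thesis by (simp add: p_def algebra_simps)
qed

text \<open>The difference \<open>g\<close> of the two sides satisfies
  \<open>g (q * x) = - x * g x\<close>, which multiplication by \<open>jtheta x q\<close> turns into
  periodicity. The zero of this factor at \<open>x = 1\<close> is the point where the periodic
  function is known to vanish.\<close>

theorem appell_m_change_z:
  assumes d0: "appell_m_defined x q z0" and d1: "appell_m_defined x q z1"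
  shows "appell_m x q z1 - appell_m x q z0 = Delta x z1 z0 q"
proof (cases "jtheta (z1 / z0) q = 0")
  \<comment> \<open>Here the orbits of \<open>1 / z0\<close> and \<open>1 / z1\<close> coincide and
    their poles are not separate. Both sides are 0: \<open>m\<close> is invariant under
    \<open>z\<close> to \<open>q z\<close>, and \<open>Delta\<close> contains the vanishing theta
    factor.\<close>
  case True
  then obtain k :: int where "z1 / z0 = q powi k"
    using d0 d1 jtheta_eq_0_iff[of "z1 / z0"] by (auto simp: appell_m_defined_def)
  then have "z1 = q powi k * z0" using d0 by (auto simp: appell_m_defined_def field_simps)
  then show ?thesis
    using appell_m_z_shift_powi[of x z0 k] True d0 by (simp add: Delta_def appell_m_defined_def)
next
  case False
  have nz: "x \<noteq> 0" "z0 \<noteq> 0" "z1 \<noteq> 0" using d0 d1 by (auto simp: appell_m_defined_def)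
  have j: "jtheta z0 q \<noteq> 0" "jtheta z1 q \<noteq> 0" "jtheta (x * z0) q \<noteq> 0" "jtheta (x * z1) q \<noteq> 0"
    using d0 d1 nz by (auto simp: appell_m_defined_def jtheta_eq_0_iff)
  have False': "jtheta (z0 / z1) q \<noteq> 0"
    using jtheta_inverse[of "z1 / z0"] nz False by simp
  define g where "g = (\<lambda>x. appell_m x q z1 - appell_m x q z0 - Delta x z1 z0 q)"
  define h where "h = (\<lambda>x. jtheta (x * z0) q * jtheta (x * z1) q)"
  define F where "F = (\<lambda>x. g x * jtheta x q)"
  \<comment> \<open>Large enough for the disc to contain \<open>x\<close>, the base point 1 and one
    representative of each of the two orbits of poles.\<close>
  define \<rho> where "\<rho> = 2 + norm x + 1 / norm z0 + 1 / norm z1"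
  define D where "D = {w :: complex. 0 < norm w \<and> norm w < \<rho>}"
  have D: "D = ball 0 \<rho> - {0}" by (auto simp: D_def)
  have opn: "open D" unfolding D by auto
  have \<rho>: "\<rho> > 1" "norm x < \<rho>" "norm (1 / z0) < \<rho>" "norm (1 / z1) < \<rho>"
    by (auto simp: \<rho>_def norm_divide add_pos_nonneg)
  have inD: "x \<in> D" "1 / z0 \<in> D" "1 / z1 \<in> D" "1 \<in> D" using \<rho> nz by (auto simp: D_def)
  have hol_h: "h holomorphic_on D"
    unfolding h_def using nz by (intro holomorphic_intros) (auto simp: D_def)
  have pole: "w \<noteq> 0 \<and> (\<forall>k::int. w * z0 \<noteq> q powi k \<and> w * z1 \<noteq> q powi k)" if "w \<in> D" "h w \<noteq> 0" for w
    using that nz unfolding h_def D_def by (auto simp: jtheta_eq_0_iff)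
  have pole': "q powi (r - 1) * (w * z0) \<noteq> 1 \<and> q powi (r - 1) * (w * z1) \<noteq> 1" if "w \<in> D" "h w \<noteq> 0" for w r
    using pole[OF that] by (auto simp: power_int_diff field_simps dest!: spec[of _ "1 - r"])
  have opn': "open {w\<in>D. h w \<noteq> 0}"
  proof -
    have "{w\<in>D. h w \<noteq> 0} = D \<inter> h -` (- {0})" by auto
    also have "open \<dots>"
      by (rule continuous_open_preimage[OF holomorphic_on_imp_continuous_on[OF hol_h] opn]) auto
    finally show ?thesis .
  qed
  have hol_g: "g holomorphic_on {w\<in>D. h w \<noteq> 0}"
    unfolding g_def appell_m_eq
    by (intro holomorphic_intros opn' holomorphic_Delta) (use pole' nz j in \<open>auto simp: h_def D_def\<close>)
  have hol_F: "F holomorphic_on {w\<in>D. h w \<noteq> 0}"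
    unfolding F_def by (intro holomorphic_intros hol_g) (auto simp: D_def)
  have h_shift: "h (q * w) = h w / (w ^ 2 * z0 * z1)" if "w \<noteq> 0" for w
    using jtheta_q_shift[of "w * z0"] jtheta_q_shift[of "w * z1"] nz that
    unfolding h_def by (simp add: mult.assoc power2_eq_square mult_ac)
  have res: "((\<lambda>w. (w - p) * F w) \<longlongrightarrow> 0) (at p)" if p: "p = 1 / z0 \<or> p = 1 / z1" for p
  proof -
    have "((\<lambda>w. (w - p) * g w) \<longlongrightarrow> 0) (at p)"
      using p
    proof
      assume "p = 1 / z1"
      then show ?thesis unfolding g_def using appell_m_change_z_residue[OF nz(2,3) j(1,2) False] by simp
    next
      assume p: "p = 1 / z0"
      \<comment> \<open>Exchanging \<open>z0\<close> and \<open>z1\<close> negates \<open>g\<close>,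
        which reduces the pole at \<open>1 / z0\<close> to the one already treated.\<close>
      have "(w - p) * g w = - ((w - p) * (appell_m w q z0 - appell_m w q z1 - Delta w z0 z1 q))" for w
        unfolding g_def Delta_swap[OF nz(2,3)] by (simp add: algebra_simps)
      then show ?thesis
        using tendsto_minus[OF appell_m_change_z_residue[OF nz(3,2) j(2,1) False']] p by simp
    qed
    then have "((\<lambda>w. (w - p) * g w * jtheta w q) \<longlongrightarrow> 0 * jtheta p q) (at p)"
      using p nz by (intro tendsto_intros isContD[OF isCont_jtheta]) auto
    then show ?thesis by (simp add: F_def mult.assoc)
  qed
  have F0: "F w = 0" if w: "w \<in> D" "h w \<noteq> 0" for w
  proof (rule q_periodic_eq_0[OF \<rho>(1) D_def hol_h _ hol_F])
    fix w assume w: "w \<in> D"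
    then have wnz: "w \<noteq> 0" by (auto simp: D_def)
    show "h (q * w) = 0 \<longleftrightarrow> h w = 0" using h_shift[OF wnz] wnz nz by simp
    show "F (q * w) = F w" if "h w \<noteq> 0"
    proof -
      have "appell_m_defined w q z0" "appell_m_defined w q z1"
        using pole[OF w that] d0 d1 by (auto simp: appell_m_defined_def)
      then have "g (q * w) = - w * g w"
        unfolding g_def using Delta_q_shift[of w z0 z1] wnz nz
        by (simp add: appell_m_q_shift algebra_simps)
      then show ?thesis unfolding F_def using jtheta_q_shift[OF wnz] wnz by simp
    qed
    assume "h w = 0"
    then obtain k :: int where "w * z0 = q powi k \<or> w * z1 = q powi k"
      using nz wnz unfolding h_def by (auto simp: jtheta_eq_0_iff)
    then have "w = q powi k * (1 / z0) \<or> w = q powi k * (1 / z1)"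
      using nz by (auto simp: field_simps)
    then obtain p where p: "p = 1 / z0 \<or> p = 1 / z1" "w = q powi k * p"
      by blast
    from orbit_powers[of k p] show "\<exists>p0\<in>D. \<exists>m n. q ^ m * w = q ^ n * p0 \<and> ((\<lambda>w. (w - p0) * F w) \<longlongrightarrow> 0) (at p0)"
      using p res[of p] inD by blast
  next
    show "1 \<in> D" "h 1 \<noteq> 0" "F 1 = 0" using inD j by (auto simp: h_def F_def)
  qed (use w in auto)
  have hx: "h x \<noteq> 0" using j by (simp add: h_def)
  \<comment> \<open>If \<open>x\<close> is itself a power of \<open>q\<close>, then
    \<open>jtheta x q = 0\<close> and \<open>F x = 0\<close> says nothing about \<open>g x\<close>.
    The value is recovered by continuity from nearby points off the orbit of 1.\<close>
  have cont: "(g \<longlongrightarrow> g x) (at x)"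
  proof -
    have "continuous_on {w\<in>D. h w \<noteq> 0} g" using hol_g by (rule holomorphic_on_imp_continuous_on)
    then show ?thesis using opn' inD hx by (simp add: continuous_on_eq_continuous_at isCont_def)
  qed
  have "\<forall>\<^sub>F w in at x. g w = 0"
  proof -
    obtain V where V: "open V" "x \<in> V" "0 \<notin> V" "\<And>w k. w \<in> V \<Longrightarrow> w \<noteq> x \<Longrightarrow> w * 1 \<noteq> q powi k"
      using q_orbit_isolated[of 1 x] nz by auto
    have "\<forall>\<^sub>F w in at x. w \<in> V \<inter> {w\<in>D. h w \<noteq> 0}"
      by (rule eventually_at_in_open') (use V opn' inD hx in auto)
    moreover have "\<forall>\<^sub>F w in at x. w \<noteq> x" by (rule eventually_neq_at_within)
    ultimately show ?thesis
    proof eventually_elim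
      case (elim w)
      then have "jtheta w q \<noteq> 0" using V jtheta_nz[of w] by fastforce
      then show ?case using F0[of w] elim by (simp add: F_def)
    qed
  qed
  then have "(g \<longlongrightarrow> 0) (at x)" by (rule tendsto_eventually)
  with cont have "g x = 0" using tendsto_unique trivial_limit_at by blast
  then show ?thesis by (simp add: g_def)
qed

end

section \<open>Overpartitions by largest part\<close>

text \<open>Iterated summability of complex terms would not suffice for the double sum. The fibre
  sums \<open>n x\<close> of the norms provide absolute summability over the whole index
  set.\<close>

lemma has_sum_Sigma_complex:
  fixes f :: "'a \<times> 'b \<Rightarrow> complex"
  assumes f: "\<And>x. x \<in> A \<Longrightarrow> ((\<lambda>y. f (x, y)) has_sum g x) (B x)"
    and n: "\<And>x. x \<in> A \<Longrightarrow> ((\<lambda>y. norm (f (x, y))) has_sum n x) (B x)"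
    and sum: "n summable_on A"
  shows "(f has_sum (\<Sum>\<^sub>\<infinity>x\<in>A. g x)) (Sigma A B)"
proof (rule has_sum_SigmaI[OF f])
  have "norm (g x) \<le> n x" if "x \<in> A" for x
    by (rule norm_infsum_le[OF f[OF that] n[OF that]]) auto
  then have "g summable_on A"
    by (intro abs_summable_summable[OF summable_on_comparison_test[OF sum]]) auto
  then show "(g has_sum (\<Sum>\<^sub>\<infinity>x\<in>A. g x)) A" by (rule has_sum_infsum)
  have "(\<lambda>p. norm (f p)) summable_on Sigma A B"
    by (rule summable_on_SigmaI[OF n sum]) auto
  then show "f summable_on Sigma A B" by (rule abs_summable_summable)
qed

lemma has_sum_Times_complex:
  fixes f :: "'a \<Rightarrow> complex" and g :: "'b \<Rightarrow> complex"
  assumes f: "(f has_sum a) A" and g: "(g has_sum b) B"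
  shows "((\<lambda>(x, y). f x * g y) has_sum a * b) (A \<times> B)"
proof -
  have nf: "(\<lambda>x. norm (f x)) summable_on A" and ng: "(\<lambda>y. norm (g y)) summable_on B"
    using f g has_sum_imp_summable summable_on_iff_abs_summable_on_complex by blast+
  have "((\<lambda>(x, y). f x * g y) has_sum (\<Sum>\<^sub>\<infinity>x\<in>A. f x * b)) (A \<times> B)"
  proof (rule has_sum_Sigma_complex)
    show "((\<lambda>y. case (x, y) of (x, y) \<Rightarrow> f x * g y) has_sum f x * b) B" for x
      using has_sum_cmult_right[OF g] by simp
    show "((\<lambda>y. norm (case (x, y) of (x, y) \<Rightarrow> f x * g y)) has_sum norm (f x) * (\<Sum>\<^sub>\<infinity>y\<in>B. norm (g y))) B" for x
      using has_sum_cmult_right[OF has_sum_infsum[OF ng]] by (simp add: norm_mult)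
    show "(\<lambda>x. norm (f x) * (\<Sum>\<^sub>\<infinity>y\<in>B. norm (g y))) summable_on A"
      by (rule summable_on_cmult_left[OF nf])
  qed
  also have "(\<Sum>\<^sub>\<infinity>x\<in>A. f x * b) = a * b"
    using has_sum_cmult_left[OF f] by (rule infsumI)
  finally show ?thesis .
qed

text \<open>The size condition is split off so that overpartitions of all sizes form one index set,
  which can be grouped by largest part as well as by size.\<close>

definition opar :: "(nat \<times> bool) list \<Rightarrow> bool" where
  "opar xs \<longleftrightarrow> sorted_wrt (\<ge>) (map fst xs) \<and> (\<forall>p\<in>set xs. fst p > 0) \<and>
     (\<forall>i<length xs. snd (xs ! i) \<longrightarrow> (\<forall>j<i. fst (xs ! j) \<noteq> fst (xs ! i)))"

definition opar_size :: "(nat \<times> bool) list \<Rightarrow> nat" where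
  "opar_size xs = sum_list (map fst xs)"

lemma overpartitions_eq: "overpartitions n = {xs. opar xs \<and> opar_size xs = n}"
  unfolding overpartitions_def opar_def opar_size_def by auto

lemma opar_Nil [simp]: "opar []"
  by (simp add: opar_def)

lemma opar_size_simps [simp]:
  "opar_size [] = 0" "opar_size (x # xs) = fst x + opar_size xs"
  "opar_size (xs @ ys) = opar_size xs + opar_size ys" "opar_size (replicate c x) = c * fst x"
  by (simp_all add: opar_size_def sum_list_replicate)

lemma opar_Cons:
  "opar (x # xs) \<longleftrightarrow>
     fst x > 0 \<and> (\<forall>y\<in>set xs. fst y \<le> fst x \<and> (snd y \<longrightarrow> fst y \<noteq> fst x)) \<and> opar xs"
proof -
  have "(\<forall>i<length (x # xs). snd ((x # xs) ! i) \<longrightarrow> (\<forall>j<i. fst ((x # xs) ! j) \<noteq> fst ((x # xs) ! i))) \<longleftrightarrow>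
     (\<forall>y\<in>set xs. snd y \<longrightarrow> fst y \<noteq> fst x) \<and>
     (\<forall>i<length xs. snd (xs ! i) \<longrightarrow> (\<forall>j<i. fst (xs ! j) \<noteq> fst (xs ! i)))"
    by (auto simp: All_less_Suc2 all_set_conv_all_nth)
  then show ?thesis unfolding opar_def by auto
qed

definition opars_upto :: "nat \<Rightarrow> (nat \<times> bool) list set" where
  "opars_upto l = {xs. opar xs \<and> (\<forall>p\<in>set xs. fst p \<le> l)}"

text \<open>What may follow a first part \<open>l\<close>: further copies of \<open>l\<close> are
  allowed but cannot be overlined.\<close>

definition opars_tail :: "nat \<Rightarrow> (nat \<times> bool) list set" where
  "opars_tail l = {xs \<in> opars_upto l. (l, True) \<notin> set xs}"

definition opars_max :: "nat \<Rightarrow> (nat \<times> bool) list set" where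
  "opars_max l = {xs \<in> opars_upto l. xs \<noteq> [] \<and> fst (hd xs) = l}"

lemma opars_upto_0: "opars_upto 0 = {[]}"
proof -
  have "xs = []" if "xs \<in> opars_upto 0" for xs
    using that by (cases xs) (auto simp: opars_upto_def opar_Cons)
  then show ?thesis by (auto simp: opars_upto_def)
qed

lemma opars_upto_Suc: "opars_upto (Suc l) = opars_upto l \<union> opars_max (Suc l)"
proof -
  have "xs \<in> opars_upto l" if "xs \<in> opars_upto (Suc l)" "xs \<notin> opars_max (Suc l)" for xs
    using that by (cases xs) (auto simp: opars_upto_def opars_max_def opar_Cons)
  then show ?thesis by (auto simp: opars_upto_def opars_max_def)
qed

lemma opars_upto_max_disjoint: "opars_upto l \<inter> opars_max (Suc l) = {}"
proof -
  have "fst (hd xs) \<le> l" if "xs \<in> opars_upto l" "xs \<noteq> []" for xs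
    using that by (cases xs) (auto simp: opars_upto_def)
  then show ?thesis by (force simp: opars_max_def)
qed

text \<open>The Boolean records whether the first copy of the largest part is overlined; it is the
  origin of the factor 2 in the generating function.\<close>

lemma bij_opars_max:
  assumes "l > 0"
  shows "bij_betw (\<lambda>(b, xs). (l, b) # xs) (UNIV \<times> opars_tail l) (opars_max l)"
  unfolding bij_betw_def
proof
  show "inj_on (\<lambda>(b, xs). (l, b) # xs) (UNIV \<times> opars_tail l)" by (auto simp: inj_on_def)
  show "(\<lambda>(b, xs). (l, b) # xs) ` (UNIV \<times> opars_tail l) = opars_max l"
  proof (intro equalityI subsetI)
    fix ys assume "ys \<in> opars_max l"
    then show "ys \<in> (\<lambda>(b, xs). (l, b) # xs) ` (UNIV \<times> opars_tail l)"
      by (cases ys) (auto simp: opars_max_def opars_tail_def opars_upto_def opar_Cons image_iff)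
  qed (use assms in \<open>fastforce simp: opars_max_def opars_tail_def opars_upto_def opar_Cons\<close>)
qed

lemma opars_tail_decompose:
  assumes "xs \<in> opars_tail (Suc l)"
  shows "\<exists>c. \<exists>ys\<in>opars_upto l. xs = replicate c (Suc l, False) @ ys"
  using assms
proof (induction xs)
  case Nil
  show ?case by (intro exI[of _ 0] bexI[of _ "[]"]) (auto simp: opars_upto_def)
next
  case (Cons x xs)
  show ?case
  proof (cases "fst x = Suc l")
    case True
    then have x: "x = (Suc l, False)"
      using Cons.prems by (cases x) (auto simp: opars_tail_def)
    have "xs \<in> opars_tail (Suc l)"
      using Cons.prems by (auto simp: opars_tail_def opars_upto_def opar_Cons)
    then obtain c ys where "ys \<in> opars_upto l" "xs = replicate c (Suc l, False) @ ys"
      using Cons.IH by blast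
    then show ?thesis using x by (intro exI[of _ "Suc c"] bexI[of _ ys]) auto
  next
    case False
    then have "x # xs \<in> opars_upto l"
      using Cons.prems by (auto simp: opars_tail_def opars_upto_def opar_Cons)
    then show ?thesis by (intro exI[of _ 0] bexI[of _ "x # xs"]) auto
  qed
qed

text \<open>The number \<open>c\<close> of plain copies of the part \<open>l + 1\<close> is free and
  can be read off by counting; it yields the geometric series in the generating function.\<close>

lemma bij_opars_tail:
  "bij_betw (\<lambda>(c, xs). replicate c (Suc l, False) @ xs) (UNIV \<times> opars_upto l) (opars_tail (Suc l))"
  unfolding bij_betw_def
proof
  have count: "length (filter (\<lambda>p. fst p = Suc l) (replicate c (Suc l, False) @ xs)) = c"
    if "xs \<in> opars_upto l" for c xs
  proof -
    have "filter (\<lambda>p. fst p = Suc l) xs = []"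
      using that by (force simp: opars_upto_def filter_empty_conv)
    then show ?thesis by simp
  qed
  show "inj_on (\<lambda>(c, xs). replicate c (Suc l, False) @ xs) (UNIV \<times> opars_upto l)"
  proof (rule inj_onI, clarify)
    fix c xs c' xs'
    assume "xs \<in> opars_upto l" "xs' \<in> opars_upto l"
      and eq: "replicate c (Suc l, False) @ xs = replicate c' (Suc l, False) @ xs'"
    then have "c = c'" using count by metis
    with eq show "c = c' \<and> xs = xs'" by simp
  qed
  have mem: "replicate c (Suc l, False) @ xs \<in> opars_tail (Suc l)" if "xs \<in> opars_upto l" for c xs
  proof (induction c)
    case 0
    then show ?case using that by (fastforce simp: opars_tail_def opars_upto_def)
  next
    case (Suc c)
    have "\<forall>y\<in>set (replicate c (Suc l, False) @ xs). snd y \<longrightarrow> fst y \<noteq> Suc l"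
      using that by (force simp: opars_upto_def)
    with Suc show ?case by (auto simp: opars_tail_def opars_upto_def opar_Cons)
  qed
  show "(\<lambda>(c, xs). replicate c (Suc l, False) @ xs) ` (UNIV \<times> opars_upto l) = opars_tail (Suc l)"
    using mem opars_tail_decompose by (fastforce simp: image_iff)
qed

text \<open>Groups the nonempty overpartitions by their largest part \<open>m + 1\<close>. The empty
  one has no largest part and enters the rank series as a separate term 1.\<close>

lemma opar_Sigma: "bij_betw snd (SIGMA m:UNIV. opars_max (Suc m)) ({xs. opar xs} - {[]})"
  unfolding bij_betw_def
proof
  show "inj_on snd (SIGMA m:UNIV. opars_max (Suc m))"
    by (auto simp: inj_on_def opars_max_def)
  have "xs \<in> opars_max (fst (hd xs)) \<and> fst (hd xs) > 0" if "opar xs" "xs \<noteq> []" for xs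
    using that by (cases xs) (auto simp: opars_max_def opars_upto_def opar_Cons)
  then have "\<exists>m. xs \<in> opars_max (Suc m)" if "opar xs" "xs \<noteq> []" for xs
    using that by (metis gr0_conv_Suc)
  then show "snd ` (SIGMA m:UNIV. opars_max (Suc m)) = {xs. opar xs} - {[]}"
    by (force simp: opars_max_def opars_upto_def image_iff)
qed

lemma overpartition_rank_max:
  assumes "xs \<in> opars_max l"
  shows "overpartition_rank xs = int l - int (length xs)"
proof -
  have "Max (fst ` set xs) = l"
    by (rule Max_eqI) (use assms in \<open>auto simp: opars_max_def opars_upto_def intro!: image_eqI[of _ _ "hd xs"]\<close>)
  then show ?thesis using assms by (auto simp: overpartition_rank_def opars_max_def)
qed

lemma finite_overpartitions: "finite (overpartitions n)"
proof (rule finite_subset)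
  show "overpartitions n \<subseteq> {xs. set xs \<subseteq> {..n} \<times> UNIV \<and> length xs \<le> n}"
  proof
    fix xs assume xs: "xs \<in> overpartitions n"
    have "fst p \<le> n" if "p \<in> set xs" for p
      using member_le_sum_list[of "fst p" "map fst xs"] xs that by (auto simp: overpartitions_def)
    moreover have "length xs \<le> opar_size xs" if "\<forall>p\<in>set xs. fst p > 0" for xs :: "(nat \<times> bool) list"
      using that by (induction xs) auto
    then have "length xs \<le> n" using xs by (auto simp: overpartitions_eq opar_def)
    ultimately show "xs \<in> {xs. set xs \<subseteq> {..n} \<times> UNIV \<and> length xs \<le> n}" by force
  qed
  show "finite {xs :: (nat \<times> bool) list. set xs \<subseteq> {..n} \<times> UNIV \<and> length xs \<le> n}"
    by (rule finite_lists_length_le) auto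
qed

section \<open>Generating functions for a bounded or prescribed largest part\<close>

context nome
begin

text \<open>For \<open>y = 1 / w\<close> and largest part \<open>l\<close>, the rank weight is
  \<open>w ^ l\<close> times this weight; once \<open>l\<close> is fixed, only the number of parts
  has to be tracked.\<close>

definition opar_weight :: "complex \<Rightarrow> (nat \<times> bool) list \<Rightarrow> complex" where
  "opar_weight y xs = y ^ length xs * q ^ opar_size xs"

text \<open>The classical product for overpartitions with parts at most \<open>m\<close>: overlined
  parts form a partition into distinct parts, counted by the numerators, and the other parts an
  arbitrary partition, counted by the denominators.\<close>

definition opar_prod :: "complex \<Rightarrow> nat \<Rightarrow> complex" where
  "opar_prod y m = (\<Prod>k<m. (1 + y * q ^ Suc k) / (1 - y * q ^ Suc k))"

context
  fixes y :: complex
  assumes y: "norm y \<le> 1"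
begin

lemma norm_yq: "norm (y * q ^ Suc m) < 1"
proof -
  have "norm y * norm (q ^ Suc m) \<le> norm (q ^ Suc m)"
    using y by (intro mult_left_le_one_le) auto
  also have "\<dots> < 1" using q_lt1 by (simp only: norm_power power_less_one_iff norm_ge_zero) simp
  finally show ?thesis by (simp add: norm_mult)
qed

lemma opars_tail_has_sum:
  assumes "(opar_weight y has_sum s) (opars_upto m)"
  shows "(opar_weight y has_sum (1 / (1 - y * q ^ Suc m) * s)) (opars_tail (Suc m))"
proof -
  have "((\<lambda>c. (y * q ^ Suc m) ^ c) has_sum (1 / (1 - y * q ^ Suc m))) UNIV"
  proof (rule norm_summable_imp_has_sum)
    show "summable (\<lambda>c. norm ((y * q ^ Suc m) ^ c))"
      unfolding norm_power by (rule summable_geometric) (use norm_yq[of m] in simp)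
    show "(\<lambda>c. (y * q ^ Suc m) ^ c) sums (1 / (1 - y * q ^ Suc m))"
      by (rule geometric_sums[OF norm_yq])
  qed
  from has_sum_Times_complex[OF this assms] have
    "((\<lambda>(c, xs). (y * q ^ Suc m) ^ c * opar_weight y xs) has_sum (1 / (1 - y * q ^ Suc m) * s)) (UNIV \<times> opars_upto m)" .
  also have "(\<lambda>(c, xs). (y * q ^ Suc m) ^ c * opar_weight y xs) =
      (\<lambda>p. opar_weight y ((\<lambda>(c, xs). replicate c (Suc m, False) @ xs) p))"
    by (auto simp: opar_weight_def fun_eq_iff power_add power_mult_distrib power_mult[symmetric] mult_ac)
  finally show ?thesis
    by (subst (asm) has_sum_reindex_bij_betw[OF bij_opars_tail])
qed

lemma opars_max_has_sum:
  assumes "(opar_weight y has_sum s) (opars_upto m)"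
  shows "(opar_weight y has_sum (2 * y * q ^ Suc m / (1 - y * q ^ Suc m) * s)) (opars_max (Suc m))"
proof -
  have "((\<lambda>b :: bool. y * q ^ Suc m) has_sum (2 * y * q ^ Suc m)) UNIV"
    by (rule has_sum_finiteI) (auto simp: UNIV_bool)
  from has_sum_Times_complex[OF this opars_tail_has_sum[OF assms]] have
    "((\<lambda>(b :: bool, xs). y * q ^ Suc m * opar_weight y xs) has_sum (2 * y * q ^ Suc m * (1 / (1 - y * q ^ Suc m) * s)))
       (UNIV \<times> opars_tail (Suc m))" .
  also have "(\<lambda>(b :: bool, xs). y * q ^ Suc m * opar_weight y xs) =
      (\<lambda>p. opar_weight y ((\<lambda>(b, xs). (Suc m, b) # xs) p))"
    by (auto simp: opar_weight_def fun_eq_iff power_add mult_ac)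
  finally show ?thesis
    by (subst (asm) has_sum_reindex_bij_betw[OF bij_opars_max]) auto
qed

text \<open>Allowing the next part size adds the overpartitions with exactly that largest part; the
  induction step is \<open>1 + 2u/(1-u) = (1+u)/(1-u)\<close> with
  \<open>u = y * q ^ Suc m\<close>.\<close>

lemma opars_upto_has_sum: "(opar_weight y has_sum opar_prod y m) (opars_upto m)"
proof (induction m)
  case 0
  show ?case unfolding opars_upto_0 by (rule has_sum_finiteI) (auto simp: opar_weight_def opar_prod_def)
next
  case (Suc m)
  have nz: "1 - y * q ^ Suc m \<noteq> 0" using norm_yq[of m] by (metis eq_iff_diff_eq_0 norm_one order_less_irrefl)
  have "(opar_weight y has_sum (opar_prod y m + 2 * y * q ^ Suc m / (1 - y * q ^ Suc m) * opar_prod y m)) (opars_upto (Suc m))"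
    unfolding opars_upto_Suc
    by (rule has_sum_Un_disjoint[OF Suc.IH opars_max_has_sum[OF Suc.IH] opars_upto_max_disjoint])
  also have "opar_prod y m + 2 * y * q ^ Suc m / (1 - y * q ^ Suc m) * opar_prod y m = opar_prod y (Suc m)"
  proof -
    have "1 + 2 * y * q ^ Suc m / (1 - y * q ^ Suc m) = (1 + y * q ^ Suc m) / (1 - y * q ^ Suc m)"
      using nz by (simp add: divide_simps del: power_Suc)
    moreover have "opar_prod y (Suc m) = opar_prod y m * ((1 + y * q ^ Suc m) / (1 - y * q ^ Suc m))"
      by (simp add: opar_prod_def)
    ultimately show ?thesis by (metis distrib_right mult.commute mult_1)
  qed
  finally show ?case .
qed

end

text \<open>The total of the norms of all terms with largest part \<open>m + 1\<close> in the rank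
  series for \<open>|w| = 1\<close>, where the rank factor has modulus 1.\<close>

definition opar_norm :: "nat \<Rightarrow> real" where
  "opar_norm m = 2 * norm q ^ Suc m / (1 - norm q ^ Suc m) *
      (\<Prod>k<m. (1 + norm q ^ Suc k) / (1 - norm q ^ Suc k))"

lemma norm_weight_has_sum:
  "((\<lambda>xs. norm q ^ opar_size xs) has_sum opar_norm m) (opars_max (Suc m))"
proof -
  \<comment> \<open>With base \<open>norm q\<close> and \<open>y = 1\<close> the complex generating
    function is the sum of norms itself.\<close>
  interpret R: nome "complex_of_real (norm q)"
    by standard (use q_lt1 in auto)
  have "(R.opar_weight 1 has_sum (2 * 1 * complex_of_real (norm q) ^ Suc m / (1 - 1 * complex_of_real (norm q) ^ Suc m) * R.opar_prod 1 m)) (opars_max (Suc m))"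
    by (rule R.opars_max_has_sum[OF _ R.opars_upto_has_sum]) auto
  then have "((\<lambda>xs. complex_of_real (norm q ^ opar_size xs)) has_sum
     complex_of_real (2 * norm q ^ Suc m / (1 - norm q ^ Suc m) * (\<Prod>k<m. (1 + norm q ^ Suc k) / (1 - norm q ^ Suc k)))) (opars_max (Suc m))"
    by (simp add: R.opar_weight_def[abs_def] R.opar_prod_def)
  then show ?thesis unfolding opar_norm_def by (simp only: has_sum_of_real_iff)
qed

text \<open>The products stay bounded, because their factors differ from 1 by a geometrically
  decaying amount; the remaining factor decays geometrically in \<open>m\<close>.\<close>

lemma norm_weight_summable:
  "opar_norm summable_on UNIV"
proof -
  define r where "r = norm q"
  have r: "0 < r" "r < 1" using q_lt1 by (auto simp: r_def)
  have rk: "r ^ Suc k \<le> r" for k using power_decreasing[of 1 "Suc k" r] r by simp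
  define c where "c = (\<lambda>k. (1 + r ^ Suc k) / (1 - r ^ Suc k))"
  define P where "P = (\<lambda>m. \<Prod>k<m. c k)"
  \<comment> \<open>From \<open>c k \<le> 1 + 2 * r / (1 - r) * r ^ k\<close> and
    \<open>1 + s \<le> exp s\<close>, with the geometric series \<open>1 / (1 - r)\<close> in the
    exponent.\<close>
  define B where "B = exp (2 * r / (1 - r) / (1 - r))"
  have prod: "0 \<le> P m \<and> P m \<le> B" for m
  proof
    have le: "c k \<le> 1 + 2 * r / (1 - r) * r ^ k" and nn: "0 \<le> c k" for k
    proof -
      have p: "1 - r ^ Suc k > 0" using rk[of k] r by linarith
      have "c k = 1 + 2 * r ^ Suc k / (1 - r ^ Suc k)"
        using p by (simp add: c_def field_simps)
      also have "2 * r ^ Suc k / (1 - r ^ Suc k) \<le> 2 * r ^ Suc k / (1 - r)"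
        using r rk[of k] by (intro divide_left_mono mult_pos_pos p) auto
      finally show "c k \<le> 1 + 2 * r / (1 - r) * r ^ k" by (simp add: field_simps)
      show "0 \<le> c k" unfolding c_def using p r by (intro divide_nonneg_pos) auto
    qed
    show "0 \<le> P m" unfolding P_def using nn by (intro prod_nonneg) auto
    have "P m \<le> (\<Prod>k<m. 1 + 2 * r / (1 - r) * r ^ k)"
      unfolding P_def using le nn by (intro prod_mono) auto
    also have "\<dots> \<le> exp (\<Sum>k<m. 2 * r / (1 - r) * r ^ k)"
      using r by (intro prod_le_exp_sum) auto
    also have "\<dots> \<le> B"
    proof -
      have "(\<Sum>k<m. r ^ k) \<le> (\<Sum>k. r ^ k)" using r by (intro sum_le_suminf summable_geometric) auto
      also have "\<dots> = 1 / (1 - r)" using r by (intro suminf_geometric) auto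
      finally have "2 * r / (1 - r) * (\<Sum>k<m. r ^ k) \<le> 2 * r / (1 - r) * (1 / (1 - r))"
        using r by (intro mult_left_mono) auto
      then show ?thesis unfolding B_def by (simp add: sum_distrib_left)
    qed
    finally show "P m \<le> B" .
  qed
  have "(\<lambda>m. 2 * r ^ Suc m / (1 - r ^ Suc m) * P m) summable_on UNIV"
  proof (rule summable_on_comparison_test)
    show "(\<lambda>m. 2 * r / (1 - r) * B * r ^ m) summable_on UNIV"
      using r by (intro summable_on_cmult_right summable_nonneg_imp_summable_on summable_geometric) auto
    fix m
    have p: "1 - r ^ Suc m > 0" using rk[of m] r by linarith
    have "2 * r ^ Suc m / (1 - r ^ Suc m) \<le> 2 * r ^ Suc m / (1 - r)"
      using r rk[of m] by (intro divide_left_mono mult_pos_pos p) auto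
    then have "2 * r ^ Suc m / (1 - r ^ Suc m) * P m \<le> 2 * r ^ Suc m / (1 - r) * B"
      using prod[of m] r by (intro mult_mono) auto
    then show "2 * r ^ Suc m / (1 - r ^ Suc m) * P m \<le> 2 * r / (1 - r) * B * r ^ m"
      by (simp add: mult_ac)
    show "0 \<le> 2 * r ^ Suc m / (1 - r ^ Suc m) * P m"
      using prod[of m] p r by (intro mult_nonneg_nonneg divide_nonneg_pos) auto
  qed
  then show ?thesis unfolding P_def c_def r_def opar_norm_def[abs_def] .
qed

subsection \<open>The rank generating function\<close>

text \<open>The term for largest part \<open>m + 1\<close> has the denominators
  \<open>1 - q ^ Suc k / w\<close> with \<open>k \<le> m\<close>. Multiplication by
  \<open>qpoch_inf (q / w) q\<close> replaces them by the rest of that product, which starts at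
  \<open>q ^ (m + 2) / w\<close>.\<close>

definition rank_coeff :: "complex \<Rightarrow> nat \<Rightarrow> complex" where
  "rank_coeff w m = (\<Prod>k<m. 1 + q ^ Suc k / w) * qpoch_inf (q ^ (m + 2) / w) q"

text \<open>The rank generating function with its poles at $w = q^n$, $n \ge 1$, cleared by the
  factor $(q/w;q)_\infty$.\<close>

definition rank_num :: "complex \<Rightarrow> complex" where
  "rank_num w = (\<Sum>\<^sub>\<infinity>m. (w * q) ^ m * rank_coeff w m)"

text \<open>The series over overpartitions is summed only for \<open>|w| = 1\<close>; this formula
  continues it meromorphically to \<open>0 < |w| < 1/|q|\<close>, where the q-difference equation
  can be used.\<close>

definition rank_gf :: "complex \<Rightarrow> complex" where
  "rank_gf w = 1 + 2 * q * rank_num w / qpoch_inf (q / w) q"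

lemma qpoch_split: "qpoch_inf x q = (\<Prod>k<m. 1 - x * q ^ k) * qpoch_inf (x * q ^ m) q"
proof (induction m)
  case (Suc m)
  then show ?case using qpoch_step[of "x * q ^ m"] by (simp add: mult_ac)
qed simp

text \<open>Absolute summability over all overpartitions allows two groupings of one sum: by largest
  part, which gives the product formula, and by size, which gives the power series in
  \<open>q\<close>.\<close>

lemma rank_series_sums:
  assumes w: "norm w = 1"
  shows "(\<lambda>n. (\<Sum>xs\<in>overpartitions n. w powi overpartition_rank xs) * q ^ n) sums rank_gf w"
proof -
  have wnz: "w \<noteq> 0" using w by auto
  define y where "y = 1 / w"
  have y: "norm y \<le> 1" using w by (simp add: y_def norm_divide)
  define f where "f = (\<lambda>xs. w powi overpartition_rank xs * q ^ opar_size xs)"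
  define g where "g = (\<lambda>m. w ^ Suc m * (2 * y * q ^ Suc m / (1 - y * q ^ Suc m) * opar_prod y m))"
  have nf: "norm (f xs) = norm q ^ opar_size xs" for xs
    by (simp add: f_def norm_mult norm_power norm_power_int w)
  have 1: "(f has_sum g m) (opars_max (Suc m))" for m
  proof -
    have "((\<lambda>xs. w ^ Suc m * opar_weight y xs) has_sum g m) (opars_max (Suc m))"
      unfolding g_def by (intro has_sum_cmult_right opars_max_has_sum[OF y opars_upto_has_sum[OF y]])
    moreover have "w ^ Suc m * opar_weight y xs = f xs" if "xs \<in> opars_max (Suc m)" for xs
      using overpartition_rank_max[OF that] wnz
      by (simp add: f_def opar_weight_def y_def power_int_diff power_int_add power_inverse divide_inverse)
    ultimately show ?thesis by (subst (asm) has_sum_cong) auto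
  qed
  have "((\<lambda>(m, xs). f xs) has_sum (\<Sum>\<^sub>\<infinity>m. g m)) (SIGMA m:UNIV. opars_max (Suc m))"
    by (rule has_sum_Sigma_complex[where n = opar_norm])
      (use 1 norm_weight_has_sum norm_weight_summable in \<open>auto simp: nf\<close>)
  then have "((\<lambda>p. f (snd p)) has_sum (\<Sum>\<^sub>\<infinity>m. g m)) (SIGMA m:UNIV. opars_max (Suc m))"
    by (simp add: case_prod_unfold)
  then have "(f has_sum (\<Sum>\<^sub>\<infinity>m. g m)) ({xs. opar xs} - {[]})"
    by (subst (asm) has_sum_reindex_bij_betw[OF opar_Sigma])
  moreover have "(f has_sum 1) {[]}"
    by (rule has_sum_finiteI) (auto simp: f_def overpartition_rank_def)
  ultimately have "(f has_sum (1 + (\<Sum>\<^sub>\<infinity>m. g m))) ({[]} \<union> ({xs. opar xs} - {[]}))"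
    by (intro has_sum_Un_disjoint) auto
  also have "{[]} \<union> ({xs. opar xs} - {[]}) = {xs. opar xs}" by auto
  also have "(\<Sum>\<^sub>\<infinity>m. g m) = 2 * q * rank_num w / qpoch_inf (q / w) q"
  proof -
    have nz: "qpoch_inf (q / w) q \<noteq> 0"
    proof -
      have "y * q ^ Suc k \<noteq> 1" for k using norm_yq[OF y, of k] by (metis norm_one order_less_irrefl)
      then show ?thesis by (auto simp: qpoch_eq_0_iff y_def mult_ac)
    qed
    have "g m = 2 * q / qpoch_inf (q / w) q * ((w * q) ^ m * rank_coeff w m)" for m
    proof -
      define P where "P = (\<Prod>k<m. 1 + q ^ Suc k / w)"
      define R where "R = (\<Prod>k<m. 1 - q ^ Suc k / w)"
      define c where "c = qpoch_inf (q ^ (m + 2) / w) q"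
      have op: "opar_prod y m = P / R"
        by (simp add: opar_prod_def P_def R_def y_def prod_dividef)
      have "qpoch_inf (q / w) q = (\<Prod>k<Suc m. 1 - q / w * q ^ k) * qpoch_inf (q / w * q ^ Suc m) q"
        by (rule qpoch_split)
      also have "\<dots> = R * (1 - y * q ^ Suc m) * c"
        by (simp add: R_def c_def y_def mult_ac)
      finally have qp: "qpoch_inf (q / w) q = R * (1 - y * q ^ Suc m) * c" .
      then have nz': "R \<noteq> 0" "1 - y * q ^ Suc m \<noteq> 0" "c \<noteq> 0" using nz by auto
      have "w ^ Suc m * (2 * y * q ^ Suc m / D * (P / R)) = 2 * q / (R * D * c) * ((w * q) ^ m * (P * c))"
        if "D \<noteq> 0" for D
        using that nz' wnz by (simp add: y_def field_simps power_mult_distrib)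
      from this[OF nz'(2)] show ?thesis
        unfolding g_def op qp rank_coeff_def c_def[symmetric] P_def[symmetric] .
    qed
    then have "(\<Sum>\<^sub>\<infinity>m. g m) = 2 * q / qpoch_inf (q / w) q * rank_num w"
      unfolding rank_num_def by (simp only: infsum_cmult_right')
    then show ?thesis by simp
  qed
  finally have tot: "(f has_sum rank_gf w) {xs. opar xs}" unfolding rank_gf_def .
  have bij: "bij_betw snd (SIGMA n:UNIV. overpartitions n) {xs. opar xs}"
    by (auto simp: bij_betw_def inj_on_def overpartitions_eq image_iff)
  have "((\<lambda>p. f (snd p)) has_sum rank_gf w) (SIGMA n:UNIV. overpartitions n)"
    using tot by (subst has_sum_reindex_bij_betw[OF bij])
  then have "((\<lambda>n. \<Sum>xs\<in>overpartitions n. f xs) has_sum rank_gf w) UNIV"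
    by (rule has_sum_SigmaD) (use finite_overpartitions in \<open>auto intro: has_sum_finiteI\<close>)
  then have "(\<lambda>n. \<Sum>xs\<in>overpartitions n. f xs) sums rank_gf w"
    by (rule has_sum_imp_sums)
  moreover have "(\<Sum>xs\<in>overpartitions n. f xs) = (\<Sum>xs\<in>overpartitions n. w powi overpartition_rank xs) * q ^ n" for n
    unfolding sum_distrib_right by (rule sum.cong) (auto simp: f_def overpartitions_eq)
  ultimately show ?thesis by simp
qed

text \<open>The bound is uniform in \<open>m\<close>, so convergence of \<open>rank_num\<close> is
  governed by the powers of \<open>w * q\<close> alone and holds up to
  \<open>|w| < 1/|q|\<close>.\<close>

lemma rank_coeff_bounded:
  assumes Y: "Y \<ge> 0"
  obtains B where "B > 0" "\<And>w m. norm (1 / w) \<le> Y \<Longrightarrow> norm (rank_coeff w m) \<le> B"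
proof -
  have cont: "continuous_on (cball 0 Y) (\<lambda>x. qpoch_inf x q)"
    using holomorphic_on_imp_continuous_on[OF holomorphic_qpoch] continuous_on_subset by blast
  obtain B1 where "\<And>x. x \<in> cball 0 Y \<Longrightarrow> norm (qpoch_inf x q) \<le> B1"
    using bounded_on_cball[OF cont] by blast
  then have B1: "norm (qpoch_inf x q) \<le> B1" if "norm x \<le> Y" for x
    using that by (simp add: dist_norm)
  define B2 where "B2 = exp (Y / (1 - norm q))"
  have pr: "norm (\<Prod>k<m. 1 + q ^ Suc k / w) \<le> B2" if w: "norm (1 / w) \<le> Y" for w m
  proof -
    have "norm (\<Prod>k<m. 1 + q ^ Suc k / w) = (\<Prod>k<m. norm (1 + q ^ Suc k / w))" by (rule prod_norm[symmetric])
    also have "\<dots> \<le> (\<Prod>k<m. 1 + Y * norm q ^ k)"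
    proof (intro prod_mono conjI)
      fix k
      have "norm (q ^ Suc k / w) = norm (1 / w) * norm q ^ Suc k" by (simp add: norm_divide norm_mult norm_power)
      also have "\<dots> \<le> Y * norm q ^ k"
        using w q_lt1 Y by (intro mult_mono power_decreasing) auto
      finally show "norm (1 + q ^ Suc k / w) \<le> 1 + Y * norm q ^ k"
        using norm_triangle_ineq[of 1 "q ^ Suc k / w"] by simp
    qed auto
    also have "\<dots> \<le> exp (\<Sum>k<m. Y * norm q ^ k)"
      using Y by (intro prod_le_exp_sum) auto
    also have "\<dots> \<le> B2"
    proof -
      have "(\<Sum>k<m. norm q ^ k) \<le> (\<Sum>k. norm q ^ k)"
        using q_lt1 by (intro sum_le_suminf summable_geometric) auto
      also have "\<dots> = 1 / (1 - norm q)" using q_lt1 by (intro suminf_geometric) auto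
      finally have "Y * (\<Sum>k<m. norm q ^ k) \<le> Y * (1 / (1 - norm q))"
        using Y by (intro mult_left_mono) auto
      then show ?thesis unfolding B2_def by (simp add: sum_distrib_left)
    qed
    finally show ?thesis .
  qed
  have qx: "norm (q ^ (m + 2) / w) \<le> Y" if w: "norm (1 / w) \<le> Y" for w m
  proof -
    have "norm (q ^ (m + 2) / w) = norm q ^ (m + 2) * norm (1 / w)"
      by (simp add: norm_divide norm_power norm_mult)
    also have "\<dots> \<le> 1 * Y"
      using w q_lt1 Y by (intro mult_mono power_le_one) auto
    finally show ?thesis by simp
  qed
  have B1': "0 \<le> B1" using order_trans[OF norm_ge_zero B1[of 0]] Y by simp
  show thesis
  proof (rule that[of "B2 * B1 + 1"])
    show "B2 * B1 + 1 > 0" using B1' by (simp add: B2_def add_nonneg_pos)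
    fix w :: complex and m :: nat assume w: "norm (1 / w) \<le> Y"
    have "norm (rank_coeff w m) \<le> B2 * B1"
      unfolding rank_coeff_def norm_mult
      by (intro mult_mono pr B1 qx w) (auto simp: B2_def)
    then show "norm (rank_coeff w m) \<le> B2 * B1 + 1" by simp
  qed
qed

lemma rank_series_summable:
  assumes z: "norm z < 1"
  shows "(\<lambda>m. z ^ m * rank_coeff w m) summable_on UNIV"
proof -
  obtain B where B: "B > 0" "\<And>m. norm (rank_coeff w m) \<le> B"
    using rank_coeff_bounded[of "norm (1 / w)"] by (metis norm_ge_zero order_refl)
  have "(\<lambda>m. norm z ^ m * B) summable_on UNIV"
    using z by (intro summable_on_cmult_left summable_nonneg_imp_summable_on summable_geometric) auto
  then show ?thesis
    by (rule abs_summable_summable[OF summable_on_comparison_test])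
      (auto simp: norm_mult norm_power intro!: mult_left_mono B)
qed

lemma holomorphic_rank_num: "rank_num holomorphic_on {w. 0 < norm w \<and> norm w < 1 / norm q}"
  (is "_ holomorphic_on ?D")
proof -
  have D: "?D = ball 0 (1 / norm q) - {0}" by auto
  have opn: "open ?D" unfolding D by auto
  have "(\<lambda>w. \<Sum>\<^sub>\<infinity>m. (w * q) ^ m * rank_coeff w m) holomorphic_on ?D"
  proof (rule holomorphic_on_infsum[OF opn])
    show "(\<lambda>w. (w * q) ^ m * rank_coeff w m) holomorphic_on ?D" for m
    proof -
      have "(\<lambda>w. qpoch_inf (q ^ (m + 2) / w) q) holomorphic_on ?D"
        by (rule holomorphic_on_compose_gen[OF _ holomorphic_qpoch, of "\<lambda>w. q ^ (m + 2) / w", unfolded o_def])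
          (auto intro!: holomorphic_intros)
      then show ?thesis unfolding rank_coeff_def by (intro holomorphic_intros) auto
    qed
  next
    fix w assume w: "w \<in> ?D"
    then obtain d where d: "d > 0" "cball w d \<subseteq> ?D" using opn open_contains_cball by blast
    have c: "continuous_on (cball w d) (\<lambda>v. 1 / v)" "continuous_on (cball w d) (\<lambda>v. norm (v * q))"
      using d by (auto intro!: continuous_intros)
    obtain Y where Y: "\<And>v. v \<in> cball w d \<Longrightarrow> norm (1 / v) \<le> Y"
      using bounded_on_cball[OF c(1)] by blast
    have "Y \<ge> 0" using order_trans[OF norm_ge_zero Y[of w]] d(1) by simp
    then obtain B where B: "B > 0" "\<And>w m. norm (1 / w) \<le> Y \<Longrightarrow> norm (rank_coeff w m) \<le> B"
      using rank_coeff_bounded by blast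
    obtain v0 where v0: "v0 \<in> cball w d" "\<And>v. v \<in> cball w d \<Longrightarrow> norm (v * q) \<le> norm (v0 * q)"
      using continuous_attains_sup[OF compact_cball _ c(2)] d(1) by (metis cball_eq_empty not_less order_less_imp_le less_asym)
    define Z where "Z = norm (v0 * q)"
    have Z: "0 \<le> Z" "Z < 1"
    proof -
      have "norm v0 < 1 / norm q" using v0(1) d(2) by auto
      then show "Z < 1" by (simp add: Z_def norm_mult field_simps)
    qed (simp add: Z_def)
    have "(\<lambda>m. Z ^ m * B) summable_on UNIV"
      using Z by (intro summable_on_cmult_left summable_nonneg_imp_summable_on summable_geometric) auto
    moreover have "norm ((v * q) ^ m * rank_coeff v m) \<le> Z ^ m * B" if "v \<in> cball w d" for v m
      using v0(2)[OF that] Y that unfolding norm_mult[of "(v * q) ^ m"] norm_power Z_def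
      by (intro mult_mono power_mono B) auto
    ultimately show "\<exists>r>0. \<exists>M E. cball w r \<subseteq> ?D \<and> finite E \<and> M summable_on UNIV \<and>
        (\<forall>m\<in>UNIV - E. \<forall>v\<in>cball w r. norm ((v * q) ^ m * rank_coeff v m) \<le> M m)"
      using d by (intro exI[of _ d] conjI exI[of _ "\<lambda>m. Z ^ m * B"] exI[of _ "{}"]) auto
  qed
  then show ?thesis by (simp add: rank_num_def[abs_def])
qed

section \<open>The q-difference equation of the rank generating function\<close>

lemma rank_coeff_step:
  assumes "w \<noteq> 0"
  shows "rank_coeff w (Suc m) - rank_coeff w m = q ^ Suc m / w * (q * rank_coeff w (Suc m) + rank_coeff w m)"
proof -
  \<comment> \<open>Both neighbouring coefficients are multiples of \<open>P * c\<close>, by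
    \<open>1 - q * u\<close> and by \<open>1 + u\<close>. The factor \<open>u\<close> carries
    \<open>q ^ Suc m\<close>, which in the generating function becomes the substitution of
    \<open>z * q\<close> for \<open>z\<close>.\<close>
  define P c u where "P = (\<Prod>k<m. 1 + q ^ Suc k / w)"
    and "c = qpoch_inf (q ^ (Suc m + 2) / w) q" and "u = q ^ Suc m / w"
  have "qpoch_inf (q ^ (m + 2) / w) q = (1 - q * u) * c"
    using qpoch_step[of "q ^ (m + 2) / w"] by (simp add: c_def u_def mult_ac)
  then have "rank_coeff w m = P * ((1 - q * u) * c)" by (simp add: rank_coeff_def P_def)
  moreover have "rank_coeff w (Suc m) = P * (1 + u) * c"
    unfolding rank_coeff_def prod.lessThan_Suc P_def c_def u_def ..
  ultimately show ?thesis
    unfolding u_def[symmetric] by (simp only:) (simp add: algebra_simps)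
qed

text \<open>Two relations share the unknown \<open>s (z * q)\<close>: \<open>AB\<close> comes from
  the recursion in \<open>m\<close>, and \<open>N\<close> from comparing the coefficients at
  \<open>w * q\<close> with those at \<open>w\<close>. Eliminating it leaves a relation between
  \<open>rank_num (w * q)\<close> and \<open>rank_num w\<close>.\<close>

lemma rank_num_functional_equation:
  assumes w: "w \<noteq> 0" "norm (w * q) < 1"
  shows "(1 + w * q) * rank_num (w * q) =
     (1 - w ^ 2 * q) * qpoch_inf (q / w) q + w * q * (1 + w) * (1 - w * q) * rank_num w"
proof -
  \<comment> \<open>The power variable is decoupled from the \<open>w\<close> in the coefficients,
    so that it can be moved to \<open>z * q\<close> while \<open>w\<close> stays fixed.\<close>
  define s where "s = (\<lambda>z. \<Sum>\<^sub>\<infinity>m. z ^ m * rank_coeff w m)"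
  define Q where "Q = qpoch_inf (q / w) q"
  have hs: "((\<lambda>m. z ^ m * rank_coeff w m) has_sum s z) UNIV" if "norm z < 1" for z
    unfolding s_def by (rule has_sum_infsum[OF rank_series_summable[OF that]])
  have sums: "(\<lambda>m. z ^ m * rank_coeff w m) sums s z" if "norm z < 1" for z
    by (rule has_sum_imp_sums[OF hs[OF that]])
  have sums': "(\<lambda>m. z ^ Suc m * rank_coeff w (Suc m)) sums (s z - rank_coeff w 0)" if "norm z < 1" for z
    using sums_Suc_iff[of "\<lambda>m. z ^ m * rank_coeff w m" "s z - rank_coeff w 0"] sums[OF that] by simp
  have Q0: "Q = (1 - q / w) * rank_coeff w 0"
    using qpoch_step[of "q / w"] by (simp add: Q_def rank_coeff_def power2_eq_square)
  define z where "z = w * q"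
  have z: "norm z < 1" "norm (z * q) < 1"
  proof -
    show "norm z < 1" using w by (simp add: z_def)
    then show "norm (z * q) < 1" using q_lt1 mult_strict_mono[of "norm z" 1 "norm q" 1] by (simp add: norm_mult)
  qed
  have A: "(\<lambda>m. z ^ Suc m * (rank_coeff w (Suc m) - rank_coeff w m)) sums (s z - rank_coeff w 0 - z * s z)"
    using sums_diff[OF sums'[OF z(1)] sums_mult[OF sums[OF z(1)], of z]] by (simp add: algebra_simps)
  have B: "(\<lambda>m. 1 / w * (q * ((z * q) ^ Suc m * rank_coeff w (Suc m)) + z * q * ((z * q) ^ m * rank_coeff w m)))
     sums (1 / w * (q * (s (z * q) - rank_coeff w 0) + z * q * s (z * q)))"
    by (intro sums_mult sums_add sums'[OF z(2)] sums[OF z(2)])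
  have "z ^ Suc m * (rank_coeff w (Suc m) - rank_coeff w m) =
     1 / w * (q * ((z * q) ^ Suc m * rank_coeff w (Suc m)) + z * q * ((z * q) ^ m * rank_coeff w m))" for m
    unfolding rank_coeff_step[OF w(1)] by (simp add: power_mult_distrib algebra_simps)
  with A B have "s z - rank_coeff w 0 - z * s z = 1 / w * (q * (s (z * q) - rank_coeff w 0) + z * q * s (z * q))"
    using sums_unique2 by auto
  then have AB: "(1 - z) * s z = Q + q / w * (1 + z) * s (z * q)"
    unfolding Q0 by (simp add: algebra_simps add_divide_distrib)
  have c0: "rank_coeff (w * q) 0 = Q"
    using w by (simp add: rank_coeff_def Q_def power2_eq_square)
  have cS: "rank_coeff (w * q) (Suc m) = (1 + 1 / w) * rank_coeff w m" for m
  proof -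
    have "(\<Prod>k<Suc m. 1 + q ^ Suc k / (w * q)) = (1 + 1 / w) * (\<Prod>k<m. 1 + q ^ Suc k / w)"
      by (subst prod.lessThan_Suc_shift) simp
    then show ?thesis by (simp add: rank_coeff_def)
  qed
  have "norm (w * q * q) < 1" using z(2) by (simp add: z_def)
  then have "((\<lambda>m. (w * q * q) ^ m * rank_coeff (w * q) m) has_sum rank_num (w * q)) UNIV"
    unfolding rank_num_def by (intro has_sum_infsum rank_series_summable)
  then have "(\<lambda>m. (z * q) ^ m * rank_coeff (w * q) m) sums rank_num (w * q)"
    unfolding z_def by (rule has_sum_imp_sums)
  then have "(\<lambda>m. (z * q) ^ Suc m * rank_coeff (w * q) (Suc m)) sums (rank_num (w * q) - Q)"
    using sums_Suc_iff[of "\<lambda>m. (z * q) ^ m * rank_coeff (w * q) m" "rank_num (w * q) - Q"] c0 by simp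
  moreover have "(\<lambda>m. (z * q) * (1 + 1 / w) * ((z * q) ^ m * rank_coeff w m)) sums ((z * q) * (1 + 1 / w) * s (z * q))"
    by (intro sums_mult sums[OF z(2)])
  moreover have "(z * q) ^ Suc m * rank_coeff (w * q) (Suc m) = (z * q) * (1 + 1 / w) * ((z * q) ^ m * rank_coeff w m)" for m
    unfolding cS by (simp add: algebra_simps)
  ultimately have N: "rank_num (w * q) = Q + (z * q) * (1 + 1 / w) * s (z * q)"
    using sums_unique2 by (metis (no_types, lifting) add.commute diff_add_cancel sums_cong)
  have sN: "rank_num w = s z" by (simp add: rank_num_def s_def z_def)
  have "(1 + w * q) * rank_num (w * q) = (1 + z) * Q + w * q * (1 + w) * (q / w * (1 + z) * s (z * q))"
    unfolding N z_def using w(1) by (simp add: field_simps)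
  also have "q / w * (1 + z) * s (z * q) = (1 - z) * s z - Q" using AB by simp
  finally show ?thesis unfolding sN Q_def[symmetric] z_def by (simp add: algebra_simps power2_eq_square)
qed

text \<open>The factor \<open>(1 + w) / (1 - w)\<close> is the normalisation in which the equation
  takes the form \<open>H (w * q) = 1 - w^2 q - w^2 q H w\<close>, shared by
  \<open>1 - 2m - 2Delta\<close>.\<close>

lemma rank_gf_functional_equation:
  assumes w: "w \<noteq> 0" "norm (w * q) < 1" "\<And>k::int. w \<noteq> q powi k"
  shows "(1 + w * q) / (1 - w * q) * rank_gf (w * q) =
     1 - w ^ 2 * q - w ^ 2 * q * ((1 + w) / (1 - w) * rank_gf w)"
proof -
  define Q where "Q = qpoch_inf (q / w) q"
  have Q: "Q \<noteq> 0"
  proof -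
    have "q / w * q ^ n \<noteq> 1" for n
      using w(3)[of "int (Suc n)"] w(1) unfolding power_int_of_nat by (auto simp: field_simps)
    then show ?thesis unfolding Q_def qpoch_eq_0_iff by blast
  qed
  have w1: "w \<noteq> 1" using w(3)[of 0] by simp
  have wq: "1 - w * q \<noteq> 0" using w(2) by (metis norm_one order_less_irrefl right_minus_eq)
  have Q': "qpoch_inf (q / (w * q)) q = (1 - 1 / w) * Q"
    using qpoch_step[of "1 / w"] by (simp add: Q_def)
  have "(1 + w * q) * rank_gf (w * q) = (1 + w * q) + 2 * q * ((1 + w * q) * rank_num (w * q)) / ((1 - 1 / w) * Q)"
    unfolding rank_gf_def Q' by (simp add: algebra_simps)
  also have "\<dots> = (1 + w * q) + 2 * q * ((1 - w ^ 2 * q) * Q + w * q * (1 + w) * (1 - w * q) * rank_num w) / ((1 - 1 / w) * Q)"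
    unfolding rank_num_functional_equation[OF w(1,2)] Q_def ..
  also have "\<dots> = (1 + w * q) + 2 * q * w * (1 - w ^ 2 * q) / (w - 1)
       + w ^ 2 * q * (1 + w) * (1 - w * q) / (w - 1) * (2 * q * rank_num w / Q)"
  proof -
    define v where "v = w - 1"
    have v: "v \<noteq> 0" "1 - 1 / w = v / w" using w1 w(1) by (auto simp: v_def field_simps)
    have "2 * q * (A * Q + B * N) / (v / w * Q) = 2 * q * w * A / v + w * B / v * (2 * q * N / Q)" for A B N
      using Q v(1) w(1) by (simp add: field_simps)
    note gen = this
    show ?thesis unfolding v(2) gen unfolding v_def by (simp add: power2_eq_square mult_ac)
  qed
  also have "2 * q * rank_num w / Q = rank_gf w - 1" by (simp add: rank_gf_def Q_def)
  finally have *: "(1 + w * q) * rank_gf (w * q) = (1 + w * q) + 2 * q * w * (1 - w ^ 2 * q) / (w - 1)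
       + w ^ 2 * q * (1 + w) * (1 - w * q) / (w - 1) * (rank_gf w - 1)" .
  have "(1 + w * q) * rank_gf (w * q) =
     (1 - w * q) * (1 - w ^ 2 * q - w ^ 2 * q * ((1 + w) / (1 - w) * rank_gf w))"
    unfolding * using w1 by (simp add: divide_simps) (simp add: algebra_simps power2_eq_square power3_eq_cube)
  then show ?thesis using wq by (simp add: field_simps)
qed

section \<open>The rank generating function as an Appell-Lerch series\<close>

lemma norm_powi_eq_1_iff: "norm (q powi k) = 1 \<longleftrightarrow> k = 0"
proof -
  have "norm q powi n < norm q powi m" if "m < n" for m n :: int
    using that q_lt1 by (intro power_int_strict_decreasing) auto
  from this[of 0 k] this[of k 0] show ?thesis
    by (cases k "0 :: int" rule: linorder_cases) (auto simp: norm_power_int)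
qed

lemma powi_square: "(q ^ 2) powi k = q powi (2 * k)"
  by (simp add: power_int_mult)

abbreviation appell_mu :: "complex \<Rightarrow> complex" where
  "appell_mu x \<equiv> appell_m x (q ^ 2) (- 1)"

text \<open>Inversion and the shift by \<open>q ^ 2\<close> both relate the values at
  \<open>1 / q\<close> and \<open>q\<close>; together they give \<open>m = 1 - m\<close>. This value
  makes the formula for the rank generating function hold at \<open>w = -1\<close>.\<close>

lemma appell_m_half: "appell_mu q = 1 / 2"
proof -
  interpret Q: nome "q ^ 2" by (rule nome_square)
  have "(- 1 :: complex) * q \<noteq> (q ^ 2) powi k" for k
  proof
    assume "- 1 * q = (q ^ 2) powi k"
    then have "q powi (2 * k - 1) = - 1" unfolding powi_square by (simp add: power_int_diff field_simps)
    then show False using powi_q_neq_minus_1 by blast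
  qed
  moreover have "1 / q * (- 1) \<noteq> (q ^ 2) powi k" for k :: int
  proof
    assume "1 / q * (- 1) = (q ^ 2) powi k"
    then have "q powi (2 * k + 1) = - 1" unfolding powi_square by (simp add: power_int_add field_simps)
    then show False using powi_q_neq_minus_1 by blast
  qed
  moreover have "(- 1 :: complex) \<noteq> (q ^ 2) powi k" for k :: int
    using Q.powi_q_neq_minus_1[of k] by metis
  ultimately have "appell_m_defined q (q ^ 2) (- 1)" "appell_m_defined (1 / q) (q ^ 2) (- 1)"
    by (auto simp: appell_m_defined_def)
  then have 1: "appell_mu (1 / q) = q * appell_mu q"
    and 2: "appell_mu q = 1 - 1 / q * appell_mu (1 / q)"
    using Q.appell_m_inverse[of q "- 1"] Q.appell_m_q_shift[of "1 / q" "- 1"]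
    by (auto simp: power2_eq_square)
  have "appell_mu q = 1 - appell_mu q"
    using 2 unfolding 1 by simp
  then show ?thesis by (simp add: field_simps)
qed

theorem rank_gf_appell:
  assumes w: "norm w = 1" "w \<noteq> 1"
  shows "(1 + w) * rank_gf w = (1 - w) * (1 - 2 * appell_mu (q / w ^ 2) - 2 * Delta (q / w ^ 2) w (- 1) (q ^ 2))"
proof -
  interpret Q: nome "q ^ 2" by (rule nome_square)
  let ?Q = "q ^ 2"
  let ?J = "qpoch_inf ?Q ?Q"
  \<comment> \<open>The radius up to which \<open>rank_num\<close> is known to be holomorphic;
    \<open>norm w < \<rho>\<close> is also the condition of the functional equation.\<close>
  define \<rho> where "\<rho> = 1 / norm q"
  have \<rho>: "\<rho> > 1" using q_lt1 by (simp add: \<rho>_def)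
  define D where "D = {w :: complex. 0 < norm w \<and> norm w < \<rho>}"
  have D': "D = ball 0 \<rho> - {0}" by (auto simp: D_def)
  have opn: "open D" unfolding D' by auto
  have Dnz: "w \<noteq> 0" if "w \<in> D" for w using that by (auto simp: D_def)
  define m where "m = (\<lambda>w. appell_mu (q / w ^ 2))"
  define d where "d = (\<lambda>w. Delta (q / w ^ 2) w (- 1) ?Q)"
  define H where "H = (\<lambda>w. (1 + w) / (1 - w) * rank_gf w)"
  define f where "f = (\<lambda>w. H w - 1 + 2 * m w + 2 * d w)"
  \<comment> \<open>Under \<open>w\<close> to \<open>q * w\<close> the function \<open>f\<close>
    acquires the multiplier \<open>- q * w^2\<close>, and the theta factors and \<open>1 / w\<close>
    together contribute its inverse.\<close>
  define F where "F = (\<lambda>w. f w * (jtheta w q * jtheta (- w) q / w))"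
  \<comment> \<open>Its zeros cover the singularities of \<open>f\<close>: the powers of
    \<open>q\<close>, and the points where \<open>- (q / w ^ 2)\<close> is a power of
    \<open>q ^ 2\<close>.\<close>
  define h where "h = (\<lambda>w. jtheta w q * jtheta (- (q / w ^ 2)) ?Q)"

  let ?k = "\<lambda>w. jtheta (- (q / w ^ 2)) ?Q"
  let ?Dh = "{w\<in>D. h w \<noteq> 0}" and ?Dj = "{w\<in>D. jtheta w q \<noteq> 0}" and ?Dk = "{w\<in>D. ?k w \<noteq> 0}"
  have orbit: "jtheta w q = 0 \<longleftrightarrow> (\<exists>k::int. w = q powi k)" if "w \<noteq> 0" for w
    using jtheta_eq_0_iff[OF that] .
  have orbit2: "?k w = 0 \<longleftrightarrow> (\<exists>k::int. - (q / w ^ 2) = q powi (2 * k))" if "w \<noteq> 0" for w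
    using Q.jtheta_eq_0_iff[of "- (q / w ^ 2)"] that by (simp add: powi_square)
  have jQ_nz: "jtheta w ?Q \<noteq> 0" "jtheta (q / w) ?Q \<noteq> 0" if "w \<noteq> 0" "jtheta w q \<noteq> 0" for w
  proof -
    have no: "w \<noteq> q powi k" for k using that orbit by blast
    show "jtheta w ?Q \<noteq> 0" using that no by (auto simp: Q.jtheta_eq_0_iff powi_square)
    have "q / w \<noteq> q powi (2 * k)" for k
    proof
      assume "q / w = q powi (2 * k)"
      then have "w = q powi (1 - 2 * k)" using that by (simp add: power_int_diff field_simps)
      with no show False by blast
    qed
    then show "jtheta (q / w) ?Q \<noteq> 0" using that by (auto simp: Q.jtheta_eq_0_iff powi_square)
  qed
  have j1Q: "jtheta (- 1) ?Q \<noteq> 0" by (rule Q.jtheta_minus_1_nz)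
  have m1: "(- 1 :: complex) \<noteq> ?Q powi k" for k :: int
    using Q.powi_q_neq_minus_1[of k] by metis
  have m_ok: "appell_m_defined (q / w ^ 2) ?Q (- 1)" if "w \<noteq> 0" "?k w \<noteq> 0" for w
    using that m1 orbit2[of w] unfolding appell_m_defined_def powi_square by auto
  let ?d = "\<lambda>w. - (?J ^ 3 * (jtheta (- w) ?Q * jtheta (- (q / w)) ?Q) /
      (jtheta (- 1) ?Q * jtheta w ?Q * ?k w * jtheta (q / w) ?Q))"
  have d_eq: "d w = ?d w" if "w \<noteq> 0" for w
    unfolding d_def Delta_def using that by (simp add: power2_eq_square mult_ac)

  have Q_flip: "jtheta (q * w) ?Q = jtheta (q / w) ?Q" if "w \<noteq> 0" for w
    using Q.jtheta_flip[of "q * w"] that by (simp add: power2_eq_square)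
  have shift2: "?k (q * w) = ?k w / (q * w ^ 2)" if "w \<noteq> 0" for w
    using Q.jtheta_q_shift[of "- (q / (q * w) ^ 2)"] that by (simp add: field_simps power2_eq_square)

  have hol_H: "H holomorphic_on ?Dj"
  proof -
    have "(\<lambda>w. qpoch_inf (q / w) q) holomorphic_on ?Dj"
      by (rule holomorphic_on_compose_gen[OF _ holomorphic_qpoch, of "\<lambda>w. q / w", unfolded o_def])
        (auto intro!: holomorphic_intros dest: Dnz)
    moreover have "rank_num holomorphic_on ?Dj"
      by (rule holomorphic_on_subset[OF holomorphic_rank_num]) (auto simp: D_def \<rho>_def)
    moreover have "qpoch_inf (q / w) q \<noteq> 0" if "jtheta w q \<noteq> 0" for w
      using that by (auto simp: jtheta_def)
    moreover have "w \<noteq> 1" if "jtheta w q \<noteq> 0" for w using that by auto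
    ultimately show ?thesis unfolding H_def rank_gf_def by (intro holomorphic_intros) auto
  qed
  have opn_pos: "open {w\<in>D. k w \<noteq> 0}" if "k holomorphic_on D" for k :: "complex \<Rightarrow> complex"
  proof -
    have "{w\<in>D. k w \<noteq> 0} = D \<inter> k -` (- {0})" by auto
    also have "open \<dots>"
      by (rule continuous_open_preimage[OF holomorphic_on_imp_continuous_on[OF that] opn]) auto
    finally show ?thesis .
  qed
  have hol_j: "(\<lambda>w. jtheta w q) holomorphic_on D" "?k holomorphic_on D"
    using Dnz by (auto intro!: holomorphic_intros Q.jtheta_holomorphic_intros)
  have hol_h: "h holomorphic_on D" unfolding h_def by (intro holomorphic_intros hol_j)
  have hol_m: "m holomorphic_on ?Dk"
    unfolding m_def Q.appell_m_eq
  proof (intro holomorphic_intros Q.holomorphic_lerch_on opn_pos hol_j)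
    fix w r assume w: "w \<in> ?Dk"
    show "?Q powi (r - 1) * (q / w ^ 2 * - 1) \<noteq> 1"
      using m_ok[of w] w Dnz unfolding Q.powi_mult_eq_1_iff appell_m_defined_def by blast
  qed (use j1Q in \<open>auto dest: Dnz\<close>)
  have hol_d: "d holomorphic_on ?Dh"
  proof (rule holomorphic_transform)
    show "?d holomorphic_on ?Dh"
      by (intro holomorphic_intros Q.jtheta_holomorphic_intros) (use j1Q jQ_nz in \<open>auto simp: h_def dest: Dnz\<close>)
  qed (use d_eq Dnz in auto)
  have hol_f: "f holomorphic_on ?Dh"
    unfolding f_def
    by (intro holomorphic_intros hol_d holomorphic_on_subset[OF hol_H] holomorphic_on_subset[OF hol_m])
      (auto simp: h_def)
  have hol_F: "F holomorphic_on ?Dh"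
    unfolding F_def by (intro holomorphic_intros hol_f) (auto dest: Dnz)

  have h_shift: "h (q * w) = 0 \<longleftrightarrow> h w = 0" if "w \<in> D" for w
    using Dnz[OF that] unfolding h_def by (simp add: jtheta_q_shift shift2)
  have F_per: "F (q * w) = F w" if w: "w \<in> D" "h w \<noteq> 0" for w
  proof -
    have nz: "w \<noteq> 0" using Dnz w by blast
    have H': "H (q * w) = 1 - w ^ 2 * q - w ^ 2 * q * H w"
      unfolding H_def mult.commute[of q w]
    proof (rule rank_gf_functional_equation[OF nz])
      show "norm (w * q) < 1" using w by (simp add: D_def \<rho>_def norm_mult field_simps)
      show "w \<noteq> q powi k" for k using w orbit[OF nz] by (auto simp: h_def)
    qed
    have m': "m (q * w) = q * w ^ 2 * (1 - m w)"
    proof -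
      have "?k (q * w) \<noteq> 0" using w nz by (simp add: shift2 h_def)
      then have "appell_m_defined (q / (q * w) ^ 2) ?Q (- 1)" using nz by (intro m_ok) auto
      from Q.appell_m_q_shift[OF this] show ?thesis
        using nz unfolding m_def by (simp add: field_simps power2_eq_square)
    qed
    have d': "d (q * w) = - (q * w ^ 2) * d w"
    proof -
      have a: "jtheta (q / (q * w)) ?Q = - jtheta w ?Q / w" "jtheta (- (q / (q * w))) ?Q = jtheta (- w) ?Q / w"
        using Q.jtheta_inverse[of w] Q.jtheta_inverse[of "- w"] nz by simp_all
      have b: "jtheta (- (q * w)) ?Q = jtheta (- (q / w)) ?Q"
        using Q_flip[of "- w"] nz by simp
      show ?thesis
        using nz d_eq[of w] d_eq[of "q * w"] unfolding a b Q_flip[OF nz] shift2[OF nz] by (simp add: mult_ac)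
    qed
    have "f (q * w) = - (w ^ 2 * q) * f w"
      unfolding f_def H' m' d' by (simp add: algebra_simps)
    moreover have "jtheta (- (q * w)) q = jtheta (- w) q / w"
      using jtheta_q_shift[of "- w"] nz by simp
    ultimately show ?thesis
      unfolding F_def jtheta_q_shift[OF nz] using nz by (simp add: field_simps power2_eq_square)
  qed

  have isCont_D: "(k \<longlongrightarrow> k p) (at p)" if "k holomorphic_on S" "open S" "p \<in> S" for k :: "complex \<Rightarrow> complex" and S p
    using holomorphic_on_imp_continuous_on[OF that(1)] that(2,3)
    by (simp add: continuous_on_eq_continuous_at isCont_def)

  have one: "1 \<in> D" using \<rho> by (simp add: D_def)
  \<comment> \<open>The two families of singularities are disjoint: a common point would make an odd
    power of \<open>q\<close> equal to -1.\<close>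
  have not_both: "?k w \<noteq> 0" if "w = q powi k" for w and k :: int
  proof
    assume "?k w = 0"
    moreover have "w \<noteq> 0" using that by simp
    ultimately obtain l :: int where "- (q / w ^ 2) = q powi (2 * l)" using orbit2[of w] by auto
    then have "q powi (2 * l + 2 * k - 1) = - 1"
      unfolding that by (simp add: power_int_add power_int_diff power_int_mult field_simps)
    then show False using powi_q_neq_minus_1 by blast
  qed
  \<comment> \<open>At 1 both \<open>H\<close> and \<open>d\<close> have at most a simple pole, so
    \<open>(w - 1) * f w\<close> has a limit; the additional factor \<open>jtheta w q\<close>
    vanishes at 1 and brings the limit to 0.\<close>
  have pole1: "((\<lambda>w. (w - 1) * F w) \<longlongrightarrow> 0) (at 1)"
  proof -
    have q1: "qpoch_inf q q \<noteq> 0" by simp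
    have jq: "jtheta q ?Q \<noteq> 0" "jtheta (- q) ?Q \<noteq> 0"
    proof -
      have "q \<noteq> q powi (2 * k)" "- q \<noteq> q powi (2 * k)" for k :: int
      proof -
        show "q \<noteq> q powi (2 * k)" using powi_q_eq_iff[of 1 "2 * k"] by simp presburger
        show "- q \<noteq> q powi (2 * k)"
        proof
          assume "- q = q powi (2 * k)"
          then have "q powi (2 * k - 1) = - 1" by (simp add: power_int_diff field_simps)
          then show False using powi_q_neq_minus_1 by blast
        qed
      qed
      then show "jtheta q ?Q \<noteq> 0" "jtheta (- q) ?Q \<noteq> 0" by (auto simp: Q.jtheta_eq_0_iff powi_square)
    qed
    have cQ: "isCont (\<lambda>w. jtheta (k w) ?Q) 1" if "isCont k 1" "k 1 \<noteq> 0" for k :: "complex \<Rightarrow> complex"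
      using isCont_o2[OF that(1) Q.isCont_jtheta[OF that(2)]] .
    have "isCont rank_num 1"
      using isCont_D[OF holomorphic_on_subset[OF holomorphic_rank_num, of D] opn one]
      by (auto simp: isCont_def D_def \<rho>_def)
    moreover have "isCont (\<lambda>w. qpoch_inf (q / w) q) 1"
      by (rule isCont_o2[of _ "\<lambda>w. q / w" "\<lambda>x. qpoch_inf x q"])
        (use holomorphic_on_imp_continuous_on[OF holomorphic_qpoch] in
          \<open>auto intro!: continuous_intros simp: continuous_on_eq_continuous_at\<close>)
    ultimately have R: "isCont rank_gf 1"
      unfolding rank_gf_def using q1 by (intro continuous_intros) auto
    have M: "(m \<longlongrightarrow> m 1) (at 1)"
      by (rule isCont_D[OF hol_m opn_pos[OF hol_j(2)]]) (use one jq in auto)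
    \<comment> \<open>\<open>d\<close> without the factor \<open>1 / jtheta w (q^2)\<close>, the
      only one that blows up at 1.\<close>
    define e where "e = (\<lambda>w. - (?J ^ 3 * (jtheta (- w) ?Q * jtheta (- (q / w)) ?Q) /
      (jtheta (- 1) ?Q * ?k w * jtheta (q / w) ?Q)))"
    have E: "isCont e 1"
      unfolding e_def using j1Q jq by (intro continuous_intros cQ) auto
    have J: "((\<lambda>w. inverse (jtheta w ?Q / (1 - w))) \<longlongrightarrow> inverse (?J ^ 3)) (at 1)"
      by (intro tendsto_inverse Q.jtheta_tendsto_1) simp
    have T: "isCont (\<lambda>w. jtheta w q * jtheta (- w) q / w) 1"
      by (intro continuous_intros isCont_o2[OF _ isCont_jtheta]) auto
    let ?G = "\<lambda>w. - (1 + w) * rank_gf w + (w - 1) * (2 * m w - 1) - 2 * (e w * inverse (jtheta w ?Q / (1 - w)))" and ?T = "\<lambda>w. jtheta w q * jtheta (- w) q / w"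
    have "((\<lambda>w. ?G w * ?T w) \<longlongrightarrow>
        (- (1 + 1) * rank_gf 1 + (1 - 1) * (2 * m 1 - 1) - 2 * (e 1 * inverse (?J ^ 3)))
             * (jtheta 1 q * jtheta (- 1) q / 1)) (at 1)"
      by (intro tendsto_intros isContD[OF R] M isContD[OF E] J isContD[OF T])
    moreover have "\<forall>\<^sub>F w in at 1. ?G w * ?T w = (w - 1) * F w"
    proof -
      have "\<forall>\<^sub>F w in at 1. w \<noteq> 0 \<and> w \<noteq> (1 :: complex)"
        using eventually_neq_at_within[of 1] eventually_neq_at_within[of 0 1 UNIV] by eventually_elim auto
      then show ?thesis
      proof eventually_elim
        case (elim w)
        have "d w = e w * inverse (jtheta w ?Q)"
          using elim unfolding e_def by (subst d_eq) (auto simp: divide_inverse mult_ac)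
        then have hd: "(w - 1) * (2 * d w) = - 2 * (e w * inverse (jtheta w ?Q / (1 - w)))"
          by (simp add: divide_inverse algebra_simps)
        have hH: "(w - 1) * H w = - (1 + w) * rank_gf w"
          using elim unfolding H_def by (simp add: divide_simps) (simp add: algebra_simps)
        have "(w - 1) * f w = (w - 1) * H w + (w - 1) * (2 * m w - 1) + (w - 1) * (2 * d w)"
          unfolding f_def by (simp add: algebra_simps)
        then have "?G w = (w - 1) * f w"
          unfolding hd hH by simp
        then show ?case unfolding F_def by (simp add: mult.assoc)
      qed
    qed
    ultimately show ?thesis by (simp add: Lim_transform_eventually)
  qed

  have m1D: "- 1 \<in> D" "h (- 1) \<noteq> 0" "F (- 1) = 0"
  proof -
    show "- 1 \<in> D" using \<rho> by (simp add: D_def)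
    have "jtheta (- q) ?Q \<noteq> 0" using not_both[of 1 0] by simp
    then show "h (- 1) \<noteq> 0" using jtheta_minus_1_nz by (simp add: h_def)
    \<comment> \<open>The factor \<open>jtheta (- w) q\<close> was included in \<open>F\<close> for
      this zero; it determines the constant.\<close>
    show "F (- 1) = 0" by (simp add: F_def)
  qed
  have conn: "connected D"
    unfolding D' using connected_punctured_ball[of "0::complex" \<rho>] by simp
  \<comment> \<open>At the zeros of $w^2 + q^{2l+1}$ the poles of \<open>m\<close> and \<open>d\<close> cancel, because
    their sum is $m(q/w^2, q^2, w)$.\<close>
  have pole2: "((\<lambda>w. (w - p) * F w) \<longlongrightarrow> 0) (at p)" if p: "p \<in> D" "?k p = 0" for p
  proof -
    have pnz: "p \<noteq> 0" and hp: "h p = 0" using p Dnz by (auto simp: h_def)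
    have jp: "jtheta p q \<noteq> 0" using not_both p(2) orbit[OF pnz] by blast
    define g where "g = (\<lambda>w. H w - 1 + 2 * (Q.lerch (q / w) w / jtheta w ?Q))"
    have "g holomorphic_on ?Dj"
      unfolding g_def
    proof (intro holomorphic_intros hol_H Q.holomorphic_lerch_on opn_pos hol_j Q.jtheta_holomorphic_intros)
      fix w r assume "w \<in> ?Dj"
      then show "?Q powi (r - 1) * (q / w) \<noteq> 1"
        using jQ_nz(2)[of w] Q.jtheta_eq_0_iff[of "q / w"] Dnz unfolding Q.powi_mult_eq_1_iff by auto
    qed (use jQ_nz Dnz in auto)
    then have G: "(g \<longlongrightarrow> g p) (at p)"
      by (rule isCont_D[OF _ opn_pos[OF hol_j(1)]]) (use p jp in auto)
    obtain r where r: "r > 0" "ball p r \<subseteq> D" "\<And>z. z \<in> ball p r - {p} \<Longrightarrow> h z \<noteq> 0"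
      using isolated_zeros[OF hol_h opn conn p(1) hp m1D(1,2)] by blast
    have fg: "f w = g w" if "w \<in> D" "h w \<noteq> 0" for w
    proof -
      have w: "w \<noteq> 0" "jtheta w q \<noteq> 0" "?k w \<noteq> 0" using that Dnz by (auto simp: h_def)
      have xw: "q / w ^ 2 * w = q / w" using w by (simp add: power2_eq_square)
      have "w \<noteq> ?Q powi k" "q / w \<noteq> ?Q powi k" for k :: int
        using jQ_nz[OF w(1,2)] Q.jtheta_eq_0_iff[of w] Q.jtheta_eq_0_iff[of "q / w"] w by auto
      then have "appell_m_defined (q / w ^ 2) ?Q w"
        using w xw by (simp add: appell_m_defined_def)
      from Q.appell_m_change_z[OF m_ok[OF w(1,3)] this]
      have "appell_m (q / w ^ 2) ?Q w = m w + d w" by (simp add: m_def d_def algebra_simps)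
      moreover have "appell_m (q / w ^ 2) ?Q w = Q.lerch (q / w) w / jtheta w ?Q"
        unfolding Q.appell_m_eq xw ..
      ultimately show ?thesis unfolding f_def g_def by simp
    qed
    have "((\<lambda>w. (w - p) * (g w * (jtheta w q * jtheta (- w) q / w))) \<longlongrightarrow>
        (p - p) * (g p * (jtheta p q * jtheta (- p) q / p))) (at p)"
      using pnz by (intro tendsto_intros G isContD[OF isCont_jtheta] isContD[OF isCont_o2[OF _ isCont_jtheta]]) auto
    moreover have "\<forall>\<^sub>F w in at p. (w - p) * (g w * (jtheta w q * jtheta (- w) q / w)) = (w - p) * F w"
      unfolding eventually_at using r fg by (intro exI[of _ r]) (auto simp: F_def dist_commute subset_iff)
    ultimately show ?thesis by (simp add: Lim_transform_eventually)
  qed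
  have F0: "F w = 0" if w: "w \<in> D" "h w \<noteq> 0" for w
  proof (rule q_periodic_eq_0[OF \<rho> D_def hol_h h_shift hol_F F_per _ m1D w])
    fix p assume p: "p \<in> D" "h p = 0"
    show "\<exists>p0\<in>D. \<exists>m n. q ^ m * p = q ^ n * p0 \<and> ((\<lambda>w. (w - p0) * F w) \<longlongrightarrow> 0) (at p0)"
    proof (cases "jtheta p q = 0")
      case True
      then obtain k :: int where k: "p = q powi k" using orbit[of p] Dnz p by blast
      then have "\<exists>m n :: nat. q ^ m * p = q ^ n * 1" using orbit_powers[of k 1] by simp
      then show ?thesis using one pole1 by blast
    next
      case False
      then show ?thesis using p pole2[of p] by (auto simp: h_def)
    qed
  qed
  have wnz: "w \<noteq> 0" using w by auto
  show ?thesis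
  proof (cases "w = - 1")
    \<comment> \<open>The theta factors in \<open>F\<close> vanish at -1, so this point is checked
      directly: the left side is 0, \<open>1 - 2m = 0\<close>, and \<open>Delta\<close> contains
      \<open>jtheta 1 (q^2) = 0\<close>.\<close>
    case True
    then show ?thesis by (simp add: appell_m_half Delta_def)
  next
    case False
    have "norm u = 1 \<Longrightarrow> u \<noteq> 1 \<Longrightarrow> u \<noteq> q powi k" for u k
    proof
      assume u: "norm u = 1" "u \<noteq> 1" "u = q powi k"
      then have "k = 0" using norm_powi_eq_1_iff[of k] by simp
      with u show False by simp
    qed
    note unit = this
    have jw: "jtheta w q \<noteq> 0" "jtheta (- w) q \<noteq> 0"
      using unit[of w] unit[of "- w"] w False orbit[of w] orbit[of "- w"] wnz by (auto simp: minus_equation_iff)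
    have "?k w \<noteq> 0"
    proof
      assume "?k w = 0"
      then obtain k :: int where k: "- (q / w ^ 2) = q powi (2 * k)" using orbit2[OF wnz] by blast
      then have "- (1 / w ^ 2) = q powi (2 * k - 1)" by (simp add: power_int_diff field_simps)
      then have "norm (q powi (2 * k - 1)) = norm (- (1 / w ^ 2))" by simp
      also have "\<dots> = 1" using w by (simp add: norm_divide norm_power)
      finally have "2 * k - 1 = 0" using norm_powi_eq_1_iff by blast
      then show False by presburger
    qed
    then have "F w = 0" using jw w \<rho> by (intro F0) (auto simp: D_def h_def)
    then have "f w = 0" using jw wnz by (simp add: F_def)
    then have "H w = 1 - 2 * m w - 2 * d w" by (simp add: f_def algebra_simps)
    then have "(1 - w) * H w = (1 - w) * (1 - 2 * m w - 2 * d w)" by simp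
    moreover have "(1 - w) * H w = (1 + w) * rank_gf w" using w by (simp add: H_def)
    ultimately show ?thesis by (simp add: m_def d_def)
  qed
qed

end

section \<open>Multisection of Appell--Lerch series\<close>

lemma sum_int_atLeast0: "(\<Sum>t = 0..int N - 1. f t) = (\<Sum>t<N. f (int t))"
proof -
  have "{0..int N - 1} = int ` {..<N}"
    by (auto simp: image_iff intro!: bexI[of _ "nat _"])
  then show ?thesis by (simp add: sum.reindex)
qed

section \<open>Roots of unity and finite Fourier sums\<close>

lemma zeta_nz [simp]: "zeta n \<noteq> 0"
  by (simp add: zeta_def)

lemma zeta_powi: "zeta n powi k = exp (of_int k * (2 * of_real pi * \<i> / of_int n))"
  unfolding zeta_def by (rule exp_power_int)

lemma norm_zeta_powi [simp]: "norm (zeta n powi k) = 1"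
proof -
  have "zeta n = exp (\<i> * of_real (2 * pi / of_int n))" unfolding zeta_def by (simp add: mult_ac)
  then have "norm (zeta n) = 1" by (simp only: norm_exp_i_times)
  then show ?thesis by (simp add: norm_power_int)
qed

lemma zeta_powi_eq_1_iff:
  assumes "n > 0"
  shows "zeta n powi k = 1 \<longleftrightarrow> n dvd k"
proof
  assume "zeta n powi k = 1"
  then obtain l :: int where l: "Im (of_int k * (2 * of_real pi * \<i> / of_int n)) = of_int (2 * l) * pi"
    unfolding zeta_powi exp_eq_1 by blast
  have "of_int k * (2 * of_real pi * \<i> / of_int n) = \<i> * of_real (2 * pi * of_int k / of_int n)"
    by simp
  with l have "2 * pi * of_int k / of_int n = of_int (2 * l) * pi"
    by (simp only: Im_i_times Re_complex_of_real)
  then have "real_of_int k = of_int (n * l)"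
    using assms by (simp add: field_simps)
  then have "k = n * l" using of_int_eq_iff by blast
  then show "n dvd k" by simp
next
  assume "n dvd k"
  then obtain l where "k = n * l" by (auto simp: dvd_def)
  then have "zeta n powi k = exp (of_int l * (2 * of_real pi * \<i>))"
    unfolding zeta_powi using assms by (simp add: field_simps)
  then show "zeta n powi k = 1" by (simp add: exp_eq_1)
qed

lemma zeta_powi_cong:
  assumes "n > 0" "[k = l] (mod n)"
  shows "zeta n powi k = zeta n powi l"
proof -
  have "zeta n powi (k - l) = 1"
    using assms by (simp add: zeta_powi_eq_1_iff cong_iff_dvd_diff)
  then show ?thesis by (simp add: power_int_diff)
qed

lemma sum_zeta:
  assumes N: "N > 0"
  shows "(\<Sum>t<N. zeta (int N) powi (m * int t)) = (if int N dvd m then of_nat N else 0)"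
proof -
  define w where "w = zeta (int N) powi m"
  have "(\<Sum>t<N. zeta (int N) powi (m * int t)) = (\<Sum>t<N. w ^ t)"
    by (simp add: w_def power_int_mult)
  also have "\<dots> = (if int N dvd m then of_nat N else 0)"
  proof (cases "int N dvd m")
    case True
    then have "w = 1" using N by (simp add: w_def zeta_powi_eq_1_iff)
    then show ?thesis using True by simp
  next
    case False
    then have "w \<noteq> 1" using N by (simp add: w_def zeta_powi_eq_1_iff)
    moreover have "w ^ N = 1"
    proof -
      have "w ^ N = zeta (int N) powi (m * int N)" by (simp add: w_def power_int_mult)
      also have "\<dots> = 1" using N by (simp add: zeta_powi_eq_1_iff)
      finally show ?thesis .
    qed
    ultimately show ?thesis using False by (simp add: geometric_sum)
  qed
  finally show ?thesis .
qed

text \<open>With \<open>u = v * zeta ^ t\<close> one has \<open>u ^ N = v ^ N\<close>, so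
  \<open>1 / (1 - u)\<close> is the sum of the \<open>u ^ i\<close> for \<open>i < N\<close>,
  divided by \<open>1 - v ^ N\<close>. Orthogonality keeps only \<open>i = k\<close>, which the
  range of \<open>k\<close> makes one of these exponents.\<close>

lemma sum_zeta_partial_fraction:
  assumes N: "N > 0" and k: "0 \<le> k" "k < int N" and v: "v ^ N \<noteq> 1"
  shows "(\<Sum>t<N. zeta (int N) powi (- k * int t) / (1 - v * zeta (int N) powi int t)) =
     of_nat N * v powi k / (1 - v ^ N)"
proof -
  let ?z = "zeta (int N)"
  have "?z powi (- k * int t) / (1 - v * ?z powi int t) =
      (\<Sum>i<N. v ^ i * ?z powi ((int i - k) * int t)) / (1 - v ^ N)" for t
  proof -
    define u where "u = v * ?z powi int t"
    have "?z powi (int N * int t) = 1" using N by (subst zeta_powi_eq_1_iff) auto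
    then have "u ^ N = v ^ N"
      by (simp add: u_def power_mult_distrib power_int_mult flip: power_mult) (simp add: mult.commute power_mult)
    moreover have "u \<noteq> 1" using v calculation by auto
    ultimately have "1 / (1 - u) = (\<Sum>i<N. u ^ i) / (1 - v ^ N)"
      using v geometric_sum[of u N] by (simp add: field_simps)
    then have "?z powi (- k * int t) * (1 / (1 - u)) = ?z powi (- k * int t) * ((\<Sum>i<N. u ^ i) / (1 - v ^ N))"
      by (rule arg_cong)
    then have "?z powi (- k * int t) / (1 - u) = (\<Sum>i<N. ?z powi (- k * int t) * u ^ i) / (1 - v ^ N)"
      unfolding sum_distrib_left[symmetric] by simp
    also have "(\<Sum>i<N. ?z powi (- k * int t) * u ^ i) = (\<Sum>i<N. v ^ i * ?z powi ((int i - k) * int t))"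
    proof (rule sum.cong)
      fix i
      have "(?z powi int t) ^ i = ?z powi (int i * int t)"
        using power_int_mult[of ?z "int t" "int i"] by (simp add: mult.commute)
      then have "u ^ i = v ^ i * ?z powi (int i * int t)" by (simp add: u_def power_mult_distrib)
      moreover have "?z powi ((int i - k) * int t) = ?z powi (int i * int t) * ?z powi (- k * int t)"
        by (subst power_int_add[symmetric]) (simp_all add: algebra_simps)
      ultimately show "?z powi (- k * int t) * u ^ i = v ^ i * ?z powi ((int i - k) * int t)"
        by (simp add: mult_ac)
    qed simp
    finally show ?thesis by (simp add: u_def)
  qed
  then have "(\<Sum>t<N. ?z powi (- k * int t) / (1 - v * ?z powi int t)) =
     (\<Sum>t<N. \<Sum>i<N. v ^ i * ?z powi ((int i - k) * int t)) / (1 - v ^ N)"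
    by (simp add: sum_divide_distrib)
  also have "(\<Sum>t<N. \<Sum>i<N. v ^ i * ?z powi ((int i - k) * int t)) =
     (\<Sum>i<N. v ^ i * (\<Sum>t<N. ?z powi ((int i - k) * int t)))"
    by (subst sum.swap) (simp add: sum_distrib_left)
  also have "\<dots> = (\<Sum>i<N. if i = nat k then v ^ i * of_nat N else 0)"
  proof (rule sum.cong)
    fix i assume i: "i \<in> {..<N}"
    have "int N dvd (int i - k) \<longleftrightarrow> i = nat k"
    proof
      assume "int N dvd (int i - k)"
      then have "int i mod int N = k mod int N" by (rule mod_eq_dvd_iff[THEN iffD2])
      then show "i = nat k" using i k by simp
    qed (use k in auto)
    then show "v ^ i * (\<Sum>t<N. ?z powi ((int i - k) * int t)) = (if i = nat k then v ^ i * of_nat N else 0)"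
      by (simp add: sum_zeta[OF N])
  qed simp
  also have "\<dots> = of_nat N * v powi k"
    using k by (auto simp: power_int_def)
  finally show ?thesis .
qed

lemma has_sum_sum:
  fixes f :: "'i \<Rightarrow> 'a \<Rightarrow> complex"
  assumes "\<And>i. i \<in> I \<Longrightarrow> (f i has_sum s i) A"
  shows "((\<lambda>x. \<Sum>i\<in>I. f i x) has_sum (\<Sum>i\<in>I. s i)) A"
  using assms by (induction I rule: infinite_finite_induct) (auto intro: has_sum_add)

lemma choose2_add: "choose2 (r + s) = choose2 r + choose2 s + r * s"
  using choose2_double[of r] choose2_double[of s] choose2_double[of "r + s"]
  by (simp add: algebra_simps)

lemma choose2_mult: "choose2 (n * u) = n ^ 2 * choose2 u + u * choose2 n"
proof -
  have "2 * choose2 (n * u) = n * u * (n * u - 1)" by (rule choose2_double)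
  also have "\<dots> = n ^ 2 * (u * (u - 1)) + u * (n * (n - 1))"
    by (simp add: algebra_simps power2_eq_square)
  also have "\<dots> = 2 * (n ^ 2 * choose2 u + u * choose2 n)"
    unfolding choose2_double[symmetric] by (simp add: algebra_simps)
  finally show ?thesis by simp
qed

text \<open>The shift by $1$ makes the classes $t = 0, \ldots, n-1$ match the summands of $\Psi$.\<close>

lemma bij_residue:
  assumes N: "N > 0"
  shows "bij_betw (\<lambda>(t, u). int t + 1 + int N * u) ({..<N} \<times> UNIV) UNIV"
proof (rule bij_betwI[where g = "\<lambda>r. (nat ((r - 1) mod int N), (r - 1) div int N)"])
  show "(case (nat ((r - 1) mod int N), (r - 1) div int N) of (t, u) \<Rightarrow> int t + 1 + int N * u) = r" for r
    using N mod_mult_div_eq[of "r - 1" "int N"] by simp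
qed (use N in \<open>auto simp: nat_less_iff\<close>)

section \<open>Splitting a Lerch sum into residue classes\<close>

context nome
begin

text \<open>As \<open>choose2\<close> is quadratic, shifting the index by \<open>k\<close>
  multiplies \<open>theta_term z r\<close> by \<open>q powi (r * k)\<close> and a constant.\<close>

lemma theta_term_powi_sum:
  assumes z: "z \<noteq> 0"
  shows "((\<lambda>r. theta_term z r * q powi (r * k)) has_sum ((-1) powi k * q powi (- choose2 k) * z powi (- k) * jtheta z q)) UNIV"
proof -
  let ?c = "(-1) powi k * q powi (- choose2 k) * z powi (- k)"
  have "((\<lambda>r. theta_term z (r + k)) has_sum jtheta z q) UNIV"
    by (rule has_sum_int_shift[OF jacobi_triple_product[OF z]])
  then have "((\<lambda>r. ?c * theta_term z (r + k)) has_sum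
     (?c * jtheta z q)) UNIV"
    by (rule has_sum_cmult_right)
  moreover have "?c * theta_term z (r + k) = theta_term z r * q powi (r * k)" for r
  proof -
    have "(-1 :: complex) powi k * (-1) powi k = 1"
      by (simp flip: power_int_mult_distrib)
    then show ?thesis
      using z unfolding theta_term_def choose2_add
      by (simp add: power_int_add power_int_minus field_simps)
  qed
  ultimately show ?thesis by simp
qed

text \<open>Averaging over the roots of unity makes the denominators depend on the
  \<open>N\<close>-th powers of \<open>v r\<close>. Each residue class of \<open>r\<close> then
  gives a Lerch sum to the base \<open>Q\<close>, and all of them share the first parameter
  \<open>X\<close>; this is why one common \<open>z'\<close> can be chosen.\<close>

theorem appell_m_multisection:
  fixes N :: nat and k :: int and x z z' :: complex
  defines "n \<equiv> int N"
  defines "Q \<equiv> q powi (n ^ 2)"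
  defines "X \<equiv> - (q powi (choose2 n - n * k)) * (- x) powi n"
  assumes N: "N > 0" and k: "0 \<le> k" "k < n" and x: "x \<noteq> 0" and z: "z \<noteq> 0" "jtheta z q \<noteq> 0"
    and pole: "\<And>r. (q powi r * x * z) ^ N \<noteq> 1"
    and pole_z: "\<And>r. - ((- z) powi n) \<noteq> q powi r"
    and gen: "appell_m_defined X Q z'"
  shows "(\<Sum>t = 0..n - 1. zeta n powi (- k * t) * appell_m (zeta n powi t * x) q z) =
     of_int n * (q powi (- choose2 (k + 1)) * (- x) powi k * appell_m X Q z' + Psi n k x z z' q)"
proof -
  have Qpow: "Q = q ^ (N ^ 2)" by (simp add: Q_def n_def flip: of_nat_power)
  interpret Q: nome Q
  proof
    show "Q \<noteq> 0" by (simp add: Qpow)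
    show "norm Q < 1" using q_lt1 N unfolding Qpow by (simp add: norm_power power_less_one_iff)
  qed
  have Q_powi: "Q powi l = q powi (n ^ 2 * l)" for l by (simp add: Q_def power_int_mult)
  define v where "v = (\<lambda>r. q powi (r - 1) * x * z)"
  define base where "base = (\<lambda>t. - (x powi k * z powi (k + 1)) * q powi (choose2 (t + 1) + k * t) * (- z) powi t)"
  \<comment> \<open>The theta argument of the residue class of \<open>t + 1\<close>. Its Lerch
    denominators contain \<open>X * Y t\<close>, which equals \<open>Q * U t\<close>;
    \<open>U t\<close> is the argument that appears in \<open>Psi\<close>.\<close>
  define Y where "Y = (\<lambda>t. - (q powi (choose2 (n + 1) + n * k + n * t)) * (- z) powi n)"
  define U where "U = (\<lambda>t. q powi (n * t) * (x * z) powi n)"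
  have Xnz: "X \<noteq> 0" and Ynz: "Y t \<noteq> 0" and Unz: "U t \<noteq> 0" for t
    using x z by (auto simp: X_def Y_def U_def)
  have sgn: "(- x) powi n * (- z) powi n = (x * z) powi n"
    by (simp flip: power_int_mult_distrib)
  have XY: "X * Y t = Q * U t" for t
  proof -
    have "X * Y t = q powi (choose2 n - n * k) * q powi (choose2 (n + 1) + n * k + n * t) * ((- x) powi n * (- z) powi n)"
      by (simp add: X_def Y_def mult_ac)
    also have "q powi (choose2 n - n * k) * q powi (choose2 (n + 1) + n * k + n * t) = q powi (n ^ 2 + n * t)"
    proof -
      have "choose2 n + choose2 (n + 1) = n ^ 2"
        using choose2_double[of n] unfolding choose2_plus_1 by (simp add: power2_eq_square algebra_simps)
      then have "(choose2 n - n * k) + (choose2 (n + 1) + n * k + n * t) = n ^ 2 + n * t" by simp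
      then show ?thesis by (metis power_int_add q_nz)
    qed
    finally show ?thesis by (simp add: sgn U_def Q_def power_int_add mult_ac)
  qed
  have vpow: "v (t + 1 + n * u) ^ N = Q powi (u - 1) * (X * Y t)" for t u
  proof -
    have "v (t + 1 + n * u) ^ N = (q powi (t + n * u)) ^ N * (x * z) ^ N"
      by (simp add: v_def power_mult_distrib mult.assoc)
    also have "(q powi (t + n * u)) ^ N = q powi ((t + n * u) * n)" by (simp add: power_int_mult n_def)
    also have "(t + n * u) * n = n ^ 2 * u + n * t" by (simp add: power2_eq_square algebra_simps)
    also have "q powi (n ^ 2 * u + n * t) = Q powi u * q powi (n * t)" by (simp add: power_int_add Q_powi)
    finally show ?thesis unfolding XY U_def by (simp add: power_int_diff n_def)
  qed
  have theta_v: "theta_term z (t + 1 + n * u) * v (t + 1 + n * u) powi k = base t * Q.theta_term (Y t) u" for t u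
  proof -
    define E where "E = choose2 (n + 1) + n * k + n * t"
    have e: "choose2 (t + 1 + n * u) + (t + n * u) * k = choose2 (t + 1) + k * t + n ^ 2 * choose2 u + E * u"
      unfolding E_def choose2_add[of "t + 1" "n * u"] choose2_mult choose2_plus_1[of n] by (simp add: algebra_simps)
    have "theta_term z (t + 1 + n * u) * v (t + 1 + n * u) powi k
       = (- z) powi (t + 1 + n * u) * (x * z) powi k * (q powi (choose2 (t + 1 + n * u)) * q powi ((t + n * u) * k))"
    proof -
      have m: "(- z) powi (t + 1 + n * u) = (-1) powi (t + 1 + n * u) * z powi (t + 1 + n * u)"
        by (simp flip: power_int_mult_distrib)
      have e1: "t + 1 + n * u - 1 = t + n * u" by simp
      show ?thesis
        unfolding theta_term_def v_def m e1 power_int_mult_distrib power_int_mult by (simp add: mult_ac)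
    qed
    also have "q powi (choose2 (t + 1 + n * u)) * q powi ((t + n * u) * k) = q powi (choose2 (t + 1) + k * t + n ^ 2 * choose2 u + E * u)"
      unfolding e[symmetric] by (simp add: power_int_add)
    also have "(- z) powi (t + 1 + n * u) = - z * (- z) powi t * ((- z) powi n) powi u"
      using z by (simp add: power_int_add power_int_mult)
    finally have L: "theta_term z (t + 1 + n * u) * v (t + 1 + n * u) powi k =
      - z * (- z) powi t * ((- z) powi n) powi u * (x * z) powi k * q powi (choose2 (t + 1) + k * t + n ^ 2 * choose2 u + E * u)" .
    have "(-1) powi u * Y t powi u = (q powi E * (- z) powi n) powi u"
      unfolding Y_def E_def by (simp flip: power_int_mult_distrib)
    then have "Q.theta_term (Y t) u = Q powi choose2 u * (q powi E * (- z) powi n) powi u"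
      by (simp add: Q.theta_term_def mult_ac)
    also have "\<dots> = q powi (n ^ 2 * choose2 u) * q powi (E * u) * ((- z) powi n) powi u"
      by (simp add: Q_powi power_int_mult_distrib power_int_mult)
    finally have R: "Q.theta_term (Y t) u = q powi (n ^ 2 * choose2 u) * q powi (E * u) * ((- z) powi n) powi u" .
    show ?thesis unfolding L R base_def using x z
      by (simp add: power_int_add power_int_mult_distrib mult_ac)
  qed
  have vN: "v r ^ N \<noteq> 1" for r using pole[of "r - 1"] by (simp add: v_def)

  have bij: "bij_betw (\<lambda>(t, u). int t + 1 + n * u) ({..<N} \<times> UNIV) UNIV"
    unfolding n_def by (rule bij_residue[OF N])
  \<comment> \<open>One regrouping serves two sums: constant \<open>c = 1\<close> gives the total of
    the theta weights, and \<open>c y = N / (1 - y)\<close> gives the Lerch sums.\<close>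
  have split: "S = (\<Sum>t<N. s (int t))"
    if S: "((\<lambda>r. theta_term z r * v r powi k * c (v r ^ N)) has_sum S) UNIV"
      and s: "\<And>t. ((\<lambda>u. Q.theta_term (Y t) u * c (Q powi (u - 1) * (X * Y t))) has_sum s' t) UNIV"
      and ss: "\<And>t. s t = base t * s' t" for c S s s'
  proof -
    have "((\<lambda>p. (\<lambda>r. theta_term z r * v r powi k * c (v r ^ N)) ((\<lambda>(t, u). int t + 1 + n * u) p)) has_sum S) ({..<N} \<times> UNIV)"
      using S by (subst has_sum_reindex_bij_betw[OF bij])
    then have "((\<lambda>t. s (int t)) has_sum S) {..<N}"
    proof (rule has_sum_SigmaD)
      fix t :: nat
      have "((\<lambda>u. base (int t) * (Q.theta_term (Y (int t)) u * c (Q powi (u - 1) * (X * Y (int t))))) has_sum s (int t)) UNIV"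
        unfolding ss by (rule has_sum_cmult_right[OF s])
      then show "((\<lambda>u. (\<lambda>r. theta_term z r * v r powi k * c (v r ^ N)) ((\<lambda>(t, u). int t + 1 + n * u) (t, u))) has_sum s (int t)) UNIV"
        by (simp add: theta_v vpow mult.assoc)
    qed
    then show ?thesis using has_sum_unique has_sum_finite by (metis finite_lessThan)
  qed

  have Y_orbit: "Y t \<noteq> Q powi l" for t l
  proof
    assume "Y t = Q powi l"
    then have "- ((- z) powi n) = q powi (n ^ 2 * l - (choose2 (n + 1) + n * k + n * t))"
      unfolding Y_def Q_powi by (simp add: power_int_diff field_simps)
    with pole_z show False by blast
  qed
  have U_orbit: "U t \<noteq> Q powi l" for t l
  proof
    assume "U t = Q powi l"
    then have "v (t + 1 + n * (- l)) ^ N = 1"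
      unfolding vpow XY by (simp add: power_int_diff power_int_minus)
    with vN show False by blast
  qed
  have XY_orbit: "X * Y t \<noteq> Q powi l" for t l
  proof
    assume "X * Y t = Q powi l"
    then have "U t = Q powi (l - 1)" unfolding XY by (simp add: power_int_diff field_simps)
    with U_orbit show False by blast
  qed
  have Y_def': "appell_m_defined X Q (Y t)" for t
    using Xnz Ynz Y_orbit XY_orbit by (auto simp: appell_m_defined_def)
  have jY: "jtheta (Y t) Q \<noteq> 0" for t using Q.jtheta_nz[OF Ynz Y_orbit] by blast
  have jU: "jtheta (U t) Q \<noteq> 0" for t using Q.jtheta_nz[OF Unz U_orbit] by blast

  have z'nz: "z' \<noteq> 0" using gen by (simp add: appell_m_defined_def)
  let ?B = "\<lambda>t :: nat. base (int t) * jtheta (Y (int t)) Q"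
  \<comment> \<open>The weights with which the series \<open>m(X, Q, Y t)\<close> enter add up to a
    multiple of \<open>jtheta z q\<close>; after division by it, only the monomial in front of
    \<open>m(X, Q, z')\<close> remains.\<close>
  have theta_sum: "(\<Sum>t<N. ?B t) = q powi (- choose2 (k + 1)) * (- x) powi k * jtheta z q"
  proof -
    have "((\<lambda>r. (x * z / q) powi k * (theta_term z r * q powi (r * k))) has_sum
       (x * z / q) powi k * ((-1) powi k * q powi (- choose2 k) * z powi (- k) * jtheta z q)) UNIV"
      by (intro has_sum_cmult_right theta_term_powi_sum z)
    also have "(\<lambda>r. (x * z / q) powi k * (theta_term z r * q powi (r * k))) = (\<lambda>r. theta_term z r * v r powi k * 1)"
      by (auto simp: v_def fun_eq_iff power_int_mult_distrib power_int_divide_distrib power_int_mult power_int_diff field_simps)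
    also have "(x * z / q) powi k * ((-1) powi k * q powi (- choose2 k) * z powi (- k) * jtheta z q) =
        q powi (- choose2 (k + 1)) * (- x) powi k * jtheta z q"
    proof -
      have "(- x) powi k = (-1) powi k * x powi k" by (simp flip: power_int_mult_distrib)
      then show ?thesis
        using z x unfolding choose2_plus_1
        by (simp add: power_int_mult_distrib power_int_divide_distrib power_int_minus power_int_add power_int_diff field_simps)
    qed
    finally have "((\<lambda>r. theta_term z r * v r powi k * 1) has_sum q powi (- choose2 (k + 1)) * (- x) powi k * jtheta z q) UNIV" .
    from split[where c = "\<lambda>_. 1", OF this, of "\<lambda>t. jtheta (Y t) Q"] show ?thesis
      using Q.jacobi_triple_product[OF Ynz] by simp
  qed

  define S where "S = (\<Sum>t<N. zeta n powi (- k * int t) * appell_m (zeta n powi int t * x) q z)"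
  have lerch_sum: "S * jtheta z q = of_nat N * (\<Sum>t<N. base (int t) * Q.lerch (X * Y (int t)) (Y (int t)))"
  proof -
    let ?s = "\<lambda>r. \<Sum>t<N. zeta n powi (- k * int t) * lerch_term (zeta n powi int t * x * z) z r"
    have "(?s
       has_sum (\<Sum>t<N. zeta n powi (- k * int t) * lerch (zeta n powi int t * x * z) z)) UNIV"
      by (intro has_sum_sum has_sum_cmult_right lerch_has_sum) (use x z in auto)
    also have "(\<Sum>t<N. zeta n powi (- k * int t) * lerch (zeta n powi int t * x * z) z) = S * jtheta z q"
      using z by (simp add: S_def appell_m_eq sum_distrib_right)
    also have "?s =
       (\<lambda>r. theta_term z r * v r powi k * (of_nat N / (1 - v r ^ N)))"
    proof
      fix r
      have "?s r =
         theta_term z r * (\<Sum>t<N. zeta n powi (- k * int t) / (1 - v r * zeta n powi int t))"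
        unfolding sum_distrib_left by (rule sum.cong) (auto simp: v_def mult_ac)
      also have "\<dots> = theta_term z r * (of_nat N * v r powi k / (1 - v r ^ N))"
        using sum_zeta_partial_fraction[OF N k(1) _ vN[of r]] k(2) unfolding n_def by simp
      finally show "?s r =
         theta_term z r * v r powi k * (of_nat N / (1 - v r ^ N))" by simp
    qed
    finally have 1: "((\<lambda>r. theta_term z r * v r powi k * (of_nat N / (1 - v r ^ N))) has_sum S * jtheta z q) UNIV" .
    have 2: "((\<lambda>u. Q.theta_term (Y t) u * (of_nat N / (1 - Q powi (u - 1) * (X * Y t)))) has_sum of_nat N * Q.lerch (X * Y t) (Y t)) UNIV" for t
      using has_sum_cmult_right[OF Q.lerch_has_sum[of "X * Y t" "Y t"], of "of_nat N"] Xnz Ynz by (simp add: mult.commute)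
    have "S * jtheta z q = (\<Sum>t<N. base (int t) * (of_nat N * Q.lerch (X * Y (int t)) (Y (int t))))"
      by (rule split[where c = "\<lambda>y. of_nat N / (1 - y)", OF 1 2]) simp
    then show ?thesis by (simp add: sum_distrib_left mult_ac)
  qed
  \<comment> \<open>With \<open>X * Y t = Q * U t\<close>, the quasi-periodicity factors of the two
    theta values have the quotient \<open>1 / z'\<close>, which cancels the leading factor
    \<open>z'\<close> of \<open>Delta\<close>.\<close>
  have Delta_term: "base t * jtheta (Y t) Q * Delta X (Y t) z' Q =
      - (x powi k * z powi (k + 1) * qpoch_inf Q Q ^ 3 / jtheta z' Q) *
      (q powi (choose2 (t + 1) + k * t) * (- z) powi t * jtheta (Y t / z') Q * jtheta (U t * z') Q / (jtheta (X * z') Q * jtheta (U t) Q))" for t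
  proof -
    have e: "X * z' * Y t = Q * (U t * z')" using XY[of t] by (simp add: mult_ac)
    have j1: "jtheta (X * z' * Y t) Q = - jtheta (U t * z') Q / (U t * z')"
      unfolding e by (rule Q.jtheta_q_shift) (use Unz z'nz in simp)
    have j2: "jtheta (X * Y t) Q = - jtheta (U t) Q / U t"
      unfolding XY using Q.jtheta_q_shift[OF Unz] by simp
    show ?thesis
      unfolding Delta_def base_def j1 j2 using Unz[of t] z'nz jY[of t] jU[of t] by (simp add: field_simps)
  qed
  have "(\<Sum>t<N. base (int t) * Q.lerch (X * Y (int t)) (Y (int t))) =
     (\<Sum>t<N. ?B t * appell_m X Q z' + ?B t * Delta X (Y (int t)) z' Q)"
  proof (rule sum.cong)
    fix t
    have "Q.lerch (X * Y (int t)) (Y (int t)) = jtheta (Y (int t)) Q * appell_m X Q (Y (int t))"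
      using jY by (simp add: Q.appell_m_eq)
    also have "appell_m X Q (Y (int t)) = appell_m X Q z' + Delta X (Y (int t)) z' Q"
      using Q.appell_m_change_z[OF gen Y_def'[of "int t"]] by (simp add: algebra_simps)
    finally show "base (int t) * Q.lerch (X * Y (int t)) (Y (int t)) =
      ?B t * appell_m X Q z' + ?B t * Delta X (Y (int t)) z' Q"
      by (simp add: algebra_simps)
  qed simp
  also have "\<dots> = (\<Sum>t<N. ?B t) * appell_m X Q z' +
      (\<Sum>t<N. ?B t * Delta X (Y (int t)) z' Q)"
    by (simp add: sum.distrib sum_distrib_right)
  also have "(\<Sum>t<N. ?B t * Delta X (Y (int t)) z' Q) = jtheta z q * Psi n k x z z' q"
  proof -
    have "Psi n k x z z' q = - (x powi k * z powi (k + 1) * qpoch_inf Q Q ^ 3 / (jtheta z q * jtheta z' Q)) *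
      (\<Sum>t<N. q powi (choose2 (int t + 1) + k * int t) * (- z) powi int t * jtheta (Y (int t) / z') Q *
         jtheta (U (int t) * z') Q / (jtheta (X * z') Q * jtheta (U (int t)) Q))"
      unfolding Psi_def Let_def sum_int_atLeast0 n_def
      by (simp add: Q_def X_def Y_def U_def n_def)
    then show ?thesis
      unfolding Delta_term sum_distrib_left[symmetric] using z by simp
  qed
  finally have "S * jtheta z q = of_nat N * (q powi (- choose2 (k + 1)) * (- x) powi k * appell_m X Q z' + Psi n k x z z' q) * jtheta z q"
    unfolding lerch_sum theta_sum by (simp add: algebra_simps)
  then have "S = of_nat N * (q powi (- choose2 (k + 1)) * (- x) powi k * appell_m X Q z' + Psi n k x z z' q)"
    using z by simp
  then show ?thesis unfolding S_def n_def sum_int_atLeast0 by simp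
qed

end

section \<open>Rank deviations\<close>

lemma sum_zeta_indicator:
  assumes N: "N > 0"
  shows "(\<Sum>j<N. zeta (int N) powi (int j * (r - a))) = (if [r = a] (mod int N) then of_nat N else 0)"
  using sum_zeta[OF N, of "r - a"] by (simp add: mult.commute cong_iff_dvd_diff)

lemma Nbar_eq:
  assumes N: "N > 0"
  shows "of_nat N * of_nat (Nbar a (int N) m) =
    (\<Sum>j<N. zeta (int N) powi (- a * int j) * (\<Sum>xs\<in>overpartitions m. (zeta (int N) powi int j) powi overpartition_rank xs))"
proof -
  let ?z = "zeta (int N)"
  have "(\<Sum>j<N. ?z powi (- a * int j) * (\<Sum>xs\<in>overpartitions m. (?z powi int j) powi overpartition_rank xs))
    = (\<Sum>xs\<in>overpartitions m. \<Sum>j<N. ?z powi (int j * (overpartition_rank xs - a)))"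
  proof -
    have "?z powi (- a * int j) * (?z powi int j) powi r = ?z powi (int j * (r - a))" for j r
    proof -
      have "int j * (r - a) = - a * int j + int j * r" by (simp add: algebra_simps)
      then show ?thesis by (simp only: power_int_add power_int_mult zeta_nz simp_thms)
    qed
    then show ?thesis unfolding sum_distrib_left by (subst sum.swap) (simp only:)
  qed
  also have "\<dots> = (\<Sum>xs\<in>overpartitions m. if [overpartition_rank xs = a] (mod int N) then of_nat N else 0)"
    by (simp add: sum_zeta_indicator[OF N])
  also have "\<dots> = of_nat N * of_nat (Nbar a (int N) m)"
    unfolding Nbar_def using finite_overpartitions[of m] by (simp add: sum.If_cases Int_def mult.commute)
  finally show ?thesis ..
qed

context nome
begin

text \<open>The term \<open>j = 0\<close> of the Fourier inversion is \<open>pbar m / N\<close>,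
  precisely what \<open>Dbar\<close> subtracts. Only roots of unity other than 1 remain, where
  \<open>rank_gf_appell\<close> applies.\<close>

lemma Dbar_eq:
  assumes N: "N > 0"
  shows "Dbar a (int N) q = (\<Sum>j\<in>{1..<N}. zeta (int N) powi (- a * int j) * rank_gf (zeta (int N) powi int j)) / of_nat N"
proof -
  let ?z = "zeta (int N)"
  define c where "c = (\<lambda>j m. \<Sum>xs\<in>overpartitions m. (?z powi int j) powi overpartition_rank xs)"
  let ?s = "\<lambda>m. \<Sum>j\<in>{1..<N}. ?z powi (- a * int j) * (c j m * q ^ m)"
  have "(\<lambda>m. ?s m / of_nat N) sums
     ((\<Sum>j\<in>{1..<N}. ?z powi (- a * int j) * rank_gf (?z powi int j)) / of_nat N)"
    unfolding c_def by (intro sums_divide sums_sum sums_mult rank_series_sums norm_zeta_powi)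
  moreover have "?s m / of_nat N =
      (of_nat (Nbar a (int N) m) - of_nat (pbar m) / of_int (int N)) * q ^ m" for m
  proof -
    have "of_nat N * of_nat (Nbar a (int N) m) = (\<Sum>j<N. ?z powi (- a * int j) * c j m)"
      unfolding c_def by (rule Nbar_eq[OF N])
    also have "\<dots> = c 0 m + (\<Sum>j\<in>{1..<N}. ?z powi (- a * int j) * c j m)"
      using N by (simp add: lessThan_atLeast0 sum.atLeast_Suc_lessThan)
    also have "c 0 m = of_nat (pbar m)" by (simp add: c_def pbar_def)
    finally have "(\<Sum>j\<in>{1..<N}. ?z powi (- a * int j) * c j m) = of_nat N * of_nat (Nbar a (int N) m) - of_nat (pbar m)"
      by simp
    moreover have "?s m =
        (\<Sum>j\<in>{1..<N}. ?z powi (- a * int j) * c j m) * q ^ m"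
      unfolding sum_distrib_right by (rule sum.cong) (simp_all only: mult.assoc)
    ultimately show ?thesis using N by (simp only:) (simp add: field_simps)
  qed
  ultimately show ?thesis unfolding Dbar_def by (simp add: sums_iff)
qed

text \<open>The coefficients of the two deviations combine to \<open>1 + w\<close>, so the product
  \<open>(1 + w) * rank_gf w\<close> can be replaced as a whole, including the case
  \<open>w = -1\<close>.\<close>

lemma Dbar_sum:
  assumes N: "N > 1" and a: "2 \<le> a" "a \<le> int N"
  defines "w \<equiv> \<lambda>j :: int. zeta (int N) powi j"
  shows "Dbar a (int N) q + Dbar (a - 1) (int N) q = of_bool (a = int N)
     - 2 / of_nat N * (\<Sum>j<N. w (- a * int j) * (1 - w (int j)) * appell_mu (w (- 2 * int j) * q))
     - 2 / of_nat N * (\<Sum>j = 1..int N - 1. w (- a * j) * (1 - w j) * Delta (w (- 2 * j) * q) (w j) (- 1) (q ^ 2))"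
proof -
  define m where "m = (\<lambda>j. appell_mu (w (- 2 * int j) * q))"
  define d where "d = (\<lambda>j. Delta (w (- 2 * j) * q) (w j) (- 1) (q ^ 2))"
  define u where "u = (\<lambda>j. w (- a * int j) * (1 - w (int j)))"
  have N0: "N > 0" using N by simp
  have wsum: "(\<Sum>j<N. w (- b * int j)) = (if int N dvd b then of_nat N else 0)" for b
    unfolding w_def using sum_zeta[OF N0, of "- b"] by simp
  have w0: "w 0 = 1" by (simp add: w_def)
  have w_add: "w (i + j) = w i * w j" for i j unfolding w_def by (simp add: power_int_add)
  have shift: "w (- (a - 1) * int j) = w (- a * int j) * w (int j)" for j
    unfolding w_add[symmetric] by (simp add: algebra_simps)
  have "Dbar a (int N) q + Dbar (a - 1) (int N) q =
     (\<Sum>j\<in>{1..<N}. w (- a * int j) * ((1 + w (int j)) * rank_gf (w (int j)))) / of_nat N"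
    unfolding Dbar_eq[OF N0] w_def[symmetric] shift
    by (simp add: algebra_simps flip: add_divide_distrib sum.distrib)
  also have "(\<Sum>j\<in>{1..<N}. w (- a * int j) * ((1 + w (int j)) * rank_gf (w (int j)))) =
     (\<Sum>j\<in>{1..<N}. u j - 2 * (u j * m j)
        - 2 * (u j * d (int j)))"
  proof (rule sum.cong)
    fix j assume j: "j \<in> {1..<N}"
    have "\<not> int N dvd int j" using j by (auto dest: zdvd_imp_le)
    then have "w (int j) \<noteq> 1" using N0 zeta_powi_eq_1_iff[of "int N" "int j"] by (simp add: w_def)
    moreover have "norm (w (int j)) = 1" unfolding w_def by (rule norm_zeta_powi)
    moreover have "q / w (int j) ^ 2 = w (- 2 * int j) * q"
    proof -
      have "w (- 2 * int j) * (w (int j) * w (int j)) = 1"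
        unfolding w_add[symmetric] using w0 by simp
      then show ?thesis by (simp add: w_def field_simps power2_eq_square)
    qed
    ultimately have rg: "(1 + w (int j)) * rank_gf (w (int j)) = (1 - w (int j)) * (1 - 2 * m j - 2 * d (int j))"
      using rank_gf_appell[of "w (int j)"] by (simp add: m_def d_def)
    show "w (- a * int j) * ((1 + w (int j)) * rank_gf (w (int j))) = u j - 2 * (u j * m j)
        - 2 * (u j * d (int j))"
      unfolding rg u_def by (simp add: algebra_simps)
  qed simp
  also have "\<dots> = (\<Sum>j\<in>{1..<N}. u j) - 2 * (\<Sum>j\<in>{1..<N}. u j * m j)
      - 2 * (\<Sum>j\<in>{1..<N}. u j * d (int j))"
    by (simp add: sum_subtractf sum_distrib_left)
  also have "(\<Sum>j\<in>{1..<N}. u j) = of_nat N * of_bool (a = int N)"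
  proof -
    have "(\<Sum>j\<in>{1..<N}. u j) = (\<Sum>j<N. u j)"
      using N0 w0 by (simp add: u_def lessThan_atLeast0 sum.atLeast_Suc_lessThan)
    also have "\<dots> = (\<Sum>j<N. w (- a * int j)) - (\<Sum>j<N. w (- (a - 1) * int j))"
      unfolding shift u_def by (simp add: algebra_simps sum_subtractf)
    also have "\<dots> = of_nat N * of_bool (a = int N)"
    proof -
      \<comment> \<open>Origin of the indicator of \<open>a = M\<close>: in the range of
        \<open>a\<close>, the modulus divides \<open>a\<close> only when they are equal, and it
        never divides \<open>a - 1\<close>.\<close>
      have "int N dvd a \<longleftrightarrow> a = int N" "\<not> int N dvd a - 1"
        using a by (auto dest: zdvd_imp_le)
      then show ?thesis unfolding wsum by simp
    qed
    finally show ?thesis .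
  qed
  \<comment> \<open>The factor \<open>1 - w\<close> vanishes at \<open>j = 0\<close>, so that term
    can be restored; a sum over the full residue system is what the multisection requires.\<close>
  also have "(\<Sum>j\<in>{1..<N}. u j * m j) = (\<Sum>j<N. u j * m j)"
    using N0 w0 by (simp add: u_def lessThan_atLeast0 sum.atLeast_Suc_lessThan)
  also have "(\<Sum>j\<in>{1..<N}. u j * d (int j)) = (\<Sum>j = 1..int N - 1. w (- a * j) * (1 - w j) * d j)"
  proof -
    have "{1..int N - 1} = int ` {1..<N}"
      unfolding image_int_atLeastLessThan by auto
    then show ?thesis by (simp add: sum.reindex u_def)
  qed
  finally have eq: "Dbar a (int N) q + Dbar (a - 1) (int N) q = (of_nat N * of_bool (a = int N)
      - 2 * (\<Sum>j<N. u j * m j)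
      - 2 * (\<Sum>j = 1..int N - 1. w (- a * j) * (1 - w j) * d j)) / of_nat N" .
  have cancel: "(of_nat N * A - 2 * B - 2 * C) / of_nat N = A - 2 / of_nat N * B - 2 / of_nat N * C" for A B C :: complex
    using N0 by (simp add: field_simps)
  show ?thesis using eq unfolding cancel m_def d_def u_def .
qed

section \<open>The sections for odd and for even modulus\<close>

abbreviation mu_section :: "nat \<Rightarrow> int \<Rightarrow> complex \<Rightarrow> complex" where
  "mu_section N k x \<equiv> \<Sum>t<N. zeta (int N) powi (- k * int t) * appell_mu (zeta (int N) powi int t * x)"

text \<open>For \<open>x = q\<close> and \<open>x = inverse q\<close> the number
  \<open>(q ^ 2) powi r * x\<close> is an odd power of \<open>q\<close>, so its modulus is never 1;
  with \<open>z = -1\<close> this gives the pole conditions of the multisection.\<close>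

lemma appell_m_multisection_square:
  fixes N :: nat and k :: int
  assumes N: "N > 0" and k: "0 \<le> k" "k < int N" and x: "x = q \<or> x = inverse q"
    and gen: "appell_m_defined (- ((q ^ 2) powi (choose2 (int N) - int N * k)) * (- x) powi int N) ((q ^ 2) powi (int N ^ 2)) z'"
  shows "mu_section N k x =
     of_nat N * ((q ^ 2) powi (- choose2 (k + 1)) * (- x) powi k *
         appell_m (- ((q ^ 2) powi (choose2 (int N) - int N * k)) * (- x) powi int N) ((q ^ 2) powi (int N ^ 2)) z'
       + Psi (int N) k x (- 1) z' (q ^ 2))"
proof -
  interpret Q: nome "q ^ 2" by (rule nome_square)
  have "(\<Sum>t = 0..int N - 1. zeta (int N) powi (- k * t) * appell_mu (zeta (int N) powi t * x)) =
     of_int (int N) * ((q ^ 2) powi (- choose2 (k + 1)) * (- x) powi k *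
         appell_m (- ((q ^ 2) powi (choose2 (int N) - int N * k)) * (- x) powi int N) ((q ^ 2) powi (int N ^ 2)) z'
       + Psi (int N) k x (- 1) z' (q ^ 2))"
  proof (rule Q.appell_m_multisection[OF N k _ _ Q.jtheta_minus_1_nz _ _ gen])
    show "((q ^ 2) powi r * x * - 1) ^ N \<noteq> 1" for r
    proof
      assume "((q ^ 2) powi r * x * - 1) ^ N = 1"
      then have "norm (((q ^ 2) powi r * x * - 1) ^ N) = 1" by (simp only: norm_one)
      then have "norm ((q ^ 2) powi r * x * - 1) ^ N = 1" by (simp only: norm_power)
      then have "norm ((q ^ 2) powi r * x) = 1"
        using N power_eq_1_iff[of "norm ((q ^ 2) powi r * x)" N] by simp
      moreover have "(q ^ 2) powi r * x = q powi (2 * r + (if x = q then 1 else - 1))"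
        using x unfolding powi_square by (auto simp: power_int_add power_int_minus)
      ultimately have "2 * r + (if x = q then 1 else - 1) = 0" using norm_powi_eq_1_iff by metis
      then show False by (cases "x = q"; simp; presburger)
    qed
    show "- ((- (- 1)) powi int N) \<noteq> (q ^ 2) powi r" for r
      using Q.powi_q_neq_minus_1[of r] by simp
  qed (use x in auto)
  then show ?thesis unfolding sum_int_atLeast0 by simp
qed

lemma sum_zeta_reindex:
  fixes f :: "int \<Rightarrow> complex"
  assumes N: "N > 0" and per: "\<And>i j. [i = j] (mod int N) \<Longrightarrow> f i = f j" and c: "coprime c (int N)"
  shows "(\<Sum>j<N. f (int j)) = (\<Sum>t<N. f (c * int t))"
proof -
  define g where "g = (\<lambda>t. nat (c * int t mod int N))"
  have gN: "g t < N" for t using N by (simp add: g_def nat_less_iff)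
  have gc: "[int (g t) = c * int t] (mod int N)" for t using N by (simp add: g_def cong_def)
  have "inj_on g {..<N}"
  proof (rule inj_onI)
    fix s t assume st: "s \<in> {..<N}" "t \<in> {..<N}" "g s = g t"
    then have "[c * int s = c * int t] (mod int N)" using gc cong_trans cong_sym by metis
    then have "[int s = int t] (mod int N)" using c cong_mult_lcancel by blast
    then show "s = t" using st by (simp add: cong_int_iff cong_less_modulus_unique_nat)
  qed
  then have "bij_betw g {..<N} {..<N}"
    by (auto simp: bij_betw_def endo_inj_surj gN image_subset_iff)
  then have "(\<Sum>j<N. f (int j)) = (\<Sum>t<N. f (int (g t)))"
    by (rule sum.reindex_bij_betw[symmetric])
  also have "\<dots> = (\<Sum>t<N. f (c * int t))" using per[OF gc] by simp
  finally show ?thesis .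
qed

text \<open>The substitution \<open>j = h * t\<close> permutes the residues, since
  \<open>N - 2 * h = 1\<close> makes \<open>h\<close> coprime to \<open>N\<close>, and it turns
  \<open>zeta^(-2j)\<close> into \<open>zeta^t\<close>. The exponents \<open>a\<close> and
  \<open>a - 1\<close> are thereby multiplied by \<open>h\<close>, whence \<open>k1\<close> and
  \<open>k2\<close>.\<close>

lemma odd_section_sum:
  assumes N: "N > 0" "odd N" and h: "2 * h = int N - 1"
    and k1: "[a * h = k1] (mod int N)" and k2: "[(a - 1) * h = k2] (mod int N)"
  defines "w \<equiv> \<lambda>j :: int. zeta (int N) powi j"
  shows "(\<Sum>j<N. w (- a * int j) * (1 - w (int j)) * appell_mu (w (- 2 * int j) * q)) =
     mu_section N k1 q -
     mu_section N k2 q"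
proof -
  define f where "f = (\<lambda>j. w (- a * j) * (1 - w j) * appell_mu (w (- 2 * j) * q))"
  have w_cong: "w i = w j" if "[i = j] (mod int N)" for i j
    unfolding w_def by (rule zeta_powi_cong) (use N that in auto)
  have w_add: "w (i + j) = w i * w j" for i j unfolding w_def by (simp add: power_int_add)
  have cop: "coprime h (int N)"
  proof (rule coprimeI)
    fix d assume "d dvd h" "d dvd int N"
    then have "d dvd int N - 2 * h" by (intro dvd_diff dvd_mult)
    then show "is_unit d" using h by simp
  qed
  have per: "f i = f j" if "[i = j] (mod int N)" for i j
  proof -
    have "w (c * i) = w (c * j)" for c using that by (intro w_cong cong_scalar_left)
    then show ?thesis using w_cong[OF that] unfolding f_def by metis
  qed
  have "(\<Sum>j<N. f (int j)) = (\<Sum>t<N. f (h * int t))"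
    by (rule sum_zeta_reindex[OF N(1) per cop])
  also have "\<dots> = (\<Sum>t<N. w (- k1 * int t) * appell_mu (w (int t) * q) -
     w (- k2 * int t) * appell_mu (w (int t) * q))"
  proof (rule sum.cong)
    fix t
    have "w (- a * (h * int t)) = w (- k1 * int t)"
      using cong_scalar_right[OF k1, of "- int t"] by (intro w_cong) (simp add: mult_ac)
    moreover have "w (- a * (h * int t)) * w (h * int t) = w (- k2 * int t)"
      unfolding w_add[symmetric]
      using cong_scalar_right[OF k2, of "- int t"] by (intro w_cong) (simp add: algebra_simps)
    moreover have "w (- 2 * (h * int t)) = w (int t)"
    proof (rule w_cong)
      have "- 2 * (h * int t) = - (2 * h) * int t" by simp
      also have "\<dots> = int t + int N * (- int t)" unfolding h by (simp add: algebra_simps)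
      finally have "- 2 * (h * int t) = int t + int N * (- int t)" .
      then show "[- 2 * (h * int t) = int t] (mod int N)"
        unfolding cong_iff_dvd_diff by (metis add_diff_cancel_left' dvd_triv_left)
    qed
    ultimately show "f (h * int t) = w (- k1 * int t) * appell_mu (w (int t) * q) -
      w (- k2 * int t) * appell_mu (w (int t) * q)"
      unfolding f_def by (simp add: algebra_simps)
  qed simp
  also have "\<dots> = mu_section N k1 q - mu_section N k2 q"
    unfolding w_def by (rule sum_subtractf)
  finally show ?thesis unfolding f_def .
qed

text \<open>The multisection at \<open>x = q\<close> with exponents collected to the base
  \<open>q\<close>: the two signs in \<open>X\<close> cancel for odd \<open>N\<close>, and the
  prefactor becomes a square exponent through
  \<open>- 2 * choose2 (k + 1) + k = - k ^ 2\<close>.\<close>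

lemma odd_section:
  fixes N :: nat and k :: int
  assumes N: "odd N" and k: "0 \<le> k" "k < int N"
    and gen: "appell_m_defined (q powi (int N ^ 2 - 2 * int N * k)) (q powi (2 * int N ^ 2)) z'"
  shows "mu_section N k q =
     of_nat N * (q powi (- (k ^ 2)) * (-1) powi k *
         appell_m (q powi (int N ^ 2 - 2 * int N * k)) (q powi (2 * int N ^ 2)) z'
       + Psi (int N) k q (- 1) z' (q ^ 2))"
proof -
  have N0: "N > 0" using N by (cases N) auto
  have neg: "(- q) powi l = (-1) powi l * q powi l" for l by (simp flip: power_int_mult_distrib)
  have X: "- ((q ^ 2) powi (choose2 (int N) - int N * k)) * (- q) powi int N = q powi (int N ^ 2 - 2 * int N * k)"
  proof -
    have "2 * (choose2 (int N) - int N * k) + int N = int N ^ 2 - 2 * int N * k"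
      using choose2_double[of "int N"] by (simp add: algebra_simps power2_eq_square)
    then have "q powi (2 * (choose2 (int N) - int N * k)) * q powi int N = q powi (int N ^ 2 - 2 * int N * k)"
      by (metis power_int_add q_nz)
    then show ?thesis unfolding powi_square neg using N by simp
  qed
  have C: "(q ^ 2) powi (- choose2 (k + 1)) * (- q) powi k = q powi (- (k ^ 2)) * (-1) powi k"
  proof -
    have "2 * (- choose2 (k + 1)) + k = - (k ^ 2)"
      using choose2_double[of k] unfolding choose2_plus_1 by (simp add: algebra_simps power2_eq_square)
    then have "q powi (2 * (- choose2 (k + 1))) * q powi k = q powi (- (k ^ 2))"
      by (metis power_int_add q_nz)
    then show ?thesis unfolding powi_square neg by (simp add: mult_ac)
  qed
  show ?thesis
    by (rule appell_m_multisection_square[OF N0 k, of q z', unfolded X C powi_square[of "int N ^ 2"]])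
      (use gen in auto)
qed

lemma zeta_double: "n \<noteq> 0 \<Longrightarrow> zeta (2 * n) powi (2 * i) = zeta n powi i"
  unfolding zeta_powi by (simp add: field_simps)

text \<open>The indices \<open>j\<close> and \<open>j + n\<close> give opposite roots
  \<open>w\<close> and \<open>-w\<close>, on which every factor agrees except \<open>1 - w\<close>.
  The pair therefore contributes twice a term over the roots of order \<open>n\<close>.\<close>

lemma even_section_sum:
  assumes n: "n > 0"
  defines "w \<equiv> \<lambda>j :: int. zeta (2 * int n) powi j"
  shows "(\<Sum>j<2 * n. w (- (2 * b) * int j) * (1 - w (int j)) * appell_mu (w (- 2 * int j) * q)) =
     2 * inverse q * mu_section n (b - 1) (inverse q)"
proof -
  interpret Q: nome "q ^ 2" by (rule nome_square)
  define f where "f = (\<lambda>j. w (- (2 * b) * j) * (1 - w j) * appell_mu (w (- 2 * j) * q))"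
  have w_add: "w (i + j) = w i * w j" for i j unfolding w_def by (simp add: power_int_add)
  have w2: "w (2 * i) = zeta (int n) powi i" for i
    unfolding w_def using n by (intro zeta_double) simp
  have wn: "w (int n) = - 1"
  proof -
    have "w (int n) = exp (\<i> * of_real pi)" unfolding w_def zeta_powi using n by (simp add: field_simps)
    then show ?thesis by (simp add: exp_pi_i')
  qed
  have wper: "w (2 * int n * i) = 1" for i
    unfolding w_def using n by (subst zeta_powi_eq_1_iff) auto
  have split: "(\<Sum>j<m + l. g j) = (\<Sum>j<m. g j) + (\<Sum>j<l. g (m + j))" for g :: "nat \<Rightarrow> complex" and m l
    by (induction l) (simp_all add: add.assoc)
  have "(\<Sum>j<2 * n. f (int j)) = (\<Sum>j<n. f (int j) + f (int j + int n))"
    unfolding mult_2 split by (simp add: sum.distrib add.commute)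
  also have "\<dots> = (\<Sum>j<n. 2 * inverse q * (zeta (int n) powi (- (b - 1) * int j) * appell_mu (zeta (int n) powi int j * inverse q)))"
  proof (rule sum.cong)
    fix j
    define x where "x = zeta (int n) powi int j * inverse q"
    have xnz: "x \<noteq> 0" by (simp add: x_def)
    have a1: "w (- (2 * b) * (int j + int n)) = w (- (2 * b) * int j)"
    proof -
      have "- (2 * b) * (int j + int n) = - (2 * b) * int j + 2 * int n * (- b)" by (simp add: algebra_simps)
      then show ?thesis by (metis w_add wper mult_1_right)
    qed
    have a2: "w (- 2 * (int j + int n)) = w (- 2 * int j)"
    proof -
      have "- 2 * (int j + int n) = - 2 * int j + 2 * int n * (- 1)" by simp
      then show ?thesis by (metis w_add wper mult_1_right)
    qed
    have "f (int j) + f (int j + int n) = 2 * (w (- (2 * b) * int j) * appell_mu (w (- 2 * int j) * q))"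
      unfolding f_def a1 a2 w_add wn by (simp add: algebra_simps)
    also have "w (- (2 * b) * int j) = zeta (int n) powi (- b * int j)"
      unfolding w2[symmetric] by (simp add: mult.assoc)
    also have "w (- 2 * int j) * q = 1 / x"
    proof -
      have "w (- 2 * int j) = zeta (int n) powi (- int j)" unfolding w2[symmetric] by simp
      then show ?thesis by (simp add: x_def power_int_minus divide_inverse)
    qed
    \<comment> \<open>Inversion keeps the parameter -1. It makes the power of the root of unity in
      the argument positive, as in \<open>mu_section\<close>, and the factor \<open>x\<close> lowers
      \<open>b\<close> to \<open>b - 1\<close> and supplies \<open>inverse q\<close>.\<close>
    also have "appell_mu (1 / x) = x * appell_mu x"
    proof -
      have "x * (- 1) \<noteq> (q ^ 2) powi k" for k
      proof
        assume "x * (- 1) = (q ^ 2) powi k"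
        then have "q * (x * (- 1)) = q powi (2 * k + 1)" unfolding powi_square by (simp add: power_int_add)
        moreover have "norm (q * (x * (- 1))) = 1"
          unfolding norm_mult x_def norm_zeta_powi by (simp add: norm_inverse)
        ultimately have "2 * k + 1 = 0" using norm_powi_eq_1_iff by metis
        then show False by presburger
      qed
      then have "appell_m_defined x (q ^ 2) (- 1)"
        using xnz Q.powi_q_neq_minus_1 by (auto simp: appell_m_defined_def) (metis minus_equation_iff)
      from Q.appell_m_inverse[OF this] show ?thesis by simp
    qed
    also have "2 * (zeta (int n) powi (- b * int j) * (x * appell_mu x)) =
       2 * inverse q * (zeta (int n) powi (- (b - 1) * int j) * appell_mu x)"
    proof -
      have "- (b - 1) * int j = - b * int j + int j" by (simp add: algebra_simps)
      then have "zeta (int n) powi (- (b - 1) * int j) = zeta (int n) powi (- b * int j) * zeta (int n) powi int j"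
        by (metis power_int_add zeta_nz)
      then show ?thesis by (simp add: x_def)
    qed
    finally show "f (int j) + f (int j + int n) =
      2 * inverse q * (zeta (int n) powi (- (b - 1) * int j) * appell_mu (zeta (int n) powi int j * inverse q))"
      unfolding x_def .
  qed simp
  finally show ?thesis unfolding f_def sum_distrib_left .
qed

text \<open>Here \<open>x = inverse q\<close>, and the extra \<open>inverse q\<close> completes the
  square: \<open>- 1 - 2 * choose2 b - (b - 1) = - b ^ 2\<close>.\<close>

lemma even_section:
  fixes n :: nat and b :: int
  defines "X \<equiv> (-1) powi (int n + 1) * q powi (int n ^ 2 - 2 * b * int n)"
  assumes n: "n > 0" and b: "1 \<le> b" "b \<le> int n"
    and gen: "appell_m_defined X (q powi (2 * int n ^ 2)) z'"
  shows "inverse q * mu_section n (b - 1) (inverse q) =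
     of_nat n * (- ((-1) powi b) * q powi (- (b ^ 2)) *
         appell_m X (q powi (2 * int n ^ 2)) z'
       + inverse q * Psi (int n) (b - 1) (inverse q) (- 1) z' (q ^ 2))"
proof -
  have neg: "(- inverse q) powi l = (-1) powi l * q powi (- l)" for l
    unfolding power_int_minus power_int_inverse[symmetric] by (simp flip: power_int_mult_distrib)
  have X_eq: "- ((q ^ 2) powi (choose2 (int n) - int n * (b - 1))) * (- inverse q) powi int n =
      X"
  proof -
    have "2 * (choose2 (int n) - int n * (b - 1)) + (- int n) = int n ^ 2 - 2 * b * int n"
      using choose2_double[of "int n"] by (simp add: algebra_simps power2_eq_square)
    then have "q powi (2 * (choose2 (int n) - int n * (b - 1))) * q powi (- int n) = q powi (int n ^ 2 - 2 * b * int n)"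
      by (metis power_int_add q_nz)
    then show ?thesis unfolding X_def powi_square neg by (simp add: power_int_add mult_ac)
  qed
  have C: "inverse q * ((q ^ 2) powi (- choose2 (b - 1 + 1)) * (- inverse q) powi (b - 1)) = - ((-1) powi b) * q powi (- (b ^ 2))"
  proof -
    have "- 1 + (2 * (- choose2 b) + (- (b - 1))) = - (b ^ 2)"
      using choose2_double[of b] by (simp add: algebra_simps power2_eq_square)
    then have "q powi (- 1) * (q powi (2 * (- choose2 b)) * q powi (- (b - 1))) = q powi (- (b ^ 2))"
      by (metis power_int_add q_nz)
    moreover have "(-1 :: complex) powi (b - 1) = - ((-1) powi b)" by (simp add: power_int_diff)
    ultimately show ?thesis unfolding powi_square neg by (simp add: power_int_minus mult_ac)
  qed
  have "mu_section n (b - 1) (inverse q) =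
     of_nat n * ((q ^ 2) powi (- choose2 (b - 1 + 1)) * (- inverse q) powi (b - 1) *
         appell_m X (q powi (2 * int n ^ 2)) z'
       + Psi (int n) (b - 1) (inverse q) (- 1) z' (q ^ 2))"
    using appell_m_multisection_square[OF n, of "b - 1" "inverse q" z'] gen b
    unfolding X_eq powi_square[of "int n ^ 2"] by simp
  then show ?thesis unfolding C[symmetric] by (simp add: algebra_simps)
qed

end

theorem theorem1p1:
  fixes q z' z'' :: complex and M a :: int
  assumes "0 < norm q" and "norm q < 1"
    and "M \<ge> 2" and "2 \<le> a" and "a \<le> M"
  shows
    "(even a \<and> even M \<and>
        appell_m_defined ((-1) powi (M div 2 + 1) * q powi (M^2 div 4 - (a * M) div 2))
          (q powi (M^2 div 2)) z' \<and>
        Psi_generic (M div 2) (a div 2 - 1) (inverse q) z' (q^2) \<longrightarrow>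
      Dbar a M q + Dbar (a - 1) M q =
        of_bool (a = M)
        + 2 * (-1) powi (a div 2) * q powi (- (a^2 div 4)) *
            appell_m ((-1) powi (M div 2 + 1) * q powi (M^2 div 4 - (a * M) div 2))
              (q powi (M^2 div 2)) z'
        - 2 * inverse q * Psi (M div 2) (a div 2 - 1) (inverse q) (-1) z' (q^2)
        - 2 / of_int M *
            (\<Sum>j = 1..M - 1. zeta (M div 2) powi (- ((a * j) div 2)) * (1 - zeta M powi j) *
               Delta (zeta M powi (- 2 * j) * q) (zeta M powi j) (-1) (q^2)))
   \<and> (even a \<and> odd M \<and>
        appell_m_defined (q powi (M * (a - M))) (q powi (2 * M^2)) z' \<and>
        appell_m_defined (q powi (M * (a - 1))) (q powi (2 * M^2)) z'' \<and>
        Psi_generic M ((2 * M - a) div 2) q z' (q^2) \<and>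
        Psi_generic M ((M + 1 - a) div 2) q z'' (q^2) \<longrightarrow>
      Dbar a M q + Dbar (a - 1) M q =
        - 2 * q powi (- (((2 * M - a) div 2)^2)) * (-1) powi ((2 * M - a) div 2) *
            appell_m (q powi (M * (a - M))) (q powi (2 * M^2)) z'
        + 2 * q powi (- (((M + 1 - a) div 2)^2)) * (-1) powi ((M + 1 - a) div 2) *
            appell_m (q powi (M * (a - 1))) (q powi (2 * M^2)) z''
        - 2 * Psi M ((2 * M - a) div 2) q (-1) z' (q^2)
        + 2 * Psi M ((M + 1 - a) div 2) q (-1) z'' (q^2)
        - 2 / of_int M *
            (\<Sum>j = 1..M - 1. zeta M powi (- a * j) * (1 - zeta M powi j) *
               Delta (zeta M powi (- 2 * j) * q) (zeta M powi j) (-1) (q^2)))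
   \<and> (odd a \<and> odd M \<and>
        appell_m_defined (q powi (M * a)) (q powi (2 * M^2)) z' \<and>
        appell_m_defined (q powi (M * (a - M - 1))) (q powi (2 * M^2)) z'' \<and>
        Psi_generic M ((M - a) div 2) q z' (q^2) \<and>
        Psi_generic M ((2 * M - a + 1) div 2) q z'' (q^2) \<longrightarrow>
      Dbar a M q + Dbar (a - 1) M q =
        of_bool (a = M)
        - 2 * q powi (- (((M - a) div 2)^2)) * (-1) powi ((M - a) div 2) *
            appell_m (q powi (M * a)) (q powi (2 * M^2)) z'
        + 2 * q powi (- (((2 * M - a + 1) div 2)^2)) * (-1) powi ((2 * M - a + 1) div 2) *
            appell_m (q powi (M * (a - M - 1))) (q powi (2 * M^2)) z''
        - 2 * Psi M ((M - a) div 2) q (-1) z' (q^2)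
        + 2 * Psi M ((2 * M - a + 1) div 2) q (-1) z'' (q^2)
        - 2 / of_int M *
            (\<Sum>j = 1..M - 1. zeta M powi (- a * j) * (1 - zeta M powi j) *
               Delta (zeta M powi (- 2 * j) * q) (zeta M powi j) (-1) (q^2)))"
proof -
  interpret nome q using assms(1,2) by unfold_locales auto
  obtain N where M: "M = int N" using assms(3) by (metis nonneg_int_cases order_trans zero_le_numeral)
  have N: "N > 1" "N > 0" using assms(3) M by auto
  define D where "D = (\<Sum>j = 1..M - 1. zeta M powi (- a * j) * (1 - zeta M powi j) *
               Delta (zeta M powi (- 2 * j) * q) (zeta M powi j) (-1) (q^2))"
  define S where "S = (\<Sum>j<N. zeta M powi (- a * int j) * (1 - zeta M powi int j) * appell_m (zeta M powi (- 2 * int j) * q) (q ^ 2) (- 1))"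
  have main: "Dbar a M q + Dbar (a - 1) M q = of_bool (a = M) - 2 / of_nat N * S - 2 / of_int M * D"
    using Dbar_sum[OF N(1) assms(4)] assms(5) unfolding S_def D_def M by simp
  \<comment> \<open>The common form of (ii) and (iii): \<open>k1\<close> and \<open>k2\<close>
    represent \<open>a * (M - 1) / 2\<close> and \<open>(a - 1) * (M - 1) / 2\<close> modulo
    \<open>M\<close> in the range that the multisection demands.\<close>
  have odd: "Dbar a M q + Dbar (a - 1) M q = of_bool (a = M)
      - 2 * q powi (- (k1^2)) * (-1) powi k1 * appell_m (q powi x1) (q powi (2 * M^2)) z'
      + 2 * q powi (- (k2^2)) * (-1) powi k2 * appell_m (q powi x2) (q powi (2 * M^2)) z''
      - 2 * Psi M k1 q (-1) z' (q^2) + 2 * Psi M k2 q (-1) z'' (q^2) - 2 / of_int M * D"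
    if oddM: "odd M" and k1: "0 \<le> k1" "k1 < M" "M dvd a * ((M - 1) div 2) - k1" "x1 = M^2 - 2 * M * k1"
      and k2: "0 \<le> k2" "k2 < M" "M dvd (a - 1) * ((M - 1) div 2) - k2" "x2 = M^2 - 2 * M * k2"
      and gen: "appell_m_defined (q powi x1) (q powi (2 * M^2)) z'" "appell_m_defined (q powi x2) (q powi (2 * M^2)) z''"
    for k1 k2 x1 x2
  proof -
    let ?G = "\<lambda>k x z. q powi (- (k ^ 2)) * (-1) powi k * appell_m (q powi x) (q powi (2 * M ^ 2)) z + Psi M k q (- 1) z (q ^ 2)"
    have oddN: "odd N" using oddM M by simp
    have h: "2 * ((int N - 1) div 2) = int N - 1" using oddM M by simp
    have "S = mu_section N k1 q - mu_section N k2 q"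
      unfolding S_def M
      by (rule odd_section_sum[OF N(2) oddN h]) (use k1 k2 M in \<open>auto simp: cong_iff_dvd_diff\<close>)
    also have "mu_section N k1 q = of_nat N * ?G k1 x1 z'"
      unfolding M k1(4) by (rule odd_section[OF oddN]) (use k1 gen M in auto)
    also have "mu_section N k2 q = of_nat N * ?G k2 x2 z''"
      unfolding M k2(4) by (rule odd_section[OF oddN]) (use k2 gen M in auto)
    finally have S: "S = of_nat N * ?G k1 x1 z' - of_nat N * ?G k2 x2 z''" .
    have cancel: "2 / of_nat N * (of_nat N * A - of_nat N * B) = 2 * A - 2 * B" for A B :: complex
      using N(2) by (simp add: field_simps)
    show ?thesis unfolding main S cancel by (simp add: algebra_simps)
  qed
  show ?thesis
  proof ((intro conjI impI; elim conjE), goal_cases)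
    case 1
    note even = 1(1,2) and gen = 1(3)
    obtain b where b: "a = 2 * b" using even by blast
    obtain n where n: "N = 2 * n" using even M by auto
    have Mn: "M = 2 * int n" using M n by simp
    have n0: "n > 0" using n N by simp
    have div: "M div 2 = int n" "a div 2 = b" "M^2 div 4 = int n ^ 2" "(a * M) div 2 = 2 * b * int n"
      "M^2 div 2 = 2 * int n ^ 2" "a^2 div 4 = b ^ 2"
      unfolding Mn b by (simp_all add: power2_eq_square)
    \<comment> \<open>As \<open>a\<close> is even, \<open>a * j\<close> is halved without remainder,
      so the root of order \<open>M/2\<close> can be rewritten with the root of order
      \<open>M\<close>.\<close>
    have ajdiv: "zeta (M div 2) powi (- ((a * j) div 2)) = zeta M powi (- a * j)" for j
    proof -
      have "zeta (2 * int n) powi (2 * (- (b * j))) = zeta (int n) powi (- (b * j))"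
        using n0 by (intro zeta_double) simp
      then show ?thesis unfolding div(1) unfolding Mn b by (simp add: mult.assoc)
    qed
    let ?E = "- ((-1) powi b) * q powi (- (b ^ 2)) *
         appell_m ((-1) powi (int n + 1) * q powi (int n ^ 2 - 2 * b * int n)) (q powi (2 * int n ^ 2)) z'
       + inverse q * Psi (int n) (b - 1) (inverse q) (- 1) z' (q ^ 2)"
    have "S = 2 * (inverse q * mu_section n (b - 1) (inverse q))"
      unfolding S_def Mn b n using even_section_sum[OF n0, of b] by (simp add: mult.assoc)
    also have "\<dots> = 2 * (of_nat n * ?E)"
      by (subst even_section[OF n0]) (use gen assms b Mn in \<open>auto simp: div mult.assoc\<close>)
    finally have SS: "2 / of_nat N * S = 2 * ?E"
      using n0 unfolding n by simp
    show ?case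
      unfolding ajdiv unfolding D_def[symmetric] div main SS by (simp add: algebra_simps)
  next
    case 2
    note par = 2(1,2) and gen = 2(3,4)
    obtain b where b: "a = 2 * b" using par by blast
    obtain h where h: "M = 2 * h + 1" using par by (metis oddE)
    have div: "(2 * M - a) div 2 = M - b" "(M + 1 - a) div 2 = h + 1 - b" "(M - 1) div 2 = h"
      unfolding b h by auto
    \<comment> \<open>The parities differ, so the indicator is 0; the statement of (ii) has no such
      term.\<close>
    have "a \<noteq> M" using par by auto
    \<comment> \<open>With \<open>a = 2b\<close> and \<open>2h = M - 1\<close> one gets
      \<open>a h = b M - b\<close>, so \<open>a h\<close> and \<open>(a - 1) h\<close> have the
      representatives \<open>M - b\<close> and \<open>h + 1 - b\<close>.\<close>
    have d: "a * h - (M - b) = M * (b - 1)" "(a - 1) * h - (h + 1 - b) = M * (b - 1)"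
      unfolding b h by (simp_all add: algebra_simps)
    have dv: "M dvd a * ((M - 1) div 2) - (M - b)" "M dvd (a - 1) * ((M - 1) div 2) - (h + 1 - b)"
      unfolding div d by simp_all
    have x: "M * (a - M) = M^2 - 2 * M * (M - b)" "M * (a - 1) = M^2 - 2 * M * (h + 1 - b)"
      unfolding b h by (simp_all add: algebra_simps power2_eq_square)
    show ?case
      using odd[OF par(2) _ _ dv(1) x(1) _ _ dv(2) x(2) gen] assms b h
      unfolding div D_def using \<open>a \<noteq> M\<close> by simp
  next
    case 3
    note par = 3(1,2) and gen = 3(3,4)
    obtain b where b: "a = 2 * b + 1" using par by (metis oddE)
    obtain h where h: "M = 2 * h + 1" using par by (metis oddE)
    have div: "(M - a) div 2 = h - b" "(2 * M - a + 1) div 2 = M - b" "(M - 1) div 2 = h"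
      unfolding b h by auto
    \<comment> \<open>With \<open>a = 2b + 1\<close> the products are
      \<open>a h = b M + h - b\<close> and \<open>(a - 1) h = b M - b\<close>. Here
      \<open>b \<ge> 1\<close> because \<open>a \<ge> 2\<close>, so the representative
      \<open>M - b\<close> lies below \<open>M\<close>.\<close>
    have d: "a * h - (h - b) = M * b" "(a - 1) * h - (M - b) = M * (b - 1)"
      unfolding b h by (simp_all add: algebra_simps)
    have dv: "M dvd a * ((M - 1) div 2) - (h - b)" "M dvd (a - 1) * ((M - 1) div 2) - (M - b)"
      unfolding div d by simp_all
    have x: "M * a = M^2 - 2 * M * (h - b)" "M * (a - M - 1) = M^2 - 2 * M * (M - b)"
      unfolding b h by (simp_all add: algebra_simps power2_eq_square)
    show ?case
      using odd[OF par(2) _ _ dv(1) x(1) _ _ dv(2) x(2) gen] assms b h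
      unfolding div D_def by simp
  qed
qed

end
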